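(* Let $u(t)=S(t)u_0-\mathrm{i}\int_0^tS(t-r)\,\mathrm{d}W(r)$ be the mild solution of the linear stochastic Schr\"odinger equation $\mathrm{i}\,\mathrm{d}u-\Delta u\,\mathrm{d}t=\mathrm{d}W$ on $\mathbb{R}^d\times(0,\infty)$, $u(0)=u_0$, where $u_0$ is an $\mathcal{F}_0$-measurable $L^2$-valued random variable and $W$ is a $Q$-Wiener process. Let $H(u)=\frac12\int_{\mathbb{R}^d}|\nabla u|^2\,\mathrm{d}x$. Assume that $\mathbb{E}[H(u_0)]$ is finite and that $\|\nabla Q^{1/2}\|_{\mathcal{L}_2^0}$ is finite. Then $$\mathbb{E}[H(u(t))]=\mathbb{E}[H(u_0)]+\frac t2\,\mathrm{Tr}(\nabla Q\nabla)\qquad\text{for all }t\ge0.$$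
   Context: $d\ge1$ is arbitrary. $L^2=L^2(\mathbb{R}^d)$ is the space of complex-valued square integrable functions, with inner product $(u,v)=\mathrm{Re}\int_{\mathbb{R}^d}u\bar v\,\mathrm{d}x$. $S(t)=\mathrm{e}^{-\mathrm{i}t\Delta}$ is the unitary group generated by $-\mathrm{i}\Delta$. $(\Omega,\mathcal{F},\mathbb{P},\{\mathcal{F}_t\}_{t\ge0})$ is a filtered probability space with a normal filtration; $Q$ is a nonnegative self-adjoint trace-class operator on $L^2$, and $W$ is a complex-valued (i.e. $L^2$-valued), square integrable $Q$-Wiener process with respect to $\{\mathcal{F}_t\}$, so $W(t)=\sum_j\beta_j(t)Q^{1/2}e_j$ for an orthonormal basis $(e_j)$ of $L^2$ and independent standard real Brownian motions $\beta_j$. $\|\nabla Q^{1/2}\|_{\mathcal{L}_2^0}$ is the Hilbert--Schmidt norm, $\|\nabla Q^{1/2}\|_{\mathcal{L}_2^0}^2=\sum_j\|\nabla Q^{1/2}e_j\|_{L^2}^2$, and the notation $\mathrm{Tr}(\nabla Q\nabla)$ stands for $\|\nabla Q^{1/2}\|_{\mathcal{L}_2^0}^2$. *)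

theory Defs
  imports "HOL-Probability.Probability"
begin

section \<open>The real Hilbert space of square integrable complex functions\<close>

definition square_integrable :: "(real^'d \<Rightarrow> complex) \<Rightarrow> bool" where
  "square_integrable f \<longleftrightarrow>
     f \<in> borel_measurable lborel \<and> integrable lborel (\<lambda>x. (cmod (f x))\<^sup>2)"

definition L2rel :: "(real^'d \<Rightarrow> complex) \<Rightarrow> (real^'d \<Rightarrow> complex) \<Rightarrow> bool" where
  "L2rel f g \<longleftrightarrow> square_integrable f \<and> square_integrable g \<and> (AE x in lborel. f x = g x)"

lemma square_integrable_zero [simp]: "square_integrable (\<lambda>x. 0)"
  by (simp add: square_integrable_def)

lemma square_integrable_mult:
  assumes "square_integrable f"
  shows "square_integrable (\<lambda>x. c * f x)"
  using assms by (auto simp: square_integrable_def norm_mult power_mult_distrib)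

lemma square_integrable_prod:
  assumes "square_integrable f" "square_integrable g"
  shows "integrable lborel (\<lambda>x. f x * cnj (g x))"
proof (rule Bochner_Integration.integrable_bound)
  show "integrable lborel (\<lambda>x. (cmod (f x))\<^sup>2 + (cmod (g x))\<^sup>2)"
    using assms by (auto simp: square_integrable_def)
  have [measurable]: "f \<in> borel_measurable lborel" "g \<in> borel_measurable lborel"
    using assms by (auto simp: square_integrable_def)
  have "(\<lambda>x. cnj (g x)) \<in> borel_measurable lborel"
    by (rule borel_measurable_continuous_on[OF continuous_on_cnj]) (auto intro: continuous_on_id)
  then show "(\<lambda>x. f x * cnj (g x)) \<in> borel_measurable lborel"
    by (intro borel_measurable_times) auto
  have "a * b \<le> a\<^sup>2 + b\<^sup>2" if "0 \<le> a" "0 \<le> b" for a b :: real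
    using sum_squares_bound[of a b] mult_nonneg_nonneg[OF that] by linarith
  then show "AE x in lborel. norm (f x * cnj (g x)) \<le> norm ((cmod (f x))\<^sup>2 + (cmod (g x))\<^sup>2)"
    by (auto simp: norm_mult)
qed

lemma square_integrable_add:
  assumes "square_integrable f" "square_integrable g"
  shows "square_integrable (\<lambda>x. f x + g x)"
  unfolding square_integrable_def
proof
  have [measurable]: "f \<in> borel_measurable lborel" "g \<in> borel_measurable lborel"
    using assms by (auto simp: square_integrable_def)
  show "(\<lambda>x. f x + g x) \<in> borel_measurable lborel"
    by measurable
  show "integrable lborel (\<lambda>x. (cmod (f x + g x))\<^sup>2)"
  proof (rule Bochner_Integration.integrable_bound)
    show "integrable lborel (\<lambda>x. 2 * (cmod (f x))\<^sup>2 + 2 * (cmod (g x))\<^sup>2)"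
      using assms by (auto simp: square_integrable_def)
    have "(cmod (a + b))\<^sup>2 \<le> 2 * (cmod a)\<^sup>2 + 2 * (cmod b)\<^sup>2" for a b
    proof -
      have "(cmod (a + b))\<^sup>2 \<le> (cmod a + cmod b)\<^sup>2"
        by (intro power_mono norm_triangle_ineq) auto
      also have "\<dots> \<le> 2 * (cmod a)\<^sup>2 + 2 * (cmod b)\<^sup>2"
        using sum_squares_bound[of "cmod a" "cmod b"] by (simp add: power2_sum)
      finally show ?thesis .
    qed
    then show "AE x in lborel. norm ((cmod (f x + g x))\<^sup>2)
        \<le> norm (2 * (cmod (f x))\<^sup>2 + 2 * (cmod (g x))\<^sup>2)"
      by auto
  qed measurable
qed

lemma part_equivp_L2rel: "part_equivp L2rel"
proof (rule part_equivpI)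
  show "\<exists>f. L2rel f f"
    by (rule exI[of _ "\<lambda>x. 0"]) (simp add: L2rel_def)
  show "symp L2rel"
    by (rule sympI) (auto simp: L2rel_def elim: AE_mp)
  show "transp L2rel"
    by (rule transpI) (auto simp: L2rel_def)
qed

quotient_type 'd L2 = "real^'d::finite \<Rightarrow> complex" / partial: L2rel
  by (rule part_equivp_L2rel)

lift_definition cscale :: "complex \<Rightarrow> 'd::finite L2 \<Rightarrow> 'd L2" (infixr "*\<^sub>C" 75)
  is "\<lambda>c f x. c * f x"
  by (auto simp: L2rel_def square_integrable_mult)

text \<open>The inner product is the real one, \<open>Re \<integral> u cnj(v)\<close>. Orthonormality, adjoints and
  covariances below refer to it, so operators (in particular the covariance operator) are only
  required to be real linear.\<close>

instantiation L2 :: (finite) real_inner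
begin

lift_definition zero_L2 :: "'a L2" is "\<lambda>x. 0"
  by (simp add: L2rel_def)

lift_definition plus_L2 :: "'a L2 \<Rightarrow> 'a L2 \<Rightarrow> 'a L2" is "\<lambda>f g x. f x + g x"
  by (auto simp: L2rel_def square_integrable_add)

definition uminus_L2 :: "'a L2 \<Rightarrow> 'a L2" where
  "uminus_L2 u = (-1) *\<^sub>C u"

definition minus_L2 :: "'a L2 \<Rightarrow> 'a L2 \<Rightarrow> 'a L2" where
  "minus_L2 u v = u + - v"

definition scaleR_L2 :: "real \<Rightarrow> 'a L2 \<Rightarrow> 'a L2" where
  "scaleR_L2 a u = complex_of_real a *\<^sub>C u"

lift_definition inner_L2 :: "'a L2 \<Rightarrow> 'a L2 \<Rightarrow> real"
  is "\<lambda>f g. Re (\<integral>x. f x * cnj (g x) \<partial>lborel)"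
proof -
  fix f f' g g' :: "real^'a \<Rightarrow> complex"
  assume r: "L2rel f f'" "L2rel g g'"
  have "(\<integral>x. f x * cnj (g x) \<partial>lborel) = (\<integral>x. f' x * cnj (g' x) \<partial>lborel)"
    using r square_integrable_prod[of f g] square_integrable_prod[of f' g']
    by (intro integral_cong_AE) (auto simp: L2rel_def)
  then show "Re (\<integral>x. f x * cnj (g x) \<partial>lborel) = Re (\<integral>x. f' x * cnj (g' x) \<partial>lborel)"
    by simp
qed

definition norm_L2 :: "'a L2 \<Rightarrow> real" where
  "norm_L2 u = sqrt (inner u u)"

definition dist_L2 :: "'a L2 \<Rightarrow> 'a L2 \<Rightarrow> real" where
  "dist_L2 u v = norm (u - v)"

definition sgn_L2 :: "'a L2 \<Rightarrow> 'a L2" where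
  "sgn_L2 u = inverse (norm u) *\<^sub>R u"

definition uniformity_L2 :: "('a L2 \<times> 'a L2) filter" where
  "uniformity_L2 = (INF e\<in>{0<..}. principal {(x, y). dist x y < e})"

definition open_L2 :: "'a L2 set \<Rightarrow> bool" where
  "open_L2 U = (\<forall>x\<in>U. \<forall>\<^sub>F (x', y) in uniformity. x' = x \<longrightarrow> y \<in> U)"

instance
proof
  fix u v w :: "'a L2" and a b :: real
  show "u + v + w = u + (v + w)"
    by transfer (auto simp: L2rel_def square_integrable_add add.assoc)
  show "u + v = v + u"
    by transfer (auto simp: L2rel_def square_integrable_add add.commute)
  show "0 + u = u"
    by transfer (auto simp: L2rel_def)
  show "- u + u = 0"
    unfolding uminus_L2_def
    by transfer (auto simp: L2rel_def square_integrable_zero)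
  show "u - v = u + - v"
    by (simp add: minus_L2_def)
  show "a *\<^sub>R (u + v) = a *\<^sub>R u + a *\<^sub>R v"
    unfolding scaleR_L2_def
    by transfer (auto simp: L2rel_def distrib_left
        intro!: square_integrable_add square_integrable_mult)
  show "(a + b) *\<^sub>R u = a *\<^sub>R u + b *\<^sub>R u"
    unfolding scaleR_L2_def
    by transfer (auto simp: L2rel_def distrib_right
        intro!: square_integrable_add square_integrable_mult)
  show "a *\<^sub>R b *\<^sub>R u = (a * b) *\<^sub>R u"
    unfolding scaleR_L2_def
    by transfer (auto simp: L2rel_def square_integrable_mult mult.assoc
        intro!: square_integrable_mult)
  show "1 *\<^sub>R u = u"
    unfolding scaleR_L2_def by transfer (auto simp: L2rel_def)
  show "sgn u = inverse (norm u) *\<^sub>R u"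
    by (simp add: sgn_L2_def)
  show "dist u v = norm (u - v)"
    by (simp add: dist_L2_def)
  show "uniformity = (INF e\<in>{0<..}. principal {(x, y). dist x (y :: 'a L2) < e})"
    by (simp add: uniformity_L2_def)
  show "open U = (\<forall>x\<in>U. \<forall>\<^sub>F (x', y) in uniformity. x' = x \<longrightarrow> y \<in> U)" for U :: "'a L2 set"
    by (simp add: open_L2_def)
  show "inner u v = inner v u"
  proof transfer
    fix f g :: "real^'a \<Rightarrow> complex"
    assume "L2rel f f" "L2rel g g"
    then have "integrable lborel (\<lambda>x. f x * cnj (g x))" "integrable lborel (\<lambda>x. g x * cnj (f x))"
      by (simp_all add: L2rel_def square_integrable_prod)
    then show "Re (\<integral>x. f x * cnj (g x) \<partial>lborel) = Re (\<integral>x. g x * cnj (f x) \<partial>lborel)"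
      by (simp add: integral_Re[symmetric] mult.commute del: integral_Re)
  qed
  show "inner (u + v) w = inner u w + inner v w"
    by transfer (simp add: L2rel_def distrib_right square_integrable_prod)
  show "inner (a *\<^sub>R u) v = a * inner u v"
    unfolding scaleR_L2_def
    by transfer (simp add: L2rel_def mult.assoc)
  have *: "Re (\<integral>x. f x * cnj (f x) \<partial>lborel) = (\<integral>x. (cmod (f x))\<^sup>2 \<partial>lborel)"
    for f :: "real^'a \<Rightarrow> complex"
    by (simp add: complex_norm_square[symmetric] del: of_real_power)
  show "0 \<le> inner u u"
    by transfer (simp add: *)
  show "inner u u = 0 \<longleftrightarrow> u = 0"
    by transfer (auto simp: * L2rel_def square_integrable_def integral_nonneg_eq_0_iff_AE)
  show "norm u = sqrt (inner u u)"
    by (simp add: norm_L2_def)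
qed

end

definition orthonormal_basis :: "(nat \<Rightarrow> 'd::finite L2) \<Rightarrow> bool" where
  "orthonormal_basis e \<longleftrightarrow>
     (\<forall>i j. inner (e i) (e j) = (if i = j then 1 else 0)) \<and> closure (span (range e)) = UNIV"

section \<open>Operators on the Hilbert space\<close>

definition nonneg_selfadjoint :: "('d::finite L2 \<Rightarrow> 'd L2) \<Rightarrow> bool" where
  "nonneg_selfadjoint T \<longleftrightarrow> bounded_linear T \<and>
     (\<forall>u v. inner (T u) v = inner u (T v)) \<and> (\<forall>u. 0 \<le> inner (T u) u)"

text \<open>Nuclear representation, the usual definition of trace class operators.\<close>

definition trace_class :: "('d::finite L2 \<Rightarrow> 'd L2) \<Rightarrow> bool" where
  "trace_class T \<longleftrightarrow> (\<exists>a b :: nat \<Rightarrow> 'd L2. summable (\<lambda>k. norm (a k) * norm (b k)) \<and>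
     (\<forall>u. (\<lambda>k. inner (a k) u *\<^sub>R b k) sums T u))"

definition is_op_sqrt :: "('d::finite L2 \<Rightarrow> 'd L2) \<Rightarrow> ('d L2 \<Rightarrow> 'd L2) \<Rightarrow> bool" where
  "is_op_sqrt R Q \<longleftrightarrow> nonneg_selfadjoint R \<and> R \<circ> R = Q"

section \<open>Weak derivatives\<close>

definition pd :: "'d::finite \<Rightarrow> (real^'d \<Rightarrow> real) \<Rightarrow> real^'d \<Rightarrow> real" where
  "pd i f x = frechet_derivative f (at x) (axis i 1)"

text \<open>A function is smooth iff all its iterated partial derivatives are (Frechet)
  differentiable everywhere.\<close>

definition test_function :: "(real^'d::finite \<Rightarrow> real) \<Rightarrow> bool" where
  "test_function \<phi> \<longleftrightarrow>
     (\<forall>js x. foldr pd js \<phi> differentiable (at x)) \<and> compact (closure {x. \<phi> x \<noteq> 0})"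

text \<open>The distributional pairing of \<open>u\<close> with a real test function; it does not depend
  on the representative.\<close>

definition test_pairing :: "'d::finite L2 \<Rightarrow> (real^'d \<Rightarrow> real) \<Rightarrow> complex" where
  "test_pairing u \<phi> = (\<integral>x. rep_L2 u x * complex_of_real (\<phi> x) \<partial>lborel)"

definition weak_gradient :: "'d::finite L2 \<Rightarrow> ('d \<Rightarrow> 'd L2) \<Rightarrow> bool" where
  "weak_gradient u g \<longleftrightarrow>
     (\<forall>i \<phi>. test_function \<phi> \<longrightarrow> test_pairing u (pd i \<phi>) = - test_pairing (g i) \<phi>)"

definition weak_laplacian :: "'d::finite L2 \<Rightarrow> 'd L2 \<Rightarrow> bool" where
  "weak_laplacian u f \<longleftrightarrow>
     (\<forall>\<phi>. test_function \<phi> \<longrightarrow>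
        test_pairing u (\<lambda>x. \<Sum>i\<in>UNIV. pd i (pd i \<phi>) x) = test_pairing f \<phi>)"

text \<open>\<open>grad_norm_sq u\<close> is the squared norm of the gradient of \<open>u\<close> in the space of
  square integrable vector fields, infinite if \<open>u\<close> is not in the first Sobolev space.\<close>

definition grad_norm_sq :: "'d::finite L2 \<Rightarrow> ennreal" where
  "grad_norm_sq u =
     (if \<exists>g. weak_gradient u g
      then ennreal (\<Sum>i\<in>UNIV. (norm ((THE g. weak_gradient u g) i))\<^sup>2) else \<infinity>)"

definition energy :: "'d::finite L2 \<Rightarrow> ennreal" where
  "energy u = ennreal (1/2) * grad_norm_sq u"

text \<open>For an orthonormal basis \<open>e\<close>, the squared Hilbert-Schmidt norm of the composition of
  the gradient with \<open>R\<close>.\<close>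

definition grad_HS_sq :: "('d::finite L2 \<Rightarrow> 'd L2) \<Rightarrow> (nat \<Rightarrow> 'd L2) \<Rightarrow> ennreal" where
  "grad_HS_sq R e = (\<Sum>j. grad_norm_sq (R (e j)))"

section \<open>The Schroedinger group\<close>

definition unitary_group :: "(real \<Rightarrow> 'd::finite L2 \<Rightarrow> 'd L2) \<Rightarrow> bool" where
  "unitary_group S \<longleftrightarrow>
     (\<forall>t u v. S t (u + v) = S t u + S t v) \<and> (\<forall>t c u. S t (c *\<^sub>C u) = c *\<^sub>C S t u) \<and>
     (\<forall>t u. norm (S t u) = norm u) \<and>
     S 0 = id \<and> (\<forall>s t. S (s + t) = S s \<circ> S t) \<and> (\<forall>u. continuous_on UNIV (\<lambda>t. S t u))"

definition is_generator ::
  "('d::finite L2 \<Rightarrow> 'd L2 \<Rightarrow> bool) \<Rightarrow> (real \<Rightarrow> 'd L2 \<Rightarrow> 'd L2) \<Rightarrow> bool" where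
  "is_generator A S \<longleftrightarrow>
     (\<forall>u v. A u v \<longleftrightarrow> ((\<lambda>h. (S h u - u) /\<^sub>R h) \<longlongrightarrow> v) (at 0))"

text \<open>The graph of \<open>- \<i> \<Delta>\<close>, whose domain consists of those \<open>u\<close> with \<open>\<Delta> u\<close> square
  integrable, i.e. of the second Sobolev space.\<close>

definition minus_i_laplacian :: "'d::finite L2 \<Rightarrow> 'd L2 \<Rightarrow> bool" where
  "minus_i_laplacian u v \<longleftrightarrow> (\<exists>f. weak_laplacian u f \<and> v = (- \<i>) *\<^sub>C f)"

definition schroedinger_group :: "(real \<Rightarrow> 'd::finite L2 \<Rightarrow> 'd L2) \<Rightarrow> bool" where
  "schroedinger_group S \<longleftrightarrow> unitary_group S \<and> is_generator minus_i_laplacian S"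

section \<open>Wiener processes and the stochastic integral\<close>

text \<open>Completeness of the filtration is the requirement that all null events belong to \<open>F 0\<close>;
  the index type is \<open>real\<close>, but only nonnegative times matter.\<close>

definition normal_filtration :: "'a measure \<Rightarrow> (real \<Rightarrow> 'a measure) \<Rightarrow> bool" where
  "normal_filtration M F \<longleftrightarrow>
     (\<forall>t\<ge>0. subalgebra M (F t)) \<and>
     (\<forall>s t. 0 \<le> s \<longrightarrow> s \<le> t \<longrightarrow> sets (F s) \<subseteq> sets (F t)) \<and>
     (\<forall>t\<ge>0. sets (F t) = (\<Inter>s\<in>{t<..}. sets (F s))) \<and>
     null_sets M \<subseteq> sets (F 0)"

text \<open>The centred normal law on the line with variance \<open>v\<close>, degenerate for \<open>v = 0\<close>.\<close>

definition centred_normal :: "real \<Rightarrow> real measure" where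
  "centred_normal v =
     (if v = 0 then return borel 0 else density lborel (normal_density 0 (sqrt v)))"

definition Q_wiener ::
  "'a measure \<Rightarrow> (real \<Rightarrow> 'a measure) \<Rightarrow> ('d::finite L2 \<Rightarrow> 'd L2) \<Rightarrow> (real \<Rightarrow> 'a \<Rightarrow> 'd L2) \<Rightarrow> bool"
  where
  "Q_wiener M F Q W \<longleftrightarrow>
     (\<forall>t\<ge>0. W t \<in> borel_measurable (F t)) \<and>
     (AE \<omega> in M. W 0 \<omega> = 0) \<and>
     (AE \<omega> in M. continuous_on {0..} (\<lambda>t. W t \<omega>)) \<and>
     (\<forall>s t. 0 \<le> s \<longrightarrow> s \<le> t \<longrightarrow>
        prob_space.indep_set M (sets (F s))
          {(\<lambda>\<omega>. W t \<omega> - W s \<omega>) -` B \<inter> space M | B. B \<in> sets borel}) \<and>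
     (\<forall>s t h. 0 \<le> s \<longrightarrow> s \<le> t \<longrightarrow>
        distr M borel (\<lambda>\<omega>. inner (W t \<omega> - W s \<omega>) h) = centred_normal ((t - s) * inner (Q h) h))"

text \<open>Elementary processes on \<open>[0, t]\<close>: there is a partition \<open>0 = \<tau> 0 < \<dots> < \<tau> n = t\<close>, and on
  \<open>(\<tau> k, \<tau> (k + 1)]\<close> the process is equal to the operator valued random variable \<open>\<Phi> k\<close>, which
  takes finitely many values and is measurable at time \<open>\<tau> k\<close>.\<close>

definition elementary ::
  "(real \<Rightarrow> 'a measure) \<Rightarrow> real \<Rightarrow> nat \<Rightarrow> (nat \<Rightarrow> real)
     \<Rightarrow> (nat \<Rightarrow> 'a \<Rightarrow> 'd::finite L2 \<Rightarrow>\<^sub>L 'd L2) \<Rightarrow> bool" where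
  "elementary F t n \<tau> \<Phi> \<longleftrightarrow>
     \<tau> 0 = 0 \<and> \<tau> n = t \<and> (\<forall>k<n. \<tau> k < \<tau> (Suc k)) \<and> (\<forall>k<n. simple_function (F (\<tau> k)) (\<Phi> k))"

definition elementary_process ::
  "nat \<Rightarrow> (nat \<Rightarrow> real) \<Rightarrow> (nat \<Rightarrow> 'a \<Rightarrow> 'd::finite L2 \<Rightarrow>\<^sub>L 'd L2) \<Rightarrow> real \<Rightarrow> 'a \<Rightarrow> 'd L2 \<Rightarrow> 'd L2"
  where
  "elementary_process n \<tau> \<Phi> r \<omega> u =
     (\<Sum>k<n. indicator {\<tau> k<..\<tau> (Suc k)} r *\<^sub>R blinfun_apply (\<Phi> k \<omega>) u)"

definition elementary_integral ::
  "(real \<Rightarrow> 'a \<Rightarrow> 'd::finite L2) \<Rightarrow> nat \<Rightarrow> (nat \<Rightarrow> real)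
     \<Rightarrow> (nat \<Rightarrow> 'a \<Rightarrow> 'd L2 \<Rightarrow>\<^sub>L 'd L2) \<Rightarrow> 'a \<Rightarrow> 'd L2" where
  "elementary_integral W n \<tau> \<Phi> \<omega> =
     (\<Sum>k<n. blinfun_apply (\<Phi> k \<omega>) (W (\<tau> (Suc k)) \<omega> - W (\<tau> k) \<omega>))"

text \<open>The square of the distance in which elementary processes approximate integrands:
  \<open>E \<integral>\<^sub>0\<^sup>t \<parallel>(\<Phi> r - \<Psi> r) R\<parallel>\<^sup>2 dr\<close> with the Hilbert-Schmidt norm, computed in the orthonormal
  basis \<open>e\<close>; here \<open>R\<close> is the square root of the covariance operator.\<close>

definition integrand_dist_sq ::
  "'a measure \<Rightarrow> ('d::finite L2 \<Rightarrow> 'd L2) \<Rightarrow> (nat \<Rightarrow> 'd L2) \<Rightarrow> real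
     \<Rightarrow> (real \<Rightarrow> 'a \<Rightarrow> 'd L2 \<Rightarrow> 'd L2) \<Rightarrow> (real \<Rightarrow> 'a \<Rightarrow> 'd L2 \<Rightarrow> 'd L2) \<Rightarrow> ennreal" where
  "integrand_dist_sq M R e t \<Phi> \<Psi> =
     (\<integral>\<^sup>+\<omega>. (\<integral>\<^sup>+r\<in>{0..t}.
        (\<Sum>j. ennreal ((norm (\<Phi> r \<omega> (R (e j)) - \<Psi> r \<omega> (R (e j))))\<^sup>2)) \<partial>lborel) \<partial>M)"

text \<open>\<open>I\<close> is (a version of) the Ito integral of \<open>\<Phi>\<close> over \<open>[0, t]\<close> with respect to the Wiener
  process \<open>W\<close>: the mean square limit of the integrals of elementary processes that approximate
  \<open>\<Phi>\<close>. By the Ito isometry, it does not depend on the approximating sequence.\<close>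

definition is_stochastic_integral ::
  "'a measure \<Rightarrow> (real \<Rightarrow> 'a measure) \<Rightarrow> ('d::finite L2 \<Rightarrow> 'd L2) \<Rightarrow> (nat \<Rightarrow> 'd L2)
     \<Rightarrow> (real \<Rightarrow> 'a \<Rightarrow> 'd L2) \<Rightarrow> real \<Rightarrow> (real \<Rightarrow> 'a \<Rightarrow> 'd L2 \<Rightarrow> 'd L2) \<Rightarrow> ('a \<Rightarrow> 'd L2) \<Rightarrow> bool"
  where
  "is_stochastic_integral M F R e W t \<Phi> I \<longleftrightarrow>
     I \<in> borel_measurable M \<and>
     (\<forall>j. (\<lambda>(r, \<omega>). \<Phi> r \<omega> (R (e j))) \<in> borel_measurable (restrict_space lborel {0..t} \<Otimes>\<^sub>M M)) \<and>
     (\<exists>n \<tau> \<Psi>. (\<forall>m. elementary F t (n m) (\<tau> m) (\<Psi> m)) \<and>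
        (\<lambda>m. integrand_dist_sq M R e t (elementary_process (n m) (\<tau> m) (\<Psi> m)) \<Phi>)
          \<longlonglongrightarrow> 0 \<and>
        (\<lambda>m. \<integral>\<^sup>+\<omega>. ennreal ((norm (elementary_integral W (n m) (\<tau> m) (\<Psi> m) \<omega> - I \<omega>))\<^sup>2) \<partial>M)
          \<longlonglongrightarrow> 0)"

definition mild_solution ::
  "'a measure \<Rightarrow> (real \<Rightarrow> 'a measure) \<Rightarrow> ('d::finite L2 \<Rightarrow> 'd L2) \<Rightarrow> (nat \<Rightarrow> 'd L2)
     \<Rightarrow> (real \<Rightarrow> 'a \<Rightarrow> 'd L2) \<Rightarrow> (real \<Rightarrow> 'd L2 \<Rightarrow> 'd L2) \<Rightarrow> ('a \<Rightarrow> 'd L2)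
     \<Rightarrow> (real \<Rightarrow> 'a \<Rightarrow> 'd L2) \<Rightarrow> bool" where
  "mild_solution M F R e W S u0 u \<longleftrightarrow>
     (\<forall>t\<ge>0. u t \<in> borel_measurable M \<and>
        (\<exists>I. is_stochastic_integral M F R e W t (\<lambda>r \<omega>. S (t - r)) I \<and>
           (AE \<omega> in M. u t \<omega> = S t (u0 \<omega>) - \<i> *\<^sub>C I \<omega>)))"

end

theory Submission
  imports Defs
begin

text \<open>The gradient is approximated by difference quotients. With dyadic steps \<open>2\<^sup>-\<^sup>n\<close> their norms increase
  with \<open>n\<close>, and the supremum of the sum of their squares over all directions is the squared norm of
  the weak gradient, infinite exactly if there is none. The generator of the Schroedinger group is
  invariant under translations; hence the group commutes with every difference quotient \<open>D\<close>. As \<open>D\<close>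
  is bounded, the Ito isometry, the independence of the increments from the initial value and
  the unitarity of the group give
  \<open>E \<parallel>D u(t)\<parallel>\<^sup>2 = E \<parallel>D u\<^sub>0\<parallel>\<^sup>2 + t \<Sum>\<^sub>j \<parallel>D R e\<^sub>j\<parallel>\<^sup>2\<close>.
  Summation over the directions and monotone convergence in \<open>n\<close> yield the claim.\<close>

text \<open>The gradient is unbounded: it need not act on the elementary integrals that approximate
  the stochastic integral, and mean square convergence does not control it. A difference quotient is
  bounded, so it applies to every approximant and passes to the limit. Only the energy of the
  initial value has finite mean by assumption, so \<open>u0\<close> itself may have an infinite
  second moment. The cross term with the noise is therefore removed only after a difference quotient
  has been applied to \<open>u0\<close>; its second moment is at most twice the mean energy. The
  group is known only through its generator. Its commutation with translations is derived from the
  skewness of the generator and from the fact that only zero is orthogonal to the domain, without a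
  Fourier representation. Halving the step is what the triangle inequality can compare; the
  resulting monotonicity lets suprema commute with expectations and series. Extended nonnegative
  values keep every identity meaningful before finiteness is known.\<close>

section \<open>Minimal norms, Riesz representation and Parseval identity\<close>

text \<open>By the parallelogram law, elements of nearly minimal norm in a decreasing sequence of convex sets
  form a Cauchy sequence.\<close>

lemma min_norm_nested_convex:
  fixes K :: "nat \<Rightarrow> 'a::{real_inner, complete_space} set"
  assumes conv: "\<And>n. convex (K n)" and dec: "\<And>m n. m \<le> n \<Longrightarrow> K n \<subseteq> K m"
    and bd: "\<And>n. \<exists>x\<in>K n. norm x \<le> b"
  obtains x l where "\<And>n. x n \<in> K n" "x \<longlonglongrightarrow> l" "norm l \<le> b"
    "\<And>y. (\<And>n. y \<in> K n) \<Longrightarrow> norm l \<le> norm y"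
proof -
  define d where "d n = (INF x\<in>K n. norm x)" for n
  have ne: "K n \<noteq> {}" for n using bd[of n] by auto
  have bb: "bdd_below (norm ` K n)" for n by (rule bdd_belowI2[of _ 0]) auto
  have dle: "d n \<le> norm y" if "y \<in> K n" for n y
    unfolding d_def using that bb by (intro cINF_lower) auto
  have db: "d n \<le> b" for n using bd[of n] dle by force
  have d0: "0 \<le> d n" for n unfolding d_def using ne by (intro cINF_greatest) auto
  have dm: "d m \<le> d n" if "m \<le> n" for m n
    unfolding d_def using ne[of n] dec[OF that] bb by (intro cINF_superset_mono) auto
  have "\<exists>x\<in>K n. norm x < d n + 1 / Suc n" for n
  proof -
    have "d n < d n + 1 / Suc n" by simp
    then show ?thesis
      using cINF_less_iff[OF ne bb, of n "d n + 1 / Suc n"] unfolding d_def by blast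
  qed
  then obtain x where x: "\<And>n. x n \<in> K n" and xd: "\<And>n. norm (x n) < d n + 1 / Suc n"
    by metis
  have "incseq d" using dm by (simp add: incseq_def)
  then obtain D where D: "d \<longlonglongrightarrow> D" using incseq_convergent[of d b] db by blast
  have "d n \<le> D" for n using \<open>incseq d\<close> D by (rule incseq_le)
  \<comment> \<open>The midpoint of \<open>x n\<close> and \<open>x m\<close> lies in
    \<open>K k\<close> by convexity, so \<open>norm (x n + x m)\<close> is at least
    \<open>2 * d k\<close>. As \<open>d k\<close> tends to \<open>D\<close>, the resulting bound
    tends to zero.\<close>
  have par: "(norm (x n - x m))\<^sup>2 \<le> 2 * (D + 1 / Suc k)\<^sup>2 + 2 * (D + 1 / Suc k)\<^sup>2 - 4 * (d k)\<^sup>2"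
    if "k \<le> n" "k \<le> m" for n m k
  proof -
    have xx: "(norm (x j))\<^sup>2 \<le> (D + 1 / Suc k)\<^sup>2" if "k \<le> j" for j
    proof -
      have "norm (x j) \<le> d j + 1 / Suc j" using xd[of j] by simp
      also have "\<dots> \<le> D + 1 / Suc k" using \<open>d j \<le> D\<close> that
        by (intro add_mono) (auto simp: frac_le)
      finally show ?thesis by (intro power_mono) auto
    qed
    have "(1/2) *\<^sub>R x n + (1/2) *\<^sub>R x m \<in> K k"
      using x[of n] x[of m] dec[OF that(1)] dec[OF that(2)]
      by (intro convexD[OF conv]) auto
    then have "d k \<le> norm ((1/2) *\<^sub>R x n + (1/2) *\<^sub>R x m)" by (rule dle)
    also have "\<dots> = norm (x n + x m) / 2"
      by (metis (no_types, opaque_lifting) scaleR_add_right norm_scaleR abs_of_nonneg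
          divide_nonneg_nonneg zero_le_one zero_le_numeral mult.left_neutral times_divide_eq_left)
    finally have "2 * d k \<le> norm (x n + x m)" by simp
    then have "(2 * d k)\<^sup>2 \<le> (norm (x n + x m))\<^sup>2" using d0[of k] by (intro power_mono) auto
    moreover have "(norm (x n - x m))\<^sup>2 = 2 * (norm (x n))\<^sup>2 + 2 * (norm (x m))\<^sup>2 - (norm (x n + x m))\<^sup>2"
      by (simp add: power2_norm_eq_inner inner_diff inner_add inner_commute algebra_simps)
    ultimately show ?thesis using xx[OF that(1)] xx[OF that(2)] by (simp add: power_mult_distrib)
  qed
  have lim: "(\<lambda>k. 2 * (D + 1 / Suc k)\<^sup>2 + 2 * (D + 1 / Suc k)\<^sup>2 - 4 * (d k)\<^sup>2)
      \<longlonglongrightarrow> 2 * (D + 0)\<^sup>2 + 2 * (D + 0)\<^sup>2 - 4 * D\<^sup>2"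
    by (intro tendsto_intros D LIMSEQ_Suc[OF lim_1_over_n])
  have "Cauchy x"
  proof (rule CauchyI)
    fix e :: real assume e: "e > 0"
    have "eventually (\<lambda>k. 2 * (D + 1 / Suc k)\<^sup>2 + 2 * (D + 1 / Suc k)\<^sup>2 - 4 * (d k)\<^sup>2 < e\<^sup>2) sequentially"
      using order_tendstoD(2)[OF lim, of "e\<^sup>2"] e by simp
    then obtain k where k: "2 * (D + 1 / Suc k)\<^sup>2 + 2 * (D + 1 / Suc k)\<^sup>2 - 4 * (d k)\<^sup>2 < e\<^sup>2"
      by (auto simp: eventually_sequentially)
    have "norm (x m - x n) < e" if "k \<le> m" "k \<le> n" for m n
      using par[OF that] k e by (meson le_less_trans power_less_imp_less_base less_imp_le)
    then show "\<exists>M. \<forall>m\<ge>M. \<forall>n\<ge>M. norm (x m - x n) < e" by blast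
  qed
  then obtain l where l: "x \<longlonglongrightarrow> l" by (auto simp: Cauchy_convergent_iff convergent_def)
  have up: "(\<lambda>n. d n + 1 / Suc n) \<longlonglongrightarrow> D + 0"
    by (intro tendsto_intros D LIMSEQ_Suc[OF lim_1_over_n])
  have "norm l \<le> D"
    using LIMSEQ_le[OF tendsto_norm[OF l] up] xd by (auto intro: less_imp_le)
  moreover have "D \<le> b" using LIMSEQ_le_const2[OF D] db by auto
  moreover have "D \<le> norm y" if "\<And>n. y \<in> K n" for y
    using LIMSEQ_le_const2[OF D] dle[OF that] by auto
  ultimately show ?thesis using that[of x l] x l by force
qed

text \<open>The squared norm of \<open>x + s *\<^sub>R y\<close> is quadratic in \<open>s\<close>.
  At its vertex it would fall below the value at \<open>s = 0\<close> unless the linear coefficient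
  vanishes.\<close>

lemma inner_eq_0_if_min_norm:
  fixes x y :: "'a::real_inner"
  assumes "\<And>s. norm x \<le> norm (x + s *\<^sub>R y)"
  shows "inner x y = 0"
proof (rule ccontr)
  assume ne: "inner x y \<noteq> 0"
  then have yy: "inner y y > 0" by auto
  define s where "s = - inner x y / inner y y"
  have "(norm x)\<^sup>2 \<le> (norm (x + s *\<^sub>R y))\<^sup>2" using assms by (intro power_mono) auto
  then have "0 \<le> 2 * s * inner x y + s * s * inner y y"
    by (simp add: power2_norm_eq_inner inner_add inner_commute algebra_simps)
  also have "\<dots> = - (inner x y)\<^sup>2 / inner y y"
    using yy by (simp add: s_def field_simps power2_eq_square)
  also have "\<dots> < 0" using yy ne by (simp add: divide_neg_pos)
  finally show False by simp
qed

text \<open>The residual of \<open>v\<close> of minimal norm against \<open>T\<close> is orthogonal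
  to \<open>T\<close>, hence zero, so \<open>v\<close> is a limit of elements of \<open>T\<close>.
  The residual comes from the nested convex sets, taken constantly equal to
  \<open>v - T\<close>.\<close>

lemma closure_UNIV_if_orthogonal_trivial:
  fixes T :: "'a::{real_inner, complete_space} set"
  assumes sub: "subspace T" and triv: "\<And>v. (\<And>w. w \<in> T \<Longrightarrow> inner v w = 0) \<Longrightarrow> v = 0"
  shows "closure T = UNIV"
proof -
  have "v \<in> closure T" for v
  proof -
    obtain x l where x: "\<And>n::nat. x n \<in> (\<lambda>w. v - w) ` T" and l: "x \<longlonglongrightarrow> l"
      and min: "\<And>y. y \<in> (\<lambda>w. v - w) ` T \<Longrightarrow> norm l \<le> norm y"
    proof (rule min_norm_nested_convex[of "\<lambda>_. (\<lambda>w. v - w) ` T" "norm v"])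
      have "(\<lambda>w. v - w) ` T = (\<lambda>w. v + w) ` uminus ` T"
        by (auto simp: image_image)
      also have "convex \<dots>"
        using subspace_imp_convex[OF sub] by (metis convex_translation convex_negations)
      finally show "convex ((\<lambda>w. v - w) ` T)" .
      show "\<exists>x\<in>(-) v ` T. norm x \<le> norm v" using subspace_0[OF sub] by (intro bexI[of _ v]) force+
    qed auto
    have "inner l w = 0" if w: "w \<in> T" for w
    proof (rule inner_eq_0_if_min_norm)
      fix s
      \<comment> \<open>\<open>T\<close> need not be closed, so the limit \<open>l\<close> may lie
        outside \<open>v - T\<close>. The perturbation is made at \<open>x n\<close>, which does lie
        there, and the inequality then passes to the limit.\<close>
      have "norm l \<le> norm (x n + s *\<^sub>R w)" for n
      proof (rule min)
        obtain t where t: "t \<in> T" "x n = v - t" using x[of n] by auto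
        then have "x n + s *\<^sub>R w = v - (t - s *\<^sub>R w)" by simp
        then show "x n + s *\<^sub>R w \<in> (-) v ` T"
          using t w sub by (metis image_eqI subspace_diff subspace_scale)
      qed
      moreover have "(\<lambda>n. norm (x n + s *\<^sub>R w)) \<longlonglongrightarrow> norm (l + s *\<^sub>R w)"
        by (intro tendsto_intros l)
      ultimately show "norm l \<le> norm (l + s *\<^sub>R w)" by (meson LIMSEQ_le_const)
    qed
    then have "l = 0" by (rule triv)
    have "(\<lambda>n. v - x n) \<longlonglongrightarrow> v - 0" using l \<open>l = 0\<close> by (intro tendsto_intros) auto
    moreover have "v - x n \<in> T" for n using x[of n] by auto
    ultimately show ?thesis unfolding closure_sequential by force
  qed
  then show ?thesis by auto
qed

text \<open>The kernel of a nonzero functional is closed and proper, hence not dense, so some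
  nonzero \<open>v\<close> is orthogonal to it. Every \<open>x\<close> differs from a multiple of
  \<open>v\<close> by an element of the kernel, which determines the functional up to
  scaling.\<close>

lemma riesz_representation:
  fixes f :: "'a::{real_inner, complete_space} \<Rightarrow> real"
  assumes f: "bounded_linear f"
  obtains h where "\<And>x. f x = inner x h"
proof (cases "\<forall>x. f x = 0")
  case True
  then show ?thesis using that[of 0] by simp
next
  case False
  interpret bounded_linear f by (rule f)
  define T where "T = {x. f x = 0}"
  have sub: "subspace T" unfolding T_def
    by (auto simp: subspace_def add scaleR zero)
  have "closed T" unfolding T_def
    by (intro closed_Collect_eq continuous_on continuous_on_const linear_continuous_on f)
  then have "closure T \<noteq> UNIV" using False by (auto simp: T_def)
  then obtain v where v: "\<And>w. w \<in> T \<Longrightarrow> inner v w = 0" "v \<noteq> 0"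
    using closure_UNIV_if_orthogonal_trivial[OF sub] by metis
  have fv: "f v \<noteq> 0"
  proof
    assume "f v = 0"
    then have "inner v v = 0" using v(1)[of v] by (simp add: T_def)
    then show False using v(2) by simp
  qed
  have "f x = inner x ((f v / inner v v) *\<^sub>R v)" for x
  proof -
    have "x - (f x / f v) *\<^sub>R v \<in> T" using fv by (simp add: T_def diff scaleR)
    then have "inner v x = (f x / f v) * inner v v" using v(1) by (force simp: inner_diff)
    then show ?thesis using fv v(2) by (simp add: inner_commute)
  qed
  then show ?thesis by (rule that)
qed

text \<open>\<open>P n\<close> is the best approximation of \<open>x\<close> in the span of the
  first \<open>n\<close> basis vectors. An approximant from the dense span uses only finitely many
  of them, so it bounds the residual of \<open>P n\<close> for all large \<open>n\<close>; the
  squared residual is the deficit in Bessel's inequality.\<close>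

lemma parseval:
  fixes e :: "nat \<Rightarrow> 'a::real_inner"
  assumes on: "\<And>i j. inner (e i) (e j) = (if i = j then 1 else 0)"
    and dense: "closure (span (range e)) = UNIV"
  shows "(\<lambda>j. (inner x (e j))\<^sup>2) sums (norm x)\<^sup>2"
proof -
  define P where "P n = (\<Sum>j<n. inner x (e j) *\<^sub>R e j)" for n
  have ie: "inner (\<Sum>j<n. c j *\<^sub>R e j) (e k) = (if k < n then c k else 0)" for c n k
    by (simp add: inner_sum_left on if_distrib cong: if_cong)
  have xP: "(norm (x - P n))\<^sup>2 = (norm x)\<^sup>2 - (\<Sum>j<n. (inner x (e j))\<^sup>2)" for n
  proof -
    have "inner (P n) (P n) = (\<Sum>j<n. (inner x (e j))\<^sup>2)"
      by (subst (2) P_def) (simp add: P_def ie inner_sum_right power2_eq_square)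
    moreover have "inner x (P n) = (\<Sum>j<n. (inner x (e j))\<^sup>2)"
      by (simp add: P_def inner_sum_right power2_eq_square)
    ultimately show ?thesis by (simp add: power2_norm_eq_inner inner_diff inner_commute)
  qed
  \<comment> \<open>Pythagoras: the residual \<open>x - P n\<close> is orthogonal to
    \<open>P n - y\<close>.\<close>
  have best: "norm (x - P n) \<le> norm (x - y)" if y: "y \<in> span (e ` {..<n})" for y n
  proof -
    have "inner (x - P n) z = 0" if "z \<in> span (e ` {..<n})" for z
      using that
    proof (induction rule: span_induct)
      case base
      show ?case by (auto simp: subspace_def inner_add_right)
    next
      case (step w)
      then show ?case by (auto simp: inner_diff P_def ie)
    qed
    moreover have "P n - y \<in> span (e ` {..<n})"
      unfolding P_def by (intro span_diff y span_sum span_scale) (auto intro: span_base)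
    ultimately have o: "inner (x - P n) (P n - y) = 0" by blast
    have "x - y = (x - P n) + (P n - y)" by simp
    then have "(norm (x - y))\<^sup>2 = (norm (x - P n))\<^sup>2 + (norm (P n - y))\<^sup>2"
      using o by (metis norm_add_Pythagorean orthogonal_def)
    then have "(norm (x - P n))\<^sup>2 \<le> (norm (x - y))\<^sup>2" by simp
    then show ?thesis by (rule power2_le_imp_le) simp
  qed
  have "(\<lambda>n. \<Sum>j<n. (inner x (e j))\<^sup>2) \<longlonglongrightarrow> (norm x)\<^sup>2"
  proof (rule metric_LIMSEQ_I)
    fix r :: real assume r: "r > 0"
    obtain y where y: "y \<in> span (range e)" "dist y x < sqrt r"
      using dense closure_approachable[of x "span (range e)"] r by (metis UNIV_I real_sqrt_gt_zero)
    have "\<exists>N. y \<in> span (e ` {..<N})" using y(1)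
    proof (induction rule: span_induct_alt)
      case base
      show ?case by (auto intro: span_zero)
    next
      case (step c x y)
      then obtain k N where "x = e k" "y \<in> span (e ` {..<N})" by auto
      moreover have "span (e ` {..<N}) \<subseteq> span (e ` {..<max N (Suc k)})" by (intro span_mono) auto
      ultimately show ?case
        by (intro exI[of _ "max N (Suc k)"] span_add span_scale) (auto intro: span_base)
    qed
    then obtain N where N: "y \<in> span (e ` {..<N})" ..
    show "\<exists>no. \<forall>n\<ge>no. dist (\<Sum>j<n. (inner x (e j))\<^sup>2) ((norm x)\<^sup>2) < r"
    proof (intro exI[of _ N] allI impI)
      fix n assume "N \<le> n"
      then have "span (e ` {..<N}) \<subseteq> span (e ` {..<n})" by (intro span_mono) auto
      then have "norm (x - P n) < sqrt r" using best[of y n] N y(2)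
        by (auto simp: dist_norm norm_minus_commute)
      then have "(norm (x - P n))\<^sup>2 < (sqrt r)\<^sup>2" by (intro power_strict_mono) auto
      then show "dist (\<Sum>j<n. (inner x (e j))\<^sup>2) ((norm x)\<^sup>2) < r"
        using xP[of n] r zero_le_power2[of "norm (x - P n)"] by (simp add: dist_real_def)
    qed
  qed
  then show ?thesis by (simp add: sums_def)
qed

section \<open>Completeness of the Hilbert space\<close>

abbreviation L2_of :: "(real^'d::finite \<Rightarrow> complex) \<Rightarrow> 'd L2" where
  "L2_of \<equiv> abs_L2"

lemma square_integrable_rep [simp]: "square_integrable (rep_L2 u)"
  using Quotient3_rep_reflp[OF Quotient3_L2, of u] by (simp add: L2rel_def)

lemma rep_L2_of: "square_integrable f \<Longrightarrow> AE x in lborel. rep_L2 (L2_of f) x = f x"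
  using Quotient3_rep_abs[OF Quotient3_L2, of f] by (simp add: L2rel_def)

lemma L2_of_rep [simp]: "L2_of (rep_L2 u) = u"
  by (rule Quotient3_abs_rep[OF Quotient3_L2])

lemma L2_of_eqI: "L2rel f g \<Longrightarrow> L2_of f = L2_of g"
  by (rule Quotient3_rel_abs[OF Quotient3_L2])

lemma square_integrable_measurable [measurable_dest]:
  "square_integrable f \<Longrightarrow> f \<in> borel_measurable borel"
  by (simp add: square_integrable_def)

lemma rep_measurable [measurable]: "rep_L2 u \<in> borel_measurable borel"
  by (rule square_integrable_measurable) simp

lemma L2_of_plus:
  "square_integrable f \<Longrightarrow> square_integrable g \<Longrightarrow> L2_of f + L2_of g = L2_of (\<lambda>x. f x + g x)"
  by (rule plus_L2.abs_eq) (auto simp: L2rel_def)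

lemma cscale_L2_of: "square_integrable f \<Longrightarrow> c *\<^sub>C L2_of f = L2_of (\<lambda>x. c * f x)"
  by (rule cscale.abs_eq) (auto simp: L2rel_def)

lemma scaleR_L2_of: "square_integrable f \<Longrightarrow> r *\<^sub>R L2_of f = L2_of (\<lambda>x. complex_of_real r * f x)"
  by (simp add: scaleR_L2_def cscale_L2_of)

lemma L2_of_diff:
  assumes "square_integrable f" "square_integrable g"
  shows "L2_of f - L2_of g = L2_of (\<lambda>x. f x - g x)"
proof -
  have "square_integrable (\<lambda>x. -1 * g x)" using assms(2) by (rule square_integrable_mult)
  then show ?thesis using assms
    by (simp add: minus_L2_def uminus_L2_def cscale_L2_of L2_of_plus)
qed

lemma rep_diff: "AE x in lborel. rep_L2 (u - v) x = rep_L2 u x - rep_L2 v x"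
proof -
  have "square_integrable (\<lambda>x. rep_L2 u x + (-1) * rep_L2 v x)"
    by (intro square_integrable_add square_integrable_mult square_integrable_rep)
  then have *: "square_integrable (\<lambda>x. rep_L2 u x - rep_L2 v x)" by simp
  show ?thesis using rep_L2_of[OF *] L2_of_diff[of "rep_L2 u" "rep_L2 v"] by simp
qed

lemma inner_L2_of:
  assumes "square_integrable f"
  shows "inner u (L2_of f) = Re (\<integral>x. rep_L2 u x * cnj (f x) \<partial>lborel)"
proof -
  have "inner (L2_of (rep_L2 u)) (L2_of f) = Re (\<integral>x. rep_L2 u x * cnj (f x) \<partial>lborel)"
    using assms by (intro inner_L2.abs_eq) (auto simp: L2rel_def)
  then show ?thesis by simp
qed

lemma ennreal_norm_L2_of:
  assumes "square_integrable f"
  shows "ennreal ((norm (L2_of f))\<^sup>2) = (\<integral>\<^sup>+x. ennreal ((cmod (f x))\<^sup>2) \<partial>lborel)"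
proof -
  have "inner (L2_of f) (L2_of f) = Re (\<integral>x. f x * cnj (f x) \<partial>lborel)"
    using assms by (intro inner_L2.abs_eq) (auto simp: L2rel_def)
  also have "\<dots> = (\<integral>x. (cmod (f x))\<^sup>2 \<partial>lborel)"
    by (simp add: complex_norm_square[symmetric] del: of_real_power)
  finally show ?thesis using assms
    by (subst nn_integral_eq_integral) (auto simp: power2_norm_eq_inner square_integrable_def)
qed

lemma ennreal_norm_L2:
  "ennreal ((norm u)\<^sup>2) = (\<integral>\<^sup>+x. ennreal ((cmod (rep_L2 u x))\<^sup>2) \<partial>lborel)"
  using ennreal_norm_L2_of[of "rep_L2 u"] by simp

lemma square_integrableI:
  assumes "f \<in> borel_measurable borel" "(\<integral>\<^sup>+x. ennreal ((cmod (f x))\<^sup>2) \<partial>lborel) < \<infinity>"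
  shows "square_integrable f"
  using assms by (auto simp: square_integrable_def intro!: integrableI_nonneg)

text \<open>Riesz-Fischer: a subsequence with geometrically small steps converges almost everywhere,
  and Fatou's lemma identifies the pointwise limit as the limit in norm. A Cauchy sequence with a
  convergent subsequence converges. Completeness is what the projection and representation arguments
  above require.\<close>

instance L2 :: (finite) complete_space
proof
  fix X :: "nat \<Rightarrow> 'a L2"
  assume X: "Cauchy X"
  have "\<exists>N. \<forall>m\<ge>N. \<forall>n\<ge>N. norm (X m - X n) < (1/4)^k" for k
    using CauchyD[OF X, of "(1/4)^k"] by simp
  then obtain N where N: "\<And>k m n. m \<ge> N k \<Longrightarrow> n \<ge> N k \<Longrightarrow> norm (X m - X n) < (1/4)^k"
    by metis
  \<comment> \<open>The sum makes \<open>r k\<close> at least \<open>N k\<close>; the summand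
    \<open>k\<close> makes \<open>r\<close> strictly increasing.\<close>
  define r where "r k = (\<Sum>j\<le>k. N j) + k" for k
  have rN: "N k \<le> r k" for k unfolding r_def by (simp add: trans_le_add1 member_le_sum)
  have rS: "r k < r (Suc k)" for k unfolding r_def by simp
  then have r: "strict_mono r" by (simp add: strict_mono_Suc_iff)
  define f where "f k = rep_L2 (X (r k))" for k
  have sq: "square_integrable (f k)" for k by (simp add: f_def)
  have [measurable]: "f k \<in> borel_measurable borel" for k by (simp add: f_def)
  have fdiff: "(\<integral>\<^sup>+x. ennreal ((cmod (f k x - f m x))\<^sup>2) \<partial>lborel) = ennreal ((norm (X (r k) - X (r m)))\<^sup>2)"
    for k m
    unfolding ennreal_norm_L2 f_def using rep_diff[of "X (r k)" "X (r m)"]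
    by (intro nn_integral_cong_AE) auto
  define a where "a k x = cmod (f (Suc k) x - f k x)" for k x
  have [measurable]: "a k \<in> borel_measurable borel" for k unfolding a_def by measurable
  \<comment> \<open>The squared norm of the step is at most \<open>(1/16)^k\<close>, so it remains
    summable after multiplication by \<open>4^k\<close>. The weight is spent below to obtain a
    geometric bound at almost every point.\<close>
  have a_int: "(\<integral>\<^sup>+x. ennreal (4^k * (a k x)\<^sup>2) \<partial>lborel) \<le> ennreal ((1/4)^k)" for k
  proof -
    have "norm (X (r (Suc k)) - X (r k)) \<le> (1/4)^k"
      using N[of k "r (Suc k)" "r k"] rN[of k] rS[of k] by simp
    then have "(norm (X (r (Suc k)) - X (r k)))\<^sup>2 \<le> ((1/4)^k)\<^sup>2" by (intro power_mono) auto
    then have "4^k * (norm (X (r (Suc k)) - X (r k)))\<^sup>2 \<le> 4^k * ((1/4)^k)\<^sup>2"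
      by (intro mult_left_mono) auto
    also have "(4::real)^k * ((1/4)^k)\<^sup>2 = (4 * (1/4) * (1/4))^k"
      by (simp only: power_mult_distrib power2_eq_square mult.assoc)
    finally have le: "4^k * (norm (X (r (Suc k)) - X (r k)))\<^sup>2 \<le> (1/4)^k" by simp
    have "(\<integral>\<^sup>+x. ennreal (4^k * (a k x)\<^sup>2) \<partial>lborel) =
        ennreal (4^k) * (\<integral>\<^sup>+x. ennreal ((cmod (f (Suc k) x - f k x))\<^sup>2) \<partial>lborel)"
      by (simp add: a_def ennreal_mult nn_integral_cmult)
    also have "\<dots> = ennreal (4^k * (norm (X (r (Suc k)) - X (r k)))\<^sup>2)"
      by (simp add: fdiff ennreal_mult)
    finally show ?thesis using le by (simp add: ennreal_leI)
  qed
  have "(\<integral>\<^sup>+x. (\<Sum>k. ennreal (4^k * (a k x)\<^sup>2)) \<partial>lborel) = (\<Sum>k. \<integral>\<^sup>+x. ennreal (4^k * (a k x)\<^sup>2) \<partial>lborel)"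
    by (rule nn_integral_suminf) simp
  also have "\<dots> \<le> (\<Sum>k. ennreal ((1/4)^k))"
    by (intro suminf_le a_int) auto
  also have "\<dots> = ennreal (\<Sum>k. (1/4)^k)"
    by (intro suminf_ennreal_eq) (auto simp: sums_iff intro!: summable_geometric)
  also have "\<dots> < \<infinity>" by simp
  finally have "AE x in lborel. (\<Sum>k. ennreal (4^k * (a k x)\<^sup>2)) \<noteq> \<infinity>"
    by (intro nn_integral_noteq_infinite) auto
  then have conv: "AE x in lborel. convergent (\<lambda>k. f k x)"
  proof eventually_elim
    case (elim x)
    define C where "C = enn2real (\<Sum>k. ennreal (4^k * (a k x)\<^sup>2))"
    have C: "(\<Sum>k. ennreal (4^k * (a k x)\<^sup>2)) = ennreal C" "0 \<le> C"
      using elim unfolding C_def by (simp_all only: ennreal_enn2real less_top infinity_ennreal_def enn2real_nonneg)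
    \<comment> \<open>Each single term is at most the whole series \<open>C\<close>; taking the root
      of the weight \<open>4^k = (2^k)^2\<close> leaves a geometric majorant.\<close>
    have bnd: "a k x \<le> sqrt C * (1/2)^k" for k
    proof -
      have "g k \<le> suminf g" for g :: "nat \<Rightarrow> ennreal"
        using sum_le_suminf[OF summableI, of "{k}" g] by simp
      then have "ennreal (4^k * (a k x)\<^sup>2) \<le> ennreal C" unfolding C(1)[symmetric] .
      then have "4^k * (a k x)\<^sup>2 \<le> C" using C(2) by (simp only: ennreal_le_iff)
      moreover have "(2^k)\<^sup>2 = (4::real)^k" by (simp add: power2_eq_square flip: power_mult_distrib)
      ultimately have "(2^k * a k x)\<^sup>2 \<le> C" by (simp only: power_mult_distrib)
      then have "2^k * a k x \<le> sqrt C" by (rule real_le_rsqrt)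
      then show ?thesis by (simp add: field_simps power_divide)
    qed
    have "summable (\<lambda>k. f (Suc k) x - f k x)"
    proof (rule summable_comparison_test')
      show "summable (\<lambda>k. sqrt C * (1/2)^k)" by (intro summable_mult summable_geometric) simp
      show "norm (f (Suc k) x - f k x) \<le> sqrt C * (1/2)^k" if "0 \<le> k" for k
        using bnd[of k] by (simp add: a_def)
    qed
    then have "convergent (\<lambda>n. \<Sum>k<n. f (Suc k) x - f k x)" by (simp add: summable_iff_convergent)
    then have "convergent (\<lambda>n. f n x - f 0 x)" by (simp only: sum_lessThan_telescope[of "\<lambda>k. f k x"])
    then show ?case by (simp add: convergent_diff_const_right_iff)
  qed
  define F where "F x = lim (\<lambda>k. f k x)" for x
  have [measurable]: "F \<in> borel_measurable borel"
    unfolding F_def by (rule borel_measurable_lim_metric) simp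
  have Flim: "AE x in lborel. (\<lambda>k. f k x) \<longlonglongrightarrow> F x"
    using conv unfolding F_def by eventually_elim (simp add: convergent_LIMSEQ_iff)
  \<comment> \<open>Fatou's lemma in \<open>k\<close> with \<open>m\<close> fixed: all differences
    with \<open>k \<ge> m\<close> obey the same bound.\<close>
  have Fm: "(\<integral>\<^sup>+x. ennreal ((cmod (F x - f m x))\<^sup>2) \<partial>lborel) \<le> ennreal (((1/4)^m)\<^sup>2)" for m
  proof -
    have "(\<integral>\<^sup>+x. ennreal ((cmod (F x - f m x))\<^sup>2) \<partial>lborel)
        = (\<integral>\<^sup>+x. liminf (\<lambda>k. ennreal ((cmod (f k x - f m x))\<^sup>2)) \<partial>lborel)"
    proof (rule nn_integral_cong_AE, use Flim in eventually_elim)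
      case (elim x)
      then have "(\<lambda>k. ennreal ((cmod (f k x - f m x))\<^sup>2)) \<longlonglongrightarrow> ennreal ((cmod (F x - f m x))\<^sup>2)"
        by (intro tendsto_intros)
      then show ?case by (rule lim_imp_Liminf[OF sequentially_bot, symmetric])
    qed
    also have "\<dots> \<le> liminf (\<lambda>k. \<integral>\<^sup>+x. ennreal ((cmod (f k x - f m x))\<^sup>2) \<partial>lborel)"
      by (rule nn_integral_liminf) simp
    also have "\<dots> \<le> ennreal (((1/4)^m)\<^sup>2)"
    proof (rule Liminf_le)
      show "eventually (\<lambda>k. (\<integral>\<^sup>+x. ennreal ((cmod (f k x - f m x))\<^sup>2) \<partial>lborel) \<le> ennreal (((1/4)^m)\<^sup>2)) sequentially"
        using eventually_ge_at_top[of m]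
      proof eventually_elim
        case (elim k)
        then have "r m \<le> r k" using r by (simp add: strict_mono_less_eq)
        then have "norm (X (r k) - X (r m)) \<le> (1/4)^m" using N[of m "r k" "r m"] rN[of m] by simp
        then show ?case unfolding fdiff by (intro ennreal_leI power_mono) auto
      qed
    qed simp
    finally show ?thesis .
  qed
  have "square_integrable (\<lambda>x. F x - f 0 x)"
    using Fm[of 0] by (intro square_integrableI) (auto intro: le_less_trans)
  from square_integrable_add[OF this sq[of 0]] have sF: "square_integrable F" by simp
  have FX: "norm (L2_of F - X (r m)) \<le> (1/4)^m" for m
  proof -
    have e: "L2_of F - X (r m) = L2_of (\<lambda>x. F x - f m x)"
      using L2_of_diff[OF sF sq[of m]] by (simp add: f_def)
    have "square_integrable (\<lambda>x. F x - f m x)"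
      using Fm[of m] by (intro square_integrableI) (auto intro: le_less_trans)
    from ennreal_norm_L2_of[OF this] Fm[of m]
    have "ennreal ((norm (L2_of F - X (r m)))\<^sup>2) \<le> ennreal (((1/4)^m)\<^sup>2)"
      unfolding e by (simp only:)
    then have "(norm (L2_of F - X (r m)))\<^sup>2 \<le> ((1/4)^m)\<^sup>2" by (simp only: ennreal_le_iff zero_le_power2)
    then show ?thesis by (rule power2_le_imp_le) simp
  qed
  have "(X \<circ> r) \<longlonglongrightarrow> L2_of F"
  proof (rule metric_LIMSEQ_I)
    fix e :: real assume "e > 0"
    then obtain M where M: "(1/4)^M < e" using real_arch_pow_inv[of e "1/4"] by auto
    show "\<exists>no. \<forall>n\<ge>no. dist ((X \<circ> r) n) (L2_of F) < e"
    proof (intro exI[of _ M] allI impI)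
      fix n assume "M \<le> n"
      then have "(1/4::real)^n \<le> (1/4)^M" by (intro power_decreasing) auto
      then have "norm (L2_of F - X (r n)) < e" using FX[of n] M by linarith
      then show "dist ((X \<circ> r) n) (L2_of F) < e"
        by (simp add: dist_norm norm_minus_commute)
    qed
  qed
  then have "X \<longlonglongrightarrow> L2_of F" by (metis X Cauchy_converges_subseq r)
  then show "convergent X" by (auto simp: convergent_def)
qed

lemma norm_cscale: "norm (c *\<^sub>C u) = cmod c * norm u"
proof -
  have "ennreal ((norm (c *\<^sub>C u))\<^sup>2) = (\<integral>\<^sup>+x. ennreal ((cmod c)\<^sup>2) * ennreal ((cmod (rep_L2 u x))\<^sup>2) \<partial>lborel)"
    using ennreal_norm_L2_of[of "\<lambda>x. c * rep_L2 u x"] cscale_L2_of[of "rep_L2 u" c]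
    by (simp add: square_integrable_mult norm_mult power_mult_distrib ennreal_mult)
  also have "\<dots> = ennreal ((cmod c)\<^sup>2 * (norm u)\<^sup>2)"
    by (simp add: nn_integral_cmult ennreal_norm_L2 ennreal_mult)
  finally have "(norm (c *\<^sub>C u))\<^sup>2 = (cmod c * norm u)\<^sup>2" by (simp add: power_mult_distrib)
  then show ?thesis by (rule power2_eq_imp_eq) auto
qed

lemma cscale_add_right: "c *\<^sub>C (u + v) = c *\<^sub>C u + c *\<^sub>C v"
  by transfer (auto simp: L2rel_def square_integrable_mult square_integrable_add distrib_left)

lemma cscale_cscale: "c *\<^sub>C d *\<^sub>C u = (c * d) *\<^sub>C u"
  by transfer (auto simp: L2rel_def square_integrable_mult mult.assoc)

lemma cscale_of_real: "complex_of_real r *\<^sub>C u = r *\<^sub>R u"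
  by (simp add: scaleR_L2_def)

lemma cscale_scaleR: "c *\<^sub>C r *\<^sub>R u = r *\<^sub>R c *\<^sub>C u"
  by (simp add: scaleR_L2_def cscale_cscale mult.commute)

lemma cscale_1 [simp]: "1 *\<^sub>C u = u"
  using cscale_of_real[of 1 u] by simp

lemma bounded_linear_cscale: "bounded_linear (\<lambda>u. c *\<^sub>C u)"
  by (rule bounded_linear_intro[where K = "cmod c"])
     (auto simp: cscale_add_right cscale_scaleR norm_cscale)

lemmas cscale_diff_right = linear_diff[OF bounded_linear.linear[OF bounded_linear_cscale]]

section \<open>Test functions\<close>

definition smooth :: "(real^'d::finite \<Rightarrow> real) \<Rightarrow> bool" where
  "smooth \<phi> \<longleftrightarrow> (\<forall>js x. foldr pd js \<phi> differentiable (at x))"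

lemma test_function_smooth:
  "test_function \<phi> \<longleftrightarrow> smooth \<phi> \<and> bounded {x. \<phi> x \<noteq> 0}"
  by (simp add: test_function_def smooth_def)

lemma smooth_differentiable: "smooth \<phi> \<Longrightarrow> \<phi> differentiable (at x)"
  unfolding smooth_def by (drule spec[of _ "[]"]) simp

lemma smooth_pd: "smooth \<phi> \<Longrightarrow> smooth (pd i \<phi>)"
  unfolding smooth_def
proof (intro allI)
  fix js x assume "\<forall>js x. foldr pd js \<phi> differentiable at x"
  then have "foldr pd (js @ [i]) \<phi> differentiable at x" by blast
  then show "foldr pd js (pd i \<phi>) differentiable at x" by simp
qed

text \<open>The induction over lists of directions is done once here; a smoothness proof then only
  exhibits a class of differentiable functions stable under \<open>pd\<close>.\<close>

lemma smooth_coinduct: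
  assumes "P \<phi>" and "\<And>\<psi> x. P \<psi> \<Longrightarrow> \<psi> differentiable (at x)" and "\<And>\<psi> i. P \<psi> \<Longrightarrow> P (pd i \<psi>)"
  shows "smooth \<phi>"
proof -
  have "P (foldr pd js \<phi>)" for js by (induction js) (auto simp: assms)
  then show ?thesis unfolding smooth_def using assms(2) by blast
qed

lemma pd_eqI: "(f has_derivative f') (at x) \<Longrightarrow> pd i f x = f' (axis i 1)"
  unfolding pd_def using frechet_derivative_at by metis

lemma differentiable_has_frechet:
  "f differentiable (at x) \<Longrightarrow> (f has_derivative frechet_derivative f (at x)) (at x)"
  by (simp add: frechet_derivative_works)

lemma smooth_continuous: "smooth \<phi> \<Longrightarrow> continuous_on A \<phi>"
  by (meson smooth_differentiable differentiable_imp_continuous_within continuous_at_imp_continuous_on)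

lemma pd_add:
  assumes "\<phi> differentiable (at x)" "\<psi> differentiable (at x)"
  shows "pd i (\<lambda>x. \<phi> x + \<psi> x) x = pd i \<phi> x + pd i \<psi> x"
  using pd_eqI[OF has_derivative_add[OF assms[THEN differentiable_has_frechet]], of i]
  by (simp add: pd_def)

lemma pd_mult:
  assumes "\<phi> differentiable (at x)" "\<psi> differentiable (at x)"
  shows "pd i (\<lambda>x. \<phi> x * \<psi> x) x = \<phi> x * pd i \<psi> x + pd i \<phi> x * \<psi> x"
  using pd_eqI[OF has_derivative_mult[OF assms[THEN differentiable_has_frechet]], of i]
  by (simp add: pd_def)

lemma pd_cmult:
  fixes \<phi> :: "real^'d::finite \<Rightarrow> real"
  assumes "\<phi> differentiable (at x)"
  shows "pd i (\<lambda>x. c * \<phi> x) x = c * pd i \<phi> x"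
  using pd_eqI[OF has_derivative_mult_right[OF differentiable_has_frechet[OF assms], of c], of i]
  by (simp add: pd_def)

lemma has_derivative_translate:
  assumes "(\<phi> has_derivative D) (at (x + a))"
  shows "((\<lambda>x. \<phi> (x + a)) has_derivative D) (at x)"
proof -
  have "((\<lambda>x. x + a) has_derivative (\<lambda>h. h)) (at x)" by (auto intro!: derivative_eq_intros)
  from has_derivative_compose[OF this assms] show ?thesis .
qed

lemma pd_translate:
  assumes "\<phi> differentiable (at (x + a))"
  shows "pd i (\<lambda>x. \<phi> (x + a)) x = pd i \<phi> (x + a)"
  using pd_eqI[OF has_derivative_translate[OF differentiable_has_frechet[OF assms]], of i]
  by (simp add: pd_def)

lemma smooth_add:
  assumes "smooth \<phi>" "smooth \<psi>" shows "smooth (\<lambda>x. \<phi> x + \<psi> x)"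
proof (rule smooth_coinduct[where P = "\<lambda>\<eta>. \<exists>\<phi> \<psi>. smooth \<phi> \<and> smooth \<psi> \<and> \<eta> = (\<lambda>x. \<phi> x + \<psi> x)"])
  fix \<eta> :: "real^'a \<Rightarrow> real" and i
  assume "\<exists>\<phi> \<psi>. smooth \<phi> \<and> smooth \<psi> \<and> \<eta> = (\<lambda>x. \<phi> x + \<psi> x)"
  then obtain \<phi> \<psi> where *: "smooth \<phi>" "smooth \<psi>" "\<eta> = (\<lambda>x. \<phi> x + \<psi> x)" by blast
  then show "\<exists>\<phi> \<psi>. smooth \<phi> \<and> smooth \<psi> \<and> pd i \<eta> = (\<lambda>x. \<phi> x + \<psi> x)"
    by (intro exI[of _ "pd i \<phi>"] exI[of _ "pd i \<psi>"]) (auto simp: smooth_pd pd_add smooth_differentiable)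
next
  show "\<exists>\<phi>' \<psi>'. smooth \<phi>' \<and> smooth \<psi>' \<and> (\<lambda>x. \<phi> x + \<psi> x) = (\<lambda>x. \<phi>' x + \<psi>' x)"
    using assms by blast
qed (auto intro!: differentiable_add[OF smooth_differentiable smooth_differentiable])

lemma smooth_cmult:
  assumes "smooth \<phi>" shows "smooth (\<lambda>x. c * \<phi> x)"
proof (rule smooth_coinduct[where P = "\<lambda>\<eta>. \<exists>\<phi>. smooth \<phi> \<and> \<eta> = (\<lambda>x. c * \<phi> x)"])
  fix \<eta> :: "real^'a \<Rightarrow> real" and i
  assume "\<exists>\<phi>. smooth \<phi> \<and> \<eta> = (\<lambda>x. c * \<phi> x)"
  then obtain \<phi> where *: "smooth \<phi>" "\<eta> = (\<lambda>x. c * \<phi> x)" by blast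
  then show "\<exists>\<phi>. smooth \<phi> \<and> pd i \<eta> = (\<lambda>x. c * \<phi> x)"
    by (intro exI[of _ "pd i \<phi>"]) (auto simp: smooth_pd pd_cmult smooth_differentiable)
next
  show "\<exists>\<phi>'. smooth \<phi>' \<and> (\<lambda>x. c * \<phi> x) = (\<lambda>x. c * \<phi>' x)"
    using assms by blast
qed (auto intro!: differentiable_mult[OF differentiable_const smooth_differentiable])

lemma smooth_translate:
  assumes "smooth \<phi>" shows "smooth (\<lambda>x. \<phi> (x + a))"
proof (rule smooth_coinduct[where P = "\<lambda>\<eta>. \<exists>\<phi>. smooth \<phi> \<and> \<eta> = (\<lambda>x. \<phi> (x + a))"])
  fix \<eta> :: "real^'a \<Rightarrow> real" and i
  assume "\<exists>\<phi>. smooth \<phi> \<and> \<eta> = (\<lambda>x. \<phi> (x + a))"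
  then obtain \<phi> where *: "smooth \<phi>" "\<eta> = (\<lambda>x. \<phi> (x + a))" by blast
  then show "\<exists>\<phi>. smooth \<phi> \<and> pd i \<eta> = (\<lambda>x. \<phi> (x + a))"
    by (intro exI[of _ "pd i \<phi>"]) (auto simp: smooth_pd pd_translate smooth_differentiable)
next
  fix \<eta> :: "real^'a \<Rightarrow> real" and x
  assume "\<exists>\<phi>. smooth \<phi> \<and> \<eta> = (\<lambda>x. \<phi> (x + a))"
  then show "\<eta> differentiable at x"
    using has_derivative_translate differentiable_has_frechet smooth_differentiable
    unfolding differentiable_def by metis
qed (use assms in auto)

lemma test_function_add:
  assumes "test_function \<phi>" "test_function \<psi>" shows "test_function (\<lambda>x. \<phi> x + \<psi> x)"
proof -
  have "{x. \<phi> x + \<psi> x \<noteq> 0} \<subseteq> {x. \<phi> x \<noteq> 0} \<union> {x. \<psi> x \<noteq> 0}" by auto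
  then show ?thesis
    using assms smooth_add[of \<phi> \<psi>] bounded_subset unfolding test_function_smooth bounded_Un[symmetric]
    by (metis (no_types, lifting) bounded_Un)
qed

lemma test_function_cmult:
  assumes "test_function \<phi>" shows "test_function (\<lambda>x. c * \<phi> x)"
proof -
  have "{x. c * \<phi> x \<noteq> 0} \<subseteq> {x. \<phi> x \<noteq> 0}" by auto
  then show ?thesis
    using assms smooth_cmult[of \<phi> c] bounded_subset unfolding test_function_smooth by blast
qed

lemma test_function_translate:
  assumes "test_function \<phi>" shows "test_function (\<lambda>x. \<phi> (x + a))"
proof -
  have "{x. \<phi> (x + a) \<noteq> 0} = (\<lambda>x. -a + x) ` {x. \<phi> x \<noteq> 0}"
  proof safe
    fix x assume "\<phi> (x + a) \<noteq> 0"
    then show "x \<in> (+) (- a) ` {x. \<phi> x \<noteq> 0}" by (intro image_eqI[of _ _ "x + a"]) auto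
  qed auto
  then show ?thesis
    using assms by (simp add: smooth_translate bounded_translation test_function_smooth
      del: add_uminus_conv_diff uminus_add_conv_diff)
qed

text \<open>Outside the closed support the function vanishes in a neighbourhood, so its derivative
  is zero there. Hence the support does not leave the closure, which is still bounded.\<close>

lemma test_function_pd:
  assumes "test_function \<phi>" shows "test_function (pd i \<phi>)"
proof -
  have "pd i \<phi> x = 0" if x: "x \<notin> closure {x. \<phi> x \<noteq> 0}" for x
  proof -
    have "((\<lambda>x. 0) has_derivative (\<lambda>x. 0)) (at x)" by simp
    then have "(\<phi> has_derivative (\<lambda>x. 0)) (at x)"
    proof (rule has_derivative_transform_within_open)
      show "open (- closure {x. \<phi> x \<noteq> 0})" by (simp add: open_Compl)
      show "x \<in> - closure {x. \<phi> x \<noteq> 0}" using x by simp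
      show "0 = \<phi> x" if "x \<in> - closure {x. \<phi> x \<noteq> 0}" for x
        using that closure_subset[of "{x. \<phi> x \<noteq> 0}"] by auto
    qed
    then show ?thesis by (rule pd_eqI)
  qed
  then have "{x. pd i \<phi> x \<noteq> 0} \<subseteq> closure {x. \<phi> x \<noteq> 0}" by blast
  moreover have "bounded (closure {x. \<phi> x \<noteq> 0})" using assms by (simp add: test_function_smooth bounded_closure)
  ultimately show ?thesis using assms bounded_subset smooth_pd unfolding test_function_smooth by blast
qed

section \<open>Smooth bumps supported in boxes\<close>

definition exp_recip :: "real poly \<Rightarrow> real \<Rightarrow> real" where
  "exp_recip p y = (if y > 0 then poly p (1 / y) * exp (- 1 / y) else 0)"

lemma poly_exp_tendsto_0: "((\<lambda>z. poly p z * exp (- z)) \<longlongrightarrow> 0) at_top" for p :: "real poly"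
proof -
  have "((\<lambda>z. \<Sum>i\<le>degree p. coeff p i * (z ^ i / exp z)) \<longlongrightarrow> (\<Sum>i\<le>degree p. coeff p i * 0)) at_top"
    by (intro tendsto_intros tendsto_power_div_exp_0)
  then show ?thesis
    by (simp add: poly_altdef sum_distrib_right exp_minus divide_inverse mult.assoc)
qed

text \<open>With \<open>z = 1 / y\<close> the derivative of \<open>p(z) * exp (- z)\<close> in
  \<open>y\<close> is \<open>z^2 * (p - p')(z) * exp (- z)\<close>, and \<open>[:0, 0, 1:]\<close>
  is the square of the variable. The polynomial factor thus makes the flat functions closed under
  differentiation.\<close>

lemma exp_recip_DERIV:
  "(exp_recip p has_real_derivative exp_recip ([:0, 0, 1:] * (p - pderiv p)) y) (at y)"
proof (cases y "0::real" rule: linorder_cases)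
  case less
  have "((\<lambda>y. 0) has_real_derivative 0) (at y)" by simp
  then have "(exp_recip p has_real_derivative 0) (at y)"
    by (rule has_field_derivative_transform_within_open[where S = "{..<0}"])
       (use less in \<open>auto simp: exp_recip_def\<close>)
  then show ?thesis using less by (simp add: exp_recip_def)
next
  case greater
  have "((\<lambda>y. poly p (1 / y) * exp (- 1 / y)) has_real_derivative
      exp_recip ([:0, 0, 1:] * (p - pderiv p)) y) (at y)"
    using greater unfolding exp_recip_def
    by (auto intro!: derivative_eq_intros poly_DERIV[THEN DERIV_chain2] simp: field_simps power2_eq_square)
  then show ?thesis
    by (rule has_field_derivative_transform_within_open[where S = "{0<..}"])
       (use greater in \<open>auto simp: exp_recip_def\<close>)
next
  \<comment> \<open>From the right, the difference quotient at zero is again a polynomial in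
    \<open>1 / h\<close> times \<open>exp (- 1 / h)\<close>, with one more power; from the left it
    is zero.\<close>
  case equal
  have "((\<lambda>h. exp_recip p h / h) \<longlongrightarrow> 0) (at_right 0)"
  proof -
    have "((\<lambda>h. poly ([:0, 1:] * p) (inverse h) * exp (- inverse h)) \<longlongrightarrow> 0) (at_right 0)"
      by (rule filterlim_compose[OF poly_exp_tendsto_0 filterlim_inverse_at_top_right])
    then show ?thesis
      by (rule Lim_transform_eventually)
         (auto simp: eventually_at_right_less exp_recip_def divide_inverse intro!: eventually_at_rightI[of 0 1])
  qed
  moreover have "((\<lambda>h. exp_recip p h / h) \<longlongrightarrow> 0) (at_left 0)"
    by (rule tendsto_eventually) (auto simp: exp_recip_def intro!: eventually_at_leftI[of "-1"])
  ultimately have "((\<lambda>h. exp_recip p h / h) \<longlongrightarrow> 0) (at 0)" by (intro filterlim_split_at)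
  then show ?thesis using equal by (simp add: DERIV_def exp_recip_def)
qed

text \<open>An algebra of functions closed under partial derivatives, so that its members are smooth.\<close>

inductive bump_algebra :: "(real^'d::finite \<Rightarrow> real) \<Rightarrow> bool" where
  const: "bump_algebra (\<lambda>x. c)"
| base: "bump_algebra (\<lambda>x. exp_recip p (c * x $ i + d))"
| add: "bump_algebra \<phi> \<Longrightarrow> bump_algebra \<psi> \<Longrightarrow> bump_algebra (\<lambda>x. \<phi> x + \<psi> x)"
| mult: "bump_algebra \<phi> \<Longrightarrow> bump_algebra \<psi> \<Longrightarrow> bump_algebra (\<lambda>x. \<phi> x * \<psi> x)"

lemma bump_algebra_deriv:
  "bump_algebra \<phi> \<Longrightarrow> (\<forall>x. \<phi> differentiable (at x)) \<and> (\<forall>i. bump_algebra (pd i \<phi>))"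
proof (induction rule: bump_algebra.induct)
  case (const c)
  have "pd i (\<lambda>x. c) = (\<lambda>x. 0)" for i :: 'a using pd_eqI[of "\<lambda>x. c" "\<lambda>x. 0"] by (intro ext) auto
  then show ?case using bump_algebra.const by auto
next
  case (base p c i d)
  have D: "((\<lambda>x. exp_recip p (c * x $ i + d)) has_derivative
     (\<lambda>h. exp_recip ([:0, 0, 1:] * (p - pderiv p)) (c * x $ i + d) * (c * h $ i))) (at x)" for x :: "real^'a"
  proof (rule has_derivative_compose[of "\<lambda>x. c * x $ i + d" "\<lambda>h. c * h $ i"])
    have "bounded_linear (\<lambda>h::real^'a. c * h $ i)"
      by (intro bounded_linear_intros bounded_linear_vec_nth bounded_linear_const_mult)
    from bounded_linear_imp_has_derivative[OF this]
    show "((\<lambda>x. c * x $ i + d) has_derivative (\<lambda>h. c * h $ i)) (at x)"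
      by (rule has_derivative_add_const)
    show "(exp_recip p has_derivative (*) (exp_recip ([:0, 0, 1:] * (p - pderiv p)) (c * x $ i + d)))
      (at (c * x $ i + d))"
      using exp_recip_DERIV[of p "c * x $ i + d"] by (simp add: has_field_derivative_def)
  qed
  have "pd j (\<lambda>x. exp_recip p (c * x $ i + d)) =
     (\<lambda>x. exp_recip ([:0, 0, 1:] * (p - pderiv p)) (c * x $ i + d) * (c * axis j 1 $ i))" for j
    using pd_eqI[OF D] by (intro ext)
  moreover have "bump_algebra (\<lambda>x. exp_recip ([:0, 0, 1:] * (p - pderiv p)) (c * x $ i + d) * (c * axis j 1 $ i))" for j
    by (intro bump_algebra.mult bump_algebra.base bump_algebra.const)
  ultimately show ?case using D by (auto simp: differentiable_def)
next
  case (add \<phi> \<psi>)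
  then have "pd i (\<lambda>x. \<phi> x + \<psi> x) = (\<lambda>x. pd i \<phi> x + pd i \<psi> x)" for i by (intro ext pd_add) auto
  then show ?case using add by (auto intro: bump_algebra.add)
next
  case (mult \<phi> \<psi>)
  then have "pd i (\<lambda>x. \<phi> x * \<psi> x) = (\<lambda>x. \<phi> x * pd i \<psi> x + pd i \<phi> x * \<psi> x)" for i by (intro ext pd_mult) auto
  then show ?case using mult by (auto intro!: bump_algebra.add[OF bump_algebra.mult bump_algebra.mult])
qed

lemma bump_algebra_smooth: "bump_algebra \<phi> \<Longrightarrow> smooth \<phi>"
  by (rule smooth_coinduct[where P = bump_algebra]) (auto dest: bump_algebra_deriv)

lemma bump_algebra_prod:
  "finite I \<Longrightarrow> (\<And>i. i \<in> I \<Longrightarrow> bump_algebra (f i)) \<Longrightarrow> bump_algebra (\<lambda>x. \<Prod>i\<in>I. f i x)"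
  by (induction I rule: finite_induct) (auto intro: bump_algebra.const bump_algebra.mult)

text \<open>Each factor has the form \<open>exp (- 1 / (n * c))\<close> with \<open>c\<close> the
  distance of a coordinate to a face, and tends to 1 inside the box. The arguments are written as
  affine functions of one coordinate to match the generators of \<open>bump_algebra\<close>.\<close>

definition box_bump :: "real^'d::finite \<Rightarrow> real^'d \<Rightarrow> nat \<Rightarrow> real^'d \<Rightarrow> real" where
  "box_bump a b n x = (\<Prod>i\<in>UNIV. exp_recip 1 (real n * x $ i + - real n * a $ i)
     * exp_recip 1 (- real n * x $ i + real n * b $ i))"

lemma exp_recip_1_bounds: "0 \<le> exp_recip 1 y" "exp_recip 1 y \<le> 1"
  by (auto simp: exp_recip_def)

lemma box_bump_bounds: "0 \<le> box_bump a b n x" "box_bump a b n x \<le> 1"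
  unfolding box_bump_def
  by (auto intro!: prod_nonneg prod_le_1 mult_le_one simp: exp_recip_1_bounds)

lemma box_bump_eq_0:
  assumes "x \<notin> box a b" shows "box_bump a b n x = 0"
proof -
  obtain i where "\<not> (a $ i < x $ i \<and> x $ i < b $ i)" using assms by (auto simp: mem_box_cart)
  then have "real n * x $ i + - real n * a $ i \<le> 0 \<or> - real n * x $ i + real n * b $ i \<le> 0"
    by (auto simp: not_less intro: mult_left_mono)
  then show ?thesis unfolding box_bump_def
    by (intro prod_zero) (auto simp: exp_recip_def intro!: exI[of _ i])
qed

lemma box_bump_tendsto: "(\<lambda>n. box_bump a b n x) \<longlonglongrightarrow> indicator (box a b) x"
proof (cases "x \<in> box a b")
  case False
  then show ?thesis by (simp add: box_bump_eq_0)
next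
  case True
  have *: "(\<lambda>n. exp_recip 1 (real n * c)) \<longlonglongrightarrow> 1" if "c > 0" for c
  proof -
    have "(\<lambda>n. exp (- (1 / c) * (1 / real n))) \<longlonglongrightarrow> exp (- (1 / c) * 0)"
      by (intro tendsto_intros lim_1_over_n)
    then have "(\<lambda>n. exp (- (1 / c) * (1 / real n))) \<longlonglongrightarrow> 1" by simp
    then show ?thesis
      by (rule Lim_transform_eventually)
         (use that in \<open>auto simp: exp_recip_def field_simps intro!: eventually_sequentiallyI[of 1]\<close>)
  qed
  have eq: "box_bump a b n x = (\<Prod>i\<in>UNIV. exp_recip 1 (real n * (x $ i - a $ i)) * exp_recip 1 (real n * (b $ i - x $ i)))" for n
    by (simp add: box_bump_def algebra_simps)
  have "(\<lambda>n. box_bump a b n x) \<longlonglongrightarrow> (\<Prod>i\<in>(UNIV::'a set). 1 * 1)"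
    unfolding eq using True by (intro tendsto_prod tendsto_mult *) (auto simp: mem_box_cart)
  then show ?thesis using True by simp
qed

lemma test_function_box_bump: "test_function (box_bump a b n)"
  unfolding test_function_smooth
proof
  have "bump_algebra (\<lambda>x. \<Prod>i\<in>UNIV. exp_recip 1 (real n * x $ i + - real n * a $ i)
     * exp_recip 1 (- real n * x $ i + real n * b $ i))"
    by (intro bump_algebra_prod bump_algebra.mult bump_algebra.base) auto
  then show "smooth (box_bump a b n)"
    unfolding box_bump_def[abs_def] by (rule bump_algebra_smooth)
  have "{x. box_bump a b n x \<noteq> 0} \<subseteq> box a b" using box_bump_eq_0 by blast
  then show "bounded {x. box_bump a b n x \<noteq> 0}" by (rule bounded_subset[OF bounded_box])
qed

section \<open>Test functions as vectors of the Hilbert space\<close>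

definition L2_test :: "(real^'d::finite \<Rightarrow> real) \<Rightarrow> 'd L2" where
  "L2_test \<phi> = L2_of (\<lambda>x. complex_of_real (\<phi> x))"

text \<open>Turns uniform smallness on a fixed ball into smallness in norm; this is how the uniform
  convergence of difference quotients of test functions is used.\<close>

lemma square_integrable_bounded_support:
  fixes f :: "real^'d::finite \<Rightarrow> complex"
  assumes f: "f \<in> borel_measurable borel" and bd: "\<And>x. cmod (f x) \<le> B * indicator (cball 0 r) x"
  shows "square_integrable f"
    "norm (L2_of f) \<le> B * sqrt (measure lborel (cball 0 r :: (real^'d) set))"
proof -
  let ?m = "measure lborel (cball 0 r :: (real^'d) set)"
  have m: "emeasure lborel (cball 0 r :: (real^'d) set) = ennreal ?m"
    using emeasure_lborel_cball_finite[of "0::real^'d" r] by (intro emeasure_eq_ennreal_measure) auto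
  have B: "0 \<le> B" if "r \<ge> 0" using order_trans[OF norm_ge_zero bd[of 0]] that by simp
  have Bm: "0 \<le> B * sqrt ?m"
  proof (cases "r \<ge> 0")
    case False
    then have "cball (0::real^'d) r = {}" by auto
    then show ?thesis by simp
  qed (use B in simp)
  have "(\<integral>\<^sup>+x. ennreal ((cmod (f x))\<^sup>2) \<partial>lborel) \<le> (\<integral>\<^sup>+(x::real^'d). ennreal (B\<^sup>2) * indicator (cball 0 r) x \<partial>lborel)"
  proof (rule nn_integral_mono)
    fix x
    have "(cmod (f x))\<^sup>2 \<le> (B * indicator (cball 0 r) x)\<^sup>2" using bd[of x] by (intro power_mono) auto
    also have "\<dots> = B\<^sup>2 * indicator (cball 0 r) x" by (auto simp: indicator_def)
    finally show "ennreal ((cmod (f x))\<^sup>2) \<le> ennreal (B\<^sup>2) * indicator (cball 0 r) x"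
      by (auto simp: indicator_def intro: ennreal_leI split: if_splits)
  qed
  also have "\<dots> = ennreal ((B * sqrt ?m)\<^sup>2)"
    by (simp add: nn_integral_cmult_indicator m ennreal_mult power_mult_distrib)
  finally have le: "(\<integral>\<^sup>+x. ennreal ((cmod (f x))\<^sup>2) \<partial>lborel) \<le> ennreal ((B * sqrt ?m)\<^sup>2)" .
  then show sq: "square_integrable f" using f by (intro square_integrableI) (auto intro: le_less_trans)
  show "norm (L2_of f) \<le> B * sqrt ?m"
    using le Bm unfolding ennreal_norm_L2_of[OF sq, symmetric]
    by (intro power2_le_imp_le[OF _ Bm]) simp
qed

lemma test_function_support:
  assumes "test_function \<phi>"
  obtains r where "r > 0" "\<And>x. r < norm x \<Longrightarrow> \<phi> x = 0"
proof -
  have "bounded {x. \<phi> x \<noteq> 0}"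
    using assms by (simp add: test_function_smooth)
  then obtain r where r: "r > 0" "\<forall>x\<in>{x. \<phi> x \<noteq> 0}. norm x \<le> r" by (auto simp: bounded_pos)
  have "\<phi> x = 0" if "r < norm x" for x using r(2)[rule_format, of x] that by (cases "\<phi> x = 0") auto
  then show ?thesis by (rule that[OF r(1)])
qed

lemma test_function_measurable: "test_function \<phi> \<Longrightarrow> \<phi> \<in> borel_measurable borel"
  by (intro borel_measurable_continuous_onI smooth_continuous) (simp add: test_function_smooth)

lemma test_function_square_integrable:
  assumes "test_function \<phi>" shows "square_integrable (\<lambda>x. complex_of_real (\<phi> x))"
proof -
  obtain r where r: "r > 0" "\<And>x. r < norm x \<Longrightarrow> \<phi> x = 0" using test_function_support[OF assms] by blast
  have "compact (\<phi> ` cball 0 r)"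
    using assms by (intro compact_continuous_image smooth_continuous) (auto simp: test_function_smooth)
  then obtain B where B: "\<forall>y\<in>\<phi> ` cball 0 r. norm y \<le> B" by (meson bounded_iff compact_imp_bounded)
  show ?thesis
  proof (rule square_integrable_bounded_support)
    show "cmod (complex_of_real (\<phi> x)) \<le> B * indicator (cball 0 r) x" for x
      using B r(2)[of x] by (cases "x \<in> cball 0 r") auto
    show "(\<lambda>x. complex_of_real (\<phi> x)) \<in> borel_measurable borel"
      using test_function_measurable[OF assms] by measurable
  qed
qed

lemma L2_test_add:
  "test_function \<phi> \<Longrightarrow> test_function \<psi> \<Longrightarrow> L2_test (\<lambda>x. \<phi> x + \<psi> x) = L2_test \<phi> + L2_test \<psi>"
  by (simp add: L2_test_def L2_of_plus test_function_square_integrable)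

lemma L2_test_cmult:
  "test_function \<phi> \<Longrightarrow> L2_test (\<lambda>x. c * \<phi> x) = c *\<^sub>R L2_test \<phi>"
  by (simp add: L2_test_def scaleR_L2_of test_function_square_integrable)

lemma L2_test_zero: "L2_test (\<lambda>x. 0) = 0"
  by (simp add: L2_test_def zero_L2.abs_eq)

text \<open>The real inner product sees only the real part of the pairing. Since
  \<open>Re (- \<i> * z) = Im z\<close>, pairing with \<open>\<i>\<close> times the test function
  recovers the imaginary part.\<close>

lemma test_pairing_inner:
  assumes "test_function \<phi>"
  shows "test_pairing u \<phi> = Complex (inner u (L2_test \<phi>)) (inner u (\<i> *\<^sub>C L2_test \<phi>))"
proof -
  have sq: "square_integrable (\<lambda>x. complex_of_real (\<phi> x))" by (rule test_function_square_integrable[OF assms])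
  have "inner u (\<i> *\<^sub>C L2_test \<phi>) = Re (\<integral>x. rep_L2 u x * cnj (\<i> * complex_of_real (\<phi> x)) \<partial>lborel)"
    unfolding L2_test_def by (simp only: cscale_L2_of[OF sq] inner_L2_of[OF square_integrable_mult[OF sq]])
  also have "\<dots> = Re (\<integral>x. (- \<i>) * (rep_L2 u x * complex_of_real (\<phi> x)) \<partial>lborel)"
    by (simp add: mult_ac)
  also have "\<dots> = Im (test_pairing u \<phi>)"
    by (subst integral_mult_right_zero) (simp add: test_pairing_def)
  finally show ?thesis
    by (simp add: complex_eq_iff L2_test_def inner_L2_of[OF sq] test_pairing_def)
qed

section \<open>Test functions separate points\<close>

text \<open>Cut off to a large box, the positive and negative parts of \<open>g\<close> are
  densities of finite measures. These agree on boxes, a generator stable under intersection, hence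
  everywhere, so the densities agree almost everywhere.\<close>

lemma AE_eq_0_if_box_integrals_0:
  fixes g :: "'a::euclidean_space \<Rightarrow> real"
  assumes [measurable]: "g \<in> borel_measurable borel"
    and int: "\<And>a b. integrable lborel (\<lambda>x. g x * indicator (box a b) x)"
    and zero: "\<And>a b. (\<integral>x. g x * indicator (box a b) x \<partial>lborel) = 0"
  shows "AE x in lborel. g x = 0"
proof -
  define N where "N n = box (- (real n *\<^sub>R One)) (real n *\<^sub>R One :: 'a)" for n
  have "AE x in lborel. g x * indicator (N n) x = 0" for n
  proof -
    define p where "p x = ennreal (g x * indicator (N n) x)" for x
    define m where "m x = ennreal (- (g x * indicator (N n) x))" for x
    have [measurable]: "N n \<in> sets borel" by (simp add: N_def)
    have [measurable]: "p \<in> borel_measurable borel" "m \<in> borel_measurable borel"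
      unfolding p_def m_def by measurable
    have box: "emeasure (density lborel p) (box a b) = emeasure (density lborel m) (box a b)
        \<and> emeasure (density lborel p) (box a b) < \<infinity>" for a b
    proof -
      \<comment> \<open>The intersection with the cut-off box is again a box, so the hypotheses on
        \<open>g\<close> apply to it.\<close>
      obtain c d where cd: "N n \<inter> box a b = box c d" unfolding N_def box_Int_box by blast
      let ?h = "\<lambda>x. g x * indicator (box c d) x"
      have h: "?h x = g x * indicator (N n) x * indicator (box a b) x" for x
        unfolding cd[symmetric] by (simp add: indicator_inter_arith)
      have "p x * indicator (box a b) x = ennreal (?h x)"
        and "m x * indicator (box a b) x = ennreal (- ?h x)" for x
        unfolding h p_def m_def by (auto simp: indicator_def)
      then have e: "emeasure (density lborel p) (box a b) = (\<integral>\<^sup>+x. ennreal (?h x) \<partial>lborel)"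
        "emeasure (density lborel m) (box a b) = (\<integral>\<^sup>+x. ennreal (- ?h x) \<partial>lborel)"
        by (simp_all add: emeasure_density)
      have "(\<integral>\<^sup>+x. ennreal (?h x) \<partial>lborel) \<noteq> \<infinity>" "(\<integral>\<^sup>+x. ennreal (- ?h x) \<partial>lborel) \<noteq> \<infinity>"
        using int[of c d] by (auto simp: real_integrable_def)
      moreover have "enn2real (\<integral>\<^sup>+x. ennreal (?h x) \<partial>lborel) = enn2real (\<integral>\<^sup>+x. ennreal (- ?h x) \<partial>lborel)"
        using zero[of c d] real_lebesgue_integral_def[OF int[of c d]] by simp
      ultimately show ?thesis unfolding e
        by (metis ennreal_enn2real infinity_ennreal_def less_top)
    qed
    have "density lborel p = density lborel m"
    proof (rule measure_eqI_generator_eq[where \<Omega> = UNIV and E = "range (\<lambda>(a, b). box a b)" and A = N])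
      show "Int_stable (range (\<lambda>(a, b). box a b :: 'a set))"
        by (auto simp: Int_stable_def box_Int_box)
      show "sets (density lborel p) = sigma_sets UNIV (range (\<lambda>(a, b). box a b))"
        "sets (density lborel m) = sigma_sets UNIV (range (\<lambda>(a, b). box a b))"
        by (simp_all add: borel_eq_box sets_measure_of)
      show "(\<Union>i. N i) = UNIV" using UN_box_eq_UNIV by (simp add: N_def)
      show "emeasure (density lborel p) X = emeasure (density lborel m) X"
        if "X \<in> range (\<lambda>(a, b). box a b)" for X using that box by auto
      show "emeasure (density lborel p) (N i) \<noteq> \<infinity>" for i
        using box unfolding N_def by (metis less_irrefl)
    qed (auto simp: N_def)
    moreover have "integral\<^sup>N lborel p \<noteq> \<infinity>"
      using int[of "- (real n *\<^sub>R One)" "real n *\<^sub>R One"] by (auto simp: real_integrable_def p_def[abs_def] N_def)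
    ultimately have "AE x in lborel. p x = m x"
      by (subst (asm) finite_density_unique) auto
    then show ?thesis
    proof eventually_elim
      case (elim x)
      then show ?case unfolding p_def m_def
        by (cases "g x * indicator (N n) x \<ge> 0") (auto simp: ennreal_neg ennreal_eq_0_iff)
    qed
  qed
  then have "AE x in lborel. \<forall>n. g x * indicator (N n) x = 0" unfolding AE_all_countable by blast
  then show ?thesis
  proof eventually_elim
    case (elim x)
    have "x \<in> (\<Union>i. N i)" by (simp only: N_def UN_box_eq_UNIV UNIV_I)
    then show ?case using elim by (auto simp: indicator_def split: if_splits)
  qed
qed

lemma integrable_box_of_square_integrable:
  assumes "square_integrable f"
  shows "integrable lborel (\<lambda>x. f x * complex_of_real (indicator (box a b) x))"
proof (rule Bochner_Integration.integrable_bound)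
  show "integrable lborel (\<lambda>x. (cmod (f x))\<^sup>2 + indicator (box a b) x)"
    using assms emeasure_lborel_box_finite[of a b]
    by (intro Bochner_Integration.integrable_add integrable_real_indicator) (auto simp: square_integrable_def)
  have "c \<le> c\<^sup>2 + 1" for c :: real using zero_le_power2[of "c - 1/2"] by (simp add: power2_eq_square algebra_simps)
  then show "AE x in lborel. norm (f x * complex_of_real (indicator (box a b) x)) \<le> norm ((cmod (f x))\<^sup>2 + indicator (box a b) x)"
    by (auto simp: indicator_def)
  have [measurable]: "f \<in> borel_measurable borel" using assms by (rule square_integrable_measurable)
  show "(\<lambda>x. f x * complex_of_real (indicator (box a b) x)) \<in> borel_measurable lborel"
    by measurable
qed

text \<open>Box bumps lie below the indicator of the box and converge to it. By dominated
  convergence all integrals over boxes vanish, and the real and imaginary parts are then treated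
  separately.\<close>

lemma L2_eq_0_if_test_pairings_0:
  assumes "\<And>\<phi>. test_function \<phi> \<Longrightarrow> test_pairing u \<phi> = 0"
  shows "u = 0"
proof -
  define f where "f = rep_L2 u"
  have sq: "square_integrable f" by (simp add: f_def)
  have [measurable]: "f \<in> borel_measurable borel" by (simp add: f_def)
  have int: "integrable lborel (\<lambda>x. f x * complex_of_real (indicator (box a b) x))" for a b
    using sq by (rule integrable_box_of_square_integrable)
  have box0: "(\<integral>x. f x * complex_of_real (indicator (box a b) x) \<partial>lborel) = 0" for a b
  proof (rule LIMSEQ_unique)
    show "(\<lambda>n. \<integral>x. f x * complex_of_real (box_bump a b n x) \<partial>lborel) \<longlonglongrightarrow>
        (\<integral>x. f x * complex_of_real (indicator (box a b) x) \<partial>lborel)"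
    proof (rule integral_dominated_convergence[where w = "\<lambda>x. cmod (f x * complex_of_real (indicator (box a b) x))"])
      show "AE x in lborel. (\<lambda>n. f x * complex_of_real (box_bump a b n x)) \<longlonglongrightarrow> f x * complex_of_real (indicator (box a b) x)"
        by (intro AE_I2 tendsto_intros box_bump_tendsto)
      show "AE x in lborel. norm (f x * complex_of_real (box_bump a b n x)) \<le> cmod (f x * complex_of_real (indicator (box a b) x))" for n
      proof (rule AE_I2)
        fix x show "norm (f x * complex_of_real (box_bump a b n x)) \<le> cmod (f x * complex_of_real (indicator (box a b) x))"
          using box_bump_bounds[of a b n x] box_bump_eq_0[of x a b n]
          by (cases "x \<in> box a b") (auto simp: norm_mult intro: mult_left_le)
      qed
      show "(\<lambda>x. f x * complex_of_real (box_bump a b n x)) \<in> borel_measurable lborel" for n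
        using test_function_measurable[OF test_function_box_bump[of a b n]] by measurable
    qed (use int in auto)
    show "(\<lambda>n. \<integral>x. f x * complex_of_real (box_bump a b n x) \<partial>lborel) \<longlonglongrightarrow> 0"
      using assms[OF test_function_box_bump] by (simp add: test_pairing_def f_def)
  qed
  have "AE x in lborel. Re (f x) = 0"
  proof (rule AE_eq_0_if_box_integrals_0)
    fix a b
    show "integrable lborel (\<lambda>x. Re (f x) * indicator (box a b) x)"
      using integrable_Re[OF int[of a b]] by simp
    show "(\<integral>x. Re (f x) * indicator (box a b) x \<partial>lborel) = 0"
      using integral_Re[OF int[of a b]] box0[of a b] by simp
  qed measurable
  moreover have "AE x in lborel. Im (f x) = 0"
  proof (rule AE_eq_0_if_box_integrals_0)
    fix a b
    show "integrable lborel (\<lambda>x. Im (f x) * indicator (box a b) x)"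
      using integrable_Im[OF int[of a b]] by simp
    show "(\<integral>x. Im (f x) * indicator (box a b) x \<partial>lborel) = 0"
      using integral_Im[OF int[of a b]] box0[of a b] by simp
  qed measurable
  ultimately have "AE x in lborel. f x = 0" by eventually_elim (simp add: complex_eq_iff)
  then have "L2rel f (\<lambda>x. 0)" using sq by (simp add: L2rel_def)
  then have "L2_of f = L2_of (\<lambda>x. 0)" by (rule L2_of_eqI)
  then show ?thesis by (simp add: f_def zero_L2.abs_eq)
qed

section \<open>Translations and difference quotients\<close>

lemma measurable_translate [measurable]: "(\<lambda>x::real^'d. x + a) \<in> borel_measurable borel"
  by simp

lemma lborel_distr_translate: "distr lborel lborel (\<lambda>x::real^'d. x + a) = lborel"
  using lborel_distr_plus[of a] distr_cong[of lborel lborel lborel borel "\<lambda>x. x + a" "(+) a"]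
  by (simp add: add.commute)

lemma integrable_translate:
  assumes "integrable lborel (f :: real^'d \<Rightarrow> 'b::{banach, second_countable_topology})"
  shows "integrable lborel (\<lambda>x. f (x + a))"
  using assms by (intro integrable_distr[of _ lborel lborel f]) (auto simp: lborel_distr_translate)

lemma integral_translate:
  assumes "(f :: real^'d \<Rightarrow> 'b::{banach, second_countable_topology}) \<in> borel_measurable borel"
  shows "(\<integral>x. f (x + a) \<partial>lborel) = (\<integral>x. f x \<partial>lborel)"
  using assms integral_distr[of "\<lambda>x. x + a" lborel lborel f] by (simp add: lborel_distr_translate)

lemma square_integrable_translate:
  assumes "square_integrable f" shows "square_integrable (\<lambda>x. f (x + a))"
proof -
  have [measurable]: "f \<in> borel_measurable borel" using assms by (rule square_integrable_measurable)
  have "integrable lborel (\<lambda>x. (cmod (f x))\<^sup>2)" using assms by (simp add: square_integrable_def)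
  from integrable_translate[OF this, of a] show ?thesis by (simp add: square_integrable_def)
qed

lift_definition translate :: "real^'d \<Rightarrow> 'd::finite L2 \<Rightarrow> 'd L2" is "\<lambda>a f x. f (x + a)"
proof -
  fix a and f g :: "real^'d \<Rightarrow> complex"
  assume fg: "L2rel f g"
  have [measurable]: "f \<in> borel_measurable borel" "g \<in> borel_measurable borel"
    using fg by (auto simp: L2rel_def square_integrable_def)
  have "AE x in distr lborel lborel (\<lambda>x. x + a). f x = g x"
    using fg unfolding lborel_distr_translate by (simp add: L2rel_def)
  then have "AE x in lborel. f (x + a) = g (x + a)"
    by (subst (asm) AE_distr_iff) auto
  then show "L2rel (\<lambda>x. f (x + a)) (\<lambda>x. g (x + a))"
    using fg by (auto simp: L2rel_def square_integrable_translate)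
qed

lemma translate_0 [simp]: "translate 0 u = u"
  by transfer (auto simp: L2rel_def)

lemma translate_translate: "translate a (translate b u) = translate (a + b) u"
  by transfer (simp add: L2rel_def square_integrable_translate add.assoc)

lemma translate_add: "translate a (u + v) = translate a u + translate a v"
  by transfer (auto simp: L2rel_def intro!: square_integrable_translate square_integrable_add)

lemma translate_cscale: "translate a (c *\<^sub>C u) = c *\<^sub>C translate a u"
  by transfer (auto simp: L2rel_def intro!: square_integrable_translate square_integrable_mult)

lemma inner_translate_translate: "inner (translate a u) (translate a v) = inner u v"
proof transfer
  fix a and f g :: "real^'a \<Rightarrow> complex"
  assume "L2rel f f" "L2rel g g"
  then have [measurable]: "f \<in> borel_measurable borel" "g \<in> borel_measurable borel"
    by (auto simp: L2rel_def square_integrable_def)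
  have [measurable]: "cnj \<in> borel_measurable borel"
    by (intro borel_measurable_continuous_onI continuous_intros)
  show "Re (\<integral>x. f (x + a) * cnj (g (x + a)) \<partial>lborel) = Re (\<integral>x. f x * cnj (g x) \<partial>lborel)"
    by (subst integral_translate[where f = "\<lambda>x. f x * cnj (g x)"]) measurable
qed

lemma norm_translate [simp]: "norm (translate a u) = norm u"
  by (simp add: norm_eq_sqrt_inner inner_translate_translate)

lemma bounded_linear_translate: "bounded_linear (translate a)"
  by (rule bounded_linear_intro[where K = 1]) (auto simp: translate_add scaleR_L2_def translate_cscale)

lemmas translate_diff = linear_diff[OF bounded_linear.linear[OF bounded_linear_translate]]
lemmas translate_scaleR = linear_scale[OF bounded_linear.linear[OF bounded_linear_translate]]

lemma inner_translate_left: "inner (translate a u) v = inner u (translate (- a) v)"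
  using inner_translate_translate[of a u "translate (- a) v"] by (simp add: translate_translate)

lemma translate_L2_test:
  assumes "test_function \<phi>"
  shows "translate a (L2_test \<phi>) = L2_test (\<lambda>x. \<phi> (x + a))"
  unfolding L2_test_def using assms
  by (intro translate.abs_eq) (simp add: L2rel_def test_function_square_integrable)

text \<open>Division by zero makes \<open>dquot i 0\<close> the zero operator, so the algebraic
  identities below hold for every step without a case distinction.\<close>

definition dquot :: "'d \<Rightarrow> real \<Rightarrow> 'd::finite L2 \<Rightarrow> 'd L2" where
  "dquot i h u = (translate (h *\<^sub>R axis i 1) u - u) /\<^sub>R h"

lemma bounded_linear_dquot: "bounded_linear (dquot i h)"
  unfolding dquot_def
  by (intro bounded_linear_const_scaleR bounded_linear_sub bounded_linear_translate bounded_linear_ident)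

lemma dquot_cscale: "dquot i h (c *\<^sub>C u) = c *\<^sub>C dquot i h u"
  by (simp add: dquot_def translate_cscale cscale_diff_right[symmetric] cscale_scaleR)

text \<open>Discrete integration by parts: the adjoint of a translation is the opposite translation,
  hence the reversed step.\<close>

lemma inner_dquot_left: "inner (dquot i h u) v = - inner u (dquot i (- h) v)"
  by (simp add: dquot_def inner_diff inner_translate_left)

text \<open>By the mean value theorem the quotient is a value of the partial derivative at an
  intermediate point, and uniform continuity compares it with the value at \<open>x\<close>. All
  supports lie in one ball, so uniform convergence suffices.\<close>

lemma dquot_L2_test:
  assumes \<phi>: "test_function \<phi>"
  shows "((\<lambda>h. dquot i h (L2_test \<phi>)) \<longlongrightarrow> L2_test (pd i \<phi>)) (at 0)"
proof (rule tendstoI)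
  fix \<epsilon> :: real assume \<epsilon>: "\<epsilon> > 0"
  let ?e = "axis i 1 :: real^'a"
  obtain r where r: "r > 0" "\<And>x. r < norm x \<Longrightarrow> \<phi> x = 0" using test_function_support[OF \<phi>] by blast
  obtain s where s: "s > 0" "\<And>x. s < norm x \<Longrightarrow> pd i \<phi> x = 0"
    using test_function_support[OF test_function_pd[OF \<phi>]] by blast
  \<comment> \<open>With steps of size below 1 the extra 1 keeps the support of the translated
    function inside the ball. Intermediate points may leave it by at most 1, hence the radius
    \<open>R + 1\<close> for uniform continuity.\<close>
  define R where "R = max r s + 1"
  let ?V = "measure lborel (cball 0 R :: (real^'a) set)"
  \<comment> \<open>The summand 1 in the denominator keeps it positive and makes the final estimate
    strict.\<close>
  define \<delta> where "\<delta> = \<epsilon> / (sqrt ?V + 1)"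
  have "sqrt ?V \<ge> 0" by simp
  then have "sqrt ?V + 1 > 0" by linarith
  then have \<delta>: "\<delta> > 0" "\<delta> * sqrt ?V < \<epsilon>" using \<epsilon> by (auto simp: \<delta>_def pos_divide_less_eq algebra_simps)
  have sm: "smooth (pd i \<phi>)" using test_function_pd[OF \<phi>] by (simp add: test_function_smooth)
  have "uniformly_continuous_on (cball 0 (R + 1)) (pd i \<phi>)"
    by (intro compact_uniformly_continuous smooth_continuous sm) simp
  then obtain \<eta> where \<eta>: "\<eta> > 0" "\<And>x y. x \<in> cball 0 (R + 1) \<Longrightarrow> y \<in> cball 0 (R + 1) \<Longrightarrow> dist y x < \<eta>
      \<Longrightarrow> dist (pd i \<phi> y) (pd i \<phi> x) < \<delta>"
    unfolding uniformly_continuous_on_def using \<delta>(1) by metis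
  have diff: "\<phi> differentiable (at x)" for x using \<phi> by (simp add: test_function_smooth smooth_differentiable)
  have ray: "((\<lambda>t. \<phi> (x + t *\<^sub>R ?e)) has_real_derivative pd i \<phi> (x + t *\<^sub>R ?e)) (at t)" for x t
  proof -
    have "((\<lambda>t. x + t *\<^sub>R ?e) has_derivative (\<lambda>t. t *\<^sub>R ?e)) (at t)" by (auto intro!: derivative_eq_intros)
    from has_derivative_compose[OF this differentiable_has_frechet[OF diff]]
    have "((\<lambda>t. \<phi> (x + t *\<^sub>R ?e)) has_derivative (\<lambda>s. frechet_derivative \<phi> (at (x + t *\<^sub>R ?e)) (s *\<^sub>R ?e))) (at t)" .
    moreover have "linear (frechet_derivative \<phi> (at (x + t *\<^sub>R ?e)))"
      using linear_frechet_derivative[OF diff] .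
    ultimately show ?thesis
      by (simp add: has_field_derivative_def linear_scale pd_def mult_commute_abs)
  qed
  have main: "norm (dquot i h (L2_test \<phi>) - L2_test (pd i \<phi>)) \<le> \<delta> * sqrt ?V"
    if h: "h \<noteq> 0" "\<bar>h\<bar> < min \<eta> 1" for h
  proof -
    \<comment> \<open>Differences are spelled with \<open>+\<close> and \<open>(- 1) *\<close> so
      that the closure rules for sums and multiples of test functions apply literally.\<close>
    have eq: "dquot i h (L2_test \<phi>) - L2_test (pd i \<phi>) =
      L2_test (\<lambda>x. inverse h * (\<phi> (x + h *\<^sub>R ?e) + (- 1) * \<phi> x) + (- 1) * pd i \<phi> x)"
      using \<phi> by (simp only: dquot_def translate_L2_test L2_test_add L2_test_cmult test_function_add
          test_function_cmult test_function_translate test_function_pd) simp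
    have bd: "cmod (complex_of_real (inverse h * (\<phi> (x + h *\<^sub>R ?e) + (- 1) * \<phi> x) + (- 1) * pd i \<phi> x))
      \<le> \<delta> * indicator (cball 0 R) x" for x
    proof (cases "x \<in> cball 0 R")
      case False
      then have x: "norm x > R" by simp
      then have "norm (x + h *\<^sub>R ?e) > R - 1"
        using norm_triangle_ineq4[of "x + h *\<^sub>R ?e" "h *\<^sub>R ?e"] h by simp
      then show ?thesis using r(2)[of "x + h *\<^sub>R ?e"] r(2)[of x] s(2)[of x] x False by (simp add: R_def)
    next
      case True
      have "\<exists>t. \<bar>t\<bar> \<le> \<bar>h\<bar> \<and> \<phi> (x + h *\<^sub>R ?e) - \<phi> x = h * pd i \<phi> (x + t *\<^sub>R ?e)"
      proof (cases "h > 0")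
        case True
        from MVT2[OF this, of "\<lambda>t. \<phi> (x + t *\<^sub>R ?e)" "\<lambda>t. pd i \<phi> (x + t *\<^sub>R ?e)"] ray
        obtain z where "0 < z" "z < h" "\<phi> (x + h *\<^sub>R ?e) - \<phi> x = h * pd i \<phi> (x + z *\<^sub>R ?e)" by auto
        then show ?thesis by (intro exI[of _ z]) auto
      next
        case False
        then have "h < 0" using h by simp
        from MVT2[OF this, of "\<lambda>t. \<phi> (x + t *\<^sub>R ?e)" "\<lambda>t. pd i \<phi> (x + t *\<^sub>R ?e)"] ray
        obtain z where "h < z" "z < 0" "\<phi> x - \<phi> (x + h *\<^sub>R ?e) = - h * pd i \<phi> (x + z *\<^sub>R ?e)" by auto
        then show ?thesis by (intro exI[of _ z]) auto
      qed
      then obtain t where t: "\<bar>t\<bar> \<le> \<bar>h\<bar>" "\<phi> (x + h *\<^sub>R ?e) - \<phi> x = h * pd i \<phi> (x + t *\<^sub>R ?e)" by blast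
      have "norm (x + t *\<^sub>R ?e) \<le> R + 1"
        using norm_triangle_ineq[of x "t *\<^sub>R ?e"] True t(1) h by simp
      moreover have "dist (x + t *\<^sub>R ?e) x < \<eta>" using t(1) h by (simp add: dist_norm)
      ultimately have "dist (pd i \<phi> (x + t *\<^sub>R ?e)) (pd i \<phi> x) < \<delta>"
        using True by (intro \<eta>(2)) auto
      moreover have "inverse h * (\<phi> (x + h *\<^sub>R ?e) + (- 1) * \<phi> x) = pd i \<phi> (x + t *\<^sub>R ?e)"
        using t(2) h(1) by simp
      ultimately show ?thesis using True by (simp only: norm_of_real) (simp add: dist_real_def)
    qed
    have "test_function (\<lambda>x. inverse h * (\<phi> (x + h *\<^sub>R ?e) + (- 1) * \<phi> x) + (- 1) * pd i \<phi> x)"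
      by (intro test_function_add test_function_cmult test_function_translate test_function_pd \<phi>)
    then have [measurable]: "(\<lambda>x. inverse h * (\<phi> (x + h *\<^sub>R ?e) + (- 1) * \<phi> x) + (- 1) * pd i \<phi> x) \<in> borel_measurable borel"
      by (rule test_function_measurable)
    show ?thesis unfolding eq unfolding L2_test_def
      by (rule square_integrable_bounded_support(2)[OF _ bd]) measurable
  qed
  show "eventually (\<lambda>h. dist (dquot i h (L2_test \<phi>)) (L2_test (pd i \<phi>)) < \<epsilon>) (at 0)"
    unfolding eventually_at
    by (intro exI[of _ "min \<eta> 1"]) (use \<eta>(1) main \<delta>(2) in \<open>auto simp: dist_norm intro: le_less_trans\<close>)
qed

section \<open>The gradient as a limit of difference quotients\<close>

text \<open>Test functions with complex values, represented by real and imaginary part, together with their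
  partial derivatives. Unlike the real ones, they form a dense real subspace.\<close>

definition test_deriv :: "'d \<Rightarrow> 'd::finite L2 \<Rightarrow> 'd L2 \<Rightarrow> bool" where
  "test_deriv i w w' \<longleftrightarrow> (\<exists>\<phi> \<psi>. test_function \<phi> \<and> test_function \<psi> \<and>
     w = L2_test \<phi> + \<i> *\<^sub>C L2_test \<psi> \<and> w' = L2_test (pd i \<phi>) + \<i> *\<^sub>C L2_test (pd i \<psi>))"

definition tests :: "'d::finite L2 set" where
  "tests = {L2_test \<phi> + \<i> *\<^sub>C L2_test \<psi> | \<phi> \<psi>. test_function \<phi> \<and> test_function \<psi>}"

lemma test_function_zero: "test_function (\<lambda>x. 0)"
  using test_function_cmult[OF test_function_box_bump, of 0] by simp

lemma pd_zero: "pd i (\<lambda>x. 0) = (\<lambda>x. 0)"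
  using pd_eqI[of "\<lambda>x. 0" "\<lambda>x. 0"] by (intro ext) auto

lemma cscale_zero [simp]: "c *\<^sub>C 0 = 0"
  using norm_cscale[of c 0] by simp

lemma L2_test_in_tests:
  assumes "test_function \<phi>" shows "L2_test \<phi> \<in> tests" "\<i> *\<^sub>C L2_test \<phi> \<in> tests"
proof -
  have "L2_test \<phi> + \<i> *\<^sub>C L2_test (\<lambda>x. 0) \<in> tests"
    using assms test_function_zero unfolding tests_def by blast
  then show "L2_test \<phi> \<in> tests" by (simp add: L2_test_zero)
  have "L2_test (\<lambda>x. 0) + \<i> *\<^sub>C L2_test \<phi> \<in> tests"
    using assms test_function_zero unfolding tests_def by blast
  then show "\<i> *\<^sub>C L2_test \<phi> \<in> tests" by (simp add: L2_test_zero)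
qed

lemma test_deriv_L2_test:
  assumes "test_function \<phi>"
  shows "test_deriv i (L2_test \<phi>) (L2_test (pd i \<phi>))"
    "test_deriv i (\<i> *\<^sub>C L2_test \<phi>) (\<i> *\<^sub>C L2_test (pd i \<phi>))"
  unfolding test_deriv_def
  by ((rule exI[of _ \<phi>], rule exI[of _ "\<lambda>x. 0"]), simp add: assms test_function_zero pd_zero L2_test_zero)
     ((rule exI[of _ "\<lambda>x. 0"], rule exI[of _ \<phi>]), simp add: assms test_function_zero pd_zero L2_test_zero)

lemma tests_deriv: "w \<in> tests \<Longrightarrow> \<exists>w'. test_deriv i w w'"
  unfolding tests_def test_deriv_def by blast

lemma test_deriv_tests: "test_deriv i w w' \<Longrightarrow> w \<in> tests \<and> w' \<in> tests"
  unfolding tests_def test_deriv_def by (blast intro: test_function_pd)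

lemma subspace_tests: "subspace tests"
  unfolding subspace_def
proof safe
  show "0 \<in> tests" using L2_test_in_tests(1)[OF test_function_zero] by (simp add: L2_test_zero)
next
  fix v w :: "'a L2" assume "v \<in> tests" "w \<in> tests"
  then obtain \<phi> \<psi> \<phi>' \<psi>' where *: "test_function \<phi>" "test_function \<psi>" "v = L2_test \<phi> + \<i> *\<^sub>C L2_test \<psi>"
    "test_function \<phi>'" "test_function \<psi>'" "w = L2_test \<phi>' + \<i> *\<^sub>C L2_test \<psi>'"
    unfolding tests_def by blast
  then have "v + w = L2_test (\<lambda>x. \<phi> x + \<phi>' x) + \<i> *\<^sub>C L2_test (\<lambda>x. \<psi> x + \<psi>' x)"
    by (simp add: L2_test_add cscale_add_right)
  then show "v + w \<in> tests" using * test_function_add unfolding tests_def by blast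
next
  fix c and w :: "'a L2" assume "w \<in> tests"
  then obtain \<phi> \<psi> where *: "test_function \<phi>" "test_function \<psi>" "w = L2_test \<phi> + \<i> *\<^sub>C L2_test \<psi>"
    unfolding tests_def by blast
  then have "c *\<^sub>R w = L2_test (\<lambda>x. c * \<phi> x) + \<i> *\<^sub>C L2_test (\<lambda>x. c * \<psi> x)"
    by (simp add: L2_test_cmult cscale_scaleR scaleR_add_right)
  then show "c *\<^sub>R w \<in> tests" using * test_function_cmult unfolding tests_def by blast
qed

lemma tests_separate:
  assumes "\<And>w. w \<in> tests \<Longrightarrow> inner v w = 0" shows "v = 0"
proof (rule L2_eq_0_if_test_pairings_0)
  fix \<phi> :: "real^'a \<Rightarrow> real" assume "test_function \<phi>"
  then show "test_pairing v \<phi> = 0"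
    using assms[OF L2_test_in_tests(1)] assms[OF L2_test_in_tests(2)] by (simp add: test_pairing_inner complex_eq_iff)
qed

lemma tests_dense: "closure tests = UNIV"
  by (rule closure_UNIV_if_orthogonal_trivial[OF subspace_tests tests_separate])

text \<open>Approximating \<open>v\<close> itself by elements of the dense subspace gives
  \<open>inner v v \<le> C * norm v\<close> in the limit.\<close>

lemma norm_le_of_tests:
  assumes bd: "\<And>w. w \<in> tests \<Longrightarrow> \<bar>inner v w\<bar> \<le> C * norm w" and C: "0 \<le> C"
  shows "norm v \<le> C"
proof -
  have "v \<in> closure tests" by (simp add: tests_dense)
  then obtain x where x: "\<And>n. x n \<in> tests" "x \<longlonglongrightarrow> v" unfolding closure_sequential by auto
  have "(\<lambda>n. inner v (x n)) \<longlonglongrightarrow> inner v v" "(\<lambda>n. C * norm (x n)) \<longlonglongrightarrow> C * norm v"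
    by (intro tendsto_intros x(2))+
  then have "inner v v \<le> C * norm v" using bd[OF x(1)]
    by (intro LIMSEQ_le[of "\<lambda>n. inner v (x n)" _ "\<lambda>n. C * norm (x n)"]) (auto intro: exI[of _ 0] abs_le_D1)
  then show ?thesis using C
    by (cases "norm v = 0") (auto simp: power2_norm_eq_inner[symmetric] power2_eq_square)
qed

lemma test_deriv_limit:
  assumes "test_deriv i w w'" shows "((\<lambda>h. dquot i h w) \<longlongrightarrow> w') (at 0)"
proof -
  obtain \<phi> \<psi> where *: "test_function \<phi>" "test_function \<psi>"
     "w = L2_test \<phi> + \<i> *\<^sub>C L2_test \<psi>" "w' = L2_test (pd i \<phi>) + \<i> *\<^sub>C L2_test (pd i \<psi>)"
    using assms unfolding test_deriv_def by blast
  have "dquot i h w = dquot i h (L2_test \<phi>) + \<i> *\<^sub>C dquot i h (L2_test \<psi>)" for h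
    unfolding *(3) linear_add[OF bounded_linear.linear[OF bounded_linear_dquot]] dquot_cscale ..
  moreover have "((\<lambda>h. dquot i h (L2_test \<phi>) + \<i> *\<^sub>C dquot i h (L2_test \<psi>)) \<longlongrightarrow> w') (at 0)"
    unfolding *(4) using *(1,2)
    by (intro tendsto_intros dquot_L2_test bounded_linear.tendsto[OF bounded_linear_cscale])
  ultimately show ?thesis by simp
qed

lemma test_deriv_translate:
  assumes "test_deriv i w w'" shows "test_deriv i (translate a w) (translate a w')"
proof -
  obtain \<phi> \<psi> where *: "test_function \<phi>" "test_function \<psi>"
     "w = L2_test \<phi> + \<i> *\<^sub>C L2_test \<psi>" "w' = L2_test (pd i \<phi>) + \<i> *\<^sub>C L2_test (pd i \<psi>)"
    using assms unfolding test_deriv_def by blast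
  have pd: "pd i (\<lambda>x. \<phi> (x + a)) = (\<lambda>x. pd i \<phi> (x + a))" if "test_function \<phi>" for \<phi>
    using that by (intro ext pd_translate smooth_differentiable) (simp add: test_function_smooth)
  show ?thesis unfolding test_deriv_def
    by (rule exI[of _ "\<lambda>x. \<phi> (x + a)"], rule exI[of _ "\<lambda>x. \<psi> (x + a)"])
       (simp add: * translate_add translate_cscale translate_L2_test test_function_translate test_function_pd pd)
qed

text \<open>Passes from complex pairings with real test functions to real inner products with
  complex ones; the component along \<open>\<i>\<close> carries the imaginary part of the
  pairing.\<close>

lemma weak_gradient_iff:
  "weak_gradient u g \<longleftrightarrow> (\<forall>i w w'. test_deriv i w w' \<longrightarrow> inner u w' = - inner (g i) w)"
proof (intro iffI allI impI)
  fix i :: 'a and w w' :: "'a L2" assume wg: "weak_gradient u g" and "test_deriv i w w'"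
  then obtain \<phi> \<psi> where *: "test_function \<phi>" "test_function \<psi>"
     "w = L2_test \<phi> + \<i> *\<^sub>C L2_test \<psi>" "w' = L2_test (pd i \<phi>) + \<i> *\<^sub>C L2_test (pd i \<psi>)"
    unfolding test_deriv_def by blast
  have "test_pairing u (pd i \<phi>) = - test_pairing (g i) \<phi>" if "test_function \<phi>" for \<phi> :: "real^'a \<Rightarrow> real"
    using wg that by (simp add: weak_gradient_def)
  from this[OF *(1)] this[OF *(2)] *(1,2)
  show "inner u w' = - inner (g i) w" unfolding *(3,4)
    by (simp add: test_pairing_inner test_function_pd complex_eq_iff inner_add_right)
next
  assume *: "\<forall>i w w'. test_deriv i w w' \<longrightarrow> inner u w' = - inner (g i) w"
  have "test_pairing u (pd i \<phi>) = - test_pairing (g i) \<phi>" if "test_function \<phi>" for i \<phi>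
    using *[rule_format, OF test_deriv_L2_test(1)[OF that]] *[rule_format, OF test_deriv_L2_test(2)[OF that]] that
    by (simp add: test_pairing_inner test_function_pd complex_eq_iff)
  then show "weak_gradient u g" by (simp add: weak_gradient_def)
qed

lemma weak_gradient_unique:
  assumes "weak_gradient u g" "weak_gradient u g'" shows "g = g'"
proof
  fix i
  have "g i - g' i = 0"
  proof (rule tests_separate)
    fix w :: "'a L2" assume "w \<in> tests"
    then obtain w' where "test_deriv i w w'" using tests_deriv by blast
    then have "inner (g i) w = inner (g' i) w" using assms unfolding weak_gradient_iff by fastforce
    then show "inner (g i - g' i) w = 0" by (simp add: inner_diff_left)
  qed
  then show "g i = g' i" by simp
qed

lemma grad_norm_sq_eq:
  "weak_gradient u g \<Longrightarrow> grad_norm_sq u = ennreal (\<Sum>i\<in>UNIV. (norm (g i))\<^sup>2)"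
  unfolding grad_norm_sq_def using weak_gradient_unique by (metis the_equality)

text \<open>The limit of discrete integration by parts: on both sides the difference quotients of
  test functions converge in norm to the derivatives.\<close>

lemma weak_gradient_test:
  assumes "\<And>i. test_deriv i w (d i)" shows "weak_gradient w d"
  unfolding weak_gradient_iff
proof (intro allI impI)
  fix i :: 'a and v v' :: "'a L2" assume v: "test_deriv i v v'"
  have "((\<lambda>h. inner (dquot i h w) v) \<longlongrightarrow> inner (d i) v) (at 0)"
    by (intro tendsto_intros test_deriv_limit assms)
  then have "((\<lambda>h. - inner w (dquot i (- h) v)) \<longlongrightarrow> inner (d i) v) (at 0)"
    unfolding inner_dquot_left .
  moreover have "((\<lambda>h. dquot i (- h) v) \<longlongrightarrow> v') (at 0)"
    by (rule filterlim_compose[OF test_deriv_limit[OF v]])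
       (auto simp: filterlim_at eventually_at intro!: tendsto_eq_intros exI[of _ 1])
  then have "((\<lambda>h. - inner w (dquot i (- h) v)) \<longlongrightarrow> - inner w v') (at 0)"
    by (intro tendsto_intros)
  ultimately have "inner (d i) v = - inner w v'" by (intro tendsto_unique[OF _ _ _]) auto
  then show "inner w v' = - inner (d i) v" by simp
qed

text \<open>The mean value theorem is applied to the pairing of \<open>u\<close> with the translates of a test function;
  its derivative is the pairing of the translates with the weak derivative.\<close>

lemma norm_dquot_le:
  assumes g: "weak_gradient u g" and h: "h > 0"
  shows "norm (dquot i h u) \<le> norm (g i)"
proof (rule norm_le_of_tests)
  fix w :: "'a L2" assume "w \<in> tests"
  then obtain w' where w: "test_deriv i w w'" using tests_deriv by blast
  let ?e = "axis i 1 :: real^'a"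
  \<comment> \<open>Translations along one axis form a group, so the derivative in \<open>s\<close>
    is the limit of difference quotients of the translated test function, which is again a test
    function; the weak gradient then removes its derivative.\<close>
  have D: "((\<lambda>s. inner u (translate (s *\<^sub>R ?e) w)) has_real_derivative - inner (g i) (translate (s *\<^sub>R ?e) w)) (at s)" for s
  proof -
    have "((\<lambda>h. inner u (dquot i h (translate (s *\<^sub>R ?e) w))) \<longlongrightarrow> inner u (translate (s *\<^sub>R ?e) w')) (at 0)"
      by (intro tendsto_intros test_deriv_limit test_deriv_translate w)
    moreover have "inner u (translate (s *\<^sub>R ?e) w') = - inner (g i) (translate (s *\<^sub>R ?e) w)"
      using g test_deriv_translate[OF w] unfolding weak_gradient_iff by blast
    moreover have "inner u (dquot i h (translate (s *\<^sub>R ?e) w)) =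
       (inner u (translate ((s + h) *\<^sub>R ?e) w) - inner u (translate (s *\<^sub>R ?e) w)) / h" for h
      by (simp add: dquot_def inner_diff_right translate_translate scaleR_add_left add.commute divide_inverse)
    ultimately show ?thesis by (simp add: DERIV_def)
  qed
  \<comment> \<open>The interval is \<open>[- h, 0]\<close> because moving the translation from
    \<open>u\<close> to \<open>w\<close> reverses it.\<close>
  obtain z where z: "inner u (translate (0 *\<^sub>R ?e) w) - inner u (translate ((- h) *\<^sub>R ?e) w) = (0 - (- h)) * (- inner (g i) (translate (z *\<^sub>R ?e) w))"
    using MVT2[of "- h" 0, OF _ D] h by auto
  have "\<bar>inner (dquot i h u) w\<bar> = \<bar>inner u (translate (- h *\<^sub>R ?e) w) - inner u w\<bar> / h"
    using h by (simp add: dquot_def inner_diff_left inner_translate_left divide_inverse abs_mult)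
  also have "\<dots> = \<bar>inner (g i) (translate (z *\<^sub>R ?e) w)\<bar>"
    using z h by (simp add: abs_mult abs_minus_commute)
  also have "\<dots> \<le> norm (g i) * norm w"
    using Cauchy_Schwarz_ineq2[of "g i" "translate (z *\<^sub>R ?e) w"] by simp
  finally show "\<bar>inner (dquot i h u) w\<bar> \<le> norm (g i) * norm w" .
qed simp

text \<open>The difference quotient with doubled step is an average of two translates of the original one;
  hence the difference quotients with dyadic steps increase in norm.\<close>

lemma dquot_double: "norm (dquot i (2 * h) u) \<le> norm (dquot i h u)"
proof -
  let ?a = "h *\<^sub>R axis i 1 :: real^'a"
  have "translate ((2 * h) *\<^sub>R axis i 1) u = translate ?a (translate ?a u)" by (simp add: translate_translate flip: scaleR_add_left)
  then have "dquot i (2 * h) u = (1/2) *\<^sub>R (translate ?a (dquot i h u) + dquot i h u)"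
    unfolding dquot_def translate_scaleR translate_diff by (simp add: algebra_simps flip: scaleR_add_left)
  then have "norm (dquot i (2 * h) u) \<le> (1/2) * (norm (translate ?a (dquot i h u)) + norm (dquot i h u))"
    using norm_triangle_ineq[of "translate ?a (dquot i h u)" "dquot i h u"] by simp
  then show ?thesis by simp
qed

section \<open>Dyadic difference quotients and the weak gradient\<close>

definition dyadic :: "nat \<Rightarrow> real" where "dyadic n = (1/2)^n"

lemma dyadic: "dyadic n > 0" "dyadic n = 2 * dyadic (Suc n)" "dyadic \<longlonglongrightarrow> 0"
  by (auto simp: dyadic_def[abs_def] LIMSEQ_realpow_zero)

lemma incseq_norm_dquot: "incseq (\<lambda>n. norm (dquot i (dyadic n) u))"
  by (rule incseq_SucI) (metis dquot_double dyadic(2))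

text \<open>Instead of weak compactness: the weak derivative is the strong limit of convex combinations of
  nearly minimal norm of the tails of the sequence of difference quotients.\<close>

lemma weak_derivative_of_bounded_dquot:
  assumes bd: "\<And>n. norm (dquot i (dyadic n) u) \<le> C"
  obtains g where "norm g \<le> C" "\<And>w w'. test_deriv i w w' \<Longrightarrow> inner u w' = - inner g w"
proof -
  define K where "K n = convex hull ((\<lambda>m. dquot i (dyadic m) u) ` {n..})" for n
  obtain x l where x: "\<And>n. x n \<in> K n" "x \<longlonglongrightarrow> l" "norm l \<le> C"
  proof (rule min_norm_nested_convex[of K C])
    show "convex (K n)" for n by (simp add: K_def)
    show "K n \<subseteq> K m" if "m \<le> n" for m n unfolding K_def using that by (intro hull_mono image_mono) auto
    show "\<exists>x\<in>K n. norm x \<le> C" for n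
      by (intro bexI[of _ "dquot i (dyadic n) u"] bd) (auto simp: K_def intro: hull_inc)
  qed blast
  have "inner u w' = - inner l w" if w: "test_deriv i w w'" for w w'
  proof -
    \<comment> \<open>The sign comes from discrete integration by parts, which puts the opposite
      step on \<open>w\<close>.\<close>
    have "filterlim (\<lambda>n. - dyadic n) (at 0) sequentially"
      using dyadic(1,3) by (auto simp: filterlim_at less_imp_neq[symmetric] intro!: tendsto_eq_intros)
    from filterlim_compose[OF test_deriv_limit[OF w] this]
    have "(\<lambda>n. - inner u (dquot i (- dyadic n) w)) \<longlonglongrightarrow> - inner u w'"
      by (intro tendsto_intros)
    then have L: "(\<lambda>n. inner (dquot i (dyadic n) u) w) \<longlonglongrightarrow> - inner u w'"
      by (simp add: inner_dquot_left)
    have "(\<lambda>n. inner (x n) w) \<longlonglongrightarrow> - inner u w'"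
    proof (rule metric_LIMSEQ_I)
      fix r :: real assume "r > 0"
      then obtain N where N: "\<And>n. n \<ge> N \<Longrightarrow> dist (inner (dquot i (dyadic n) u) w) (- inner u w') < r"
        using metric_LIMSEQ_D[OF L] by blast
      \<comment> \<open>The condition cuts out a convex slab, so once all late quotients satisfy it,
        so do all their convex combinations.\<close>
      have conv: "convex {y. dist (inner y w) (- inner u w') < r}"
      proof -
        have "{y. dist (inner y w) (- inner u w') < r} = (\<lambda>y. inner y w) -` ball (- inner u w') r"
          by (auto simp: dist_commute)
        also have "convex \<dots>"
          by (intro convex_linear_vimage bounded_linear.linear bounded_linear_inner_left convex_ball)
        finally show ?thesis .
      qed
      have "K n \<subseteq> {y. dist (inner y w) (- inner u w') < r}" if "n \<ge> N" for n
        unfolding K_def using that N by (intro hull_minimal conv) auto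
      then show "\<exists>no. \<forall>n\<ge>no. dist (inner (x n) w) (- inner u w') < r" using x(1) by blast
    qed
    moreover have "(\<lambda>n. inner (x n) w) \<longlonglongrightarrow> inner l w" by (intro tendsto_intros x(2))
    ultimately show ?thesis using LIMSEQ_unique by fastforce
  qed
  then show ?thesis using that x(3) by blast
qed

text \<open>Monotonicity lets the sum over directions commute with the supremum. If every
  directional supremum is finite, the weak derivatives with norms bounded by them form a weak
  gradient; otherwise the right side is infinite. Conversely a weak gradient bounds every quotient,
  and without one the left side is infinite.\<close>

lemma grad_norm_sq_SUP:
  "grad_norm_sq u = (SUP n. \<Sum>i\<in>UNIV. ennreal ((norm (dquot i (dyadic n) u))\<^sup>2))"
proof -
  have inc: "incseq (\<lambda>n. ennreal ((norm (dquot i (dyadic n) u))\<^sup>2))" for i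
    using incseq_norm_dquot[of i u] unfolding incseq_def by (auto intro!: ennreal_leI power_mono)
  have swap: "(SUP n. \<Sum>i\<in>UNIV. ennreal ((norm (dquot i (dyadic n) u))\<^sup>2))
      = (\<Sum>i\<in>UNIV. SUP n. ennreal ((norm (dquot i (dyadic n) u))\<^sup>2))"
    by (rule ennreal_SUP_sum) (rule inc)
  show ?thesis
  proof (rule antisym)
    show "grad_norm_sq u \<le> (SUP n. \<Sum>i\<in>UNIV. ennreal ((norm (dquot i (dyadic n) u))\<^sup>2))"
    proof (cases "\<exists>i. (SUP n. ennreal ((norm (dquot i (dyadic n) u))\<^sup>2)) = \<infinity>")
      case True
      then obtain i where i: "(SUP n. ennreal ((norm (dquot i (dyadic n) u))\<^sup>2)) = \<infinity>" ..
      have "f i \<le> sum f UNIV" for f :: "'a \<Rightarrow> ennreal" by (intro member_le_sum) auto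
      from this[of "\<lambda>i. SUP n. ennreal ((norm (dquot i (dyadic n) u))\<^sup>2)"]
      show ?thesis unfolding swap i infinity_ennreal_def by (simp only: top_unique top_greatest)
    next
      case False
      have "\<exists>C. (SUP n. ennreal ((norm (dquot i (dyadic n) u))\<^sup>2)) = ennreal (C\<^sup>2) \<and> 0 \<le> C" for i
      proof -
        obtain c where "(SUP n. ennreal ((norm (dquot i (dyadic n) u))\<^sup>2)) = ennreal c" "0 \<le> c"
          using False by (metis ennreal_cases infinity_ennreal_def)
        then show ?thesis by (intro exI[of _ "sqrt c"]) simp
      qed
      then obtain C where C: "\<And>i. (SUP n. ennreal ((norm (dquot i (dyadic n) u))\<^sup>2)) = ennreal ((C i)\<^sup>2)" "\<And>i. 0 \<le> C i"
        by metis
      have "norm (dquot i (dyadic n) u) \<le> C i" for i n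
      proof -
        have "ennreal ((norm (dquot i (dyadic n) u))\<^sup>2) \<le> ennreal ((C i)\<^sup>2)"
          unfolding C(1)[symmetric] by (rule SUP_upper) simp
        then have "(norm (dquot i (dyadic n) u))\<^sup>2 \<le> (C i)\<^sup>2" by (simp only: ennreal_le_iff zero_le_power2)
        then show ?thesis using C(2) by (rule power2_le_imp_le)
      qed
      then have "\<exists>g. norm g \<le> C i \<and> (\<forall>w w'. test_deriv i w w' \<longrightarrow> inner u w' = - inner g w)" for i
        using weak_derivative_of_bounded_dquot[of i u "C i"] by metis
      then obtain g where g: "\<And>i. norm (g i) \<le> C i"
        "\<And>i w w'. test_deriv i w w' \<Longrightarrow> inner u w' = - inner (g i) w" by metis
      then have "weak_gradient u g" by (simp add: weak_gradient_iff)
      then have "grad_norm_sq u = (\<Sum>i\<in>UNIV. ennreal ((norm (g i))\<^sup>2))" by (simp add: grad_norm_sq_eq)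
      also have "\<dots> \<le> (\<Sum>i\<in>UNIV. ennreal ((C i)\<^sup>2))"
        using g(1) by (intro sum_mono ennreal_leI power_mono) auto
      finally show ?thesis unfolding swap C(1) .
    qed
    show "(SUP n. \<Sum>i\<in>UNIV. ennreal ((norm (dquot i (dyadic n) u))\<^sup>2)) \<le> grad_norm_sq u"
    proof (cases "\<exists>g. weak_gradient u g")
      case True
      then obtain g where g: "weak_gradient u g" ..
      show ?thesis
      proof (rule SUP_least)
        fix n
        have "(\<Sum>i\<in>UNIV. ennreal ((norm (dquot i (dyadic n) u))\<^sup>2)) \<le> (\<Sum>i\<in>UNIV. ennreal ((norm (g i))\<^sup>2))"
          using norm_dquot_le[OF g dyadic(1)] by (intro sum_mono ennreal_leI power_mono) auto
        then show "(\<Sum>i\<in>UNIV. ennreal ((norm (dquot i (dyadic n) u))\<^sup>2)) \<le> grad_norm_sq u"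
          by (simp add: grad_norm_sq_eq[OF g])
      qed
    qed (simp add: grad_norm_sq_def)
  qed
qed

lemma incseq_dquot_sum: "incseq (\<lambda>n. \<Sum>i\<in>UNIV. ennreal ((norm (dquot i (dyadic n) u))\<^sup>2))"
  using incseq_norm_dquot[of _ u] unfolding incseq_def by (auto intro!: ennreal_leI power_mono sum_mono)

section \<open>The Schroedinger group commutes with translations\<close>

definition laplacian :: "(real^'d::finite \<Rightarrow> real) \<Rightarrow> real^'d \<Rightarrow> real" where
  "laplacian \<phi> x = (\<Sum>i\<in>UNIV. pd i (pd i \<phi>) x)"

lemma test_function_sum:
  "finite I \<Longrightarrow> (\<And>i. i \<in> I \<Longrightarrow> test_function (f i)) \<Longrightarrow> test_function (\<lambda>x. \<Sum>i\<in>I. f i x)"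
  by (induction I rule: finite_induct) (auto intro: test_function_zero test_function_add)

lemma L2_test_sum:
  "finite I \<Longrightarrow> (\<And>i. i \<in> I \<Longrightarrow> test_function (f i)) \<Longrightarrow> L2_test (\<lambda>x. \<Sum>i\<in>I. f i x) = (\<Sum>i\<in>I. L2_test (f i))"
  by (induction I rule: finite_induct) (auto simp: L2_test_zero L2_test_add test_function_sum)

lemma test_function_laplacian: "test_function \<phi> \<Longrightarrow> test_function (laplacian \<phi>)"
  unfolding laplacian_def[abs_def] by (intro test_function_sum test_function_pd) auto

lemma L2_test_laplacian: "test_function \<phi> \<Longrightarrow> L2_test (laplacian \<phi>) = (\<Sum>i\<in>UNIV. L2_test (pd i (pd i \<phi>)))"
  unfolding laplacian_def[abs_def] by (intro L2_test_sum test_function_pd) auto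

lemma laplacian_translate:
  assumes "test_function \<phi>" shows "laplacian (\<lambda>x. \<phi> (x + a)) = (\<lambda>x. laplacian \<phi> (x + a))"
proof -
  have pd: "pd i (\<lambda>x. \<phi> (x + a)) = (\<lambda>x. pd i \<phi> (x + a))" if "test_function \<phi>" for i \<phi>
    using that by (intro ext pd_translate smooth_differentiable) (simp add: test_function_smooth)
  show ?thesis by (simp add: laplacian_def[abs_def] pd assms test_function_pd)
qed

lemma weak_laplacian_iff:
  "weak_laplacian u f \<longleftrightarrow> (\<forall>\<phi>. test_function \<phi> \<longrightarrow>
     inner u (L2_test (laplacian \<phi>)) = inner f (L2_test \<phi>) \<and>
     inner u (\<i> *\<^sub>C L2_test (laplacian \<phi>)) = inner f (\<i> *\<^sub>C L2_test \<phi>))"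
proof -
  have "(\<lambda>x. \<Sum>i\<in>UNIV. pd i (pd i \<phi>) x) = laplacian \<phi>" for \<phi> :: "real^'a \<Rightarrow> real"
    by (simp add: laplacian_def fun_eq_iff)
  then show ?thesis unfolding weak_laplacian_def
    by (auto simp: test_pairing_inner test_function_laplacian complex_eq_iff)
qed

text \<open>The translation moves to the test function by taking its adjoint, and there it commutes
  with the classical Laplacian.\<close>

lemma weak_laplacian_translate:
  assumes "weak_laplacian u f" shows "weak_laplacian (translate a u) (translate a f)"
  unfolding weak_laplacian_iff
proof (intro allI impI)
  fix \<phi> :: "real^'a \<Rightarrow> real" assume \<phi>: "test_function \<phi>"
  have "test_function (\<lambda>x. \<phi> (x + - a))" using \<phi> by (rule test_function_translate)
  with assms \<phi> show "inner (translate a u) (L2_test (laplacian \<phi>)) = inner (translate a f) (L2_test \<phi>) \<and>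
     inner (translate a u) (\<i> *\<^sub>C L2_test (laplacian \<phi>)) = inner (translate a f) (\<i> *\<^sub>C L2_test \<phi>)"
    unfolding weak_laplacian_iff inner_translate_left translate_cscale
    using translate_L2_test[OF \<phi>, of "- a"] translate_L2_test[OF test_function_laplacian[OF \<phi>], of "- a"]
      laplacian_translate[OF \<phi>, of "- a"] by (metis (no_types, lifting))
qed

lemma weak_laplacian_test:
  assumes d: "\<And>i. test_deriv i w (d i)" and dd: "\<And>i. test_deriv i (d i) (dd i)"
  shows "weak_laplacian w (\<Sum>i\<in>UNIV. dd i)"
proof -
  have *: "inner w v'' = inner (dd i) v" if "test_deriv i v v'" "test_deriv i v' v''" for i v v' v''
  proof -
    have "inner w v'' = - inner (d i) v'"
      using weak_gradient_test[of w d, OF d] that(2) unfolding weak_gradient_iff by blast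
    \<comment> \<open>\<open>weak_gradient_test\<close> asks for a derivative in every direction.
      Only the one in direction \<open>i\<close> is prescribed, so arbitrary choices are made
      elsewhere and overwritten at \<open>i\<close>.\<close>
    obtain g where g: "\<And>j. test_deriv j (d i) (g j)"
      using tests_deriv[of "d i"] test_deriv_tests[OF d[of i]] by metis
    then have g': "\<And>j. test_deriv j (d i) ((g(i := dd i)) j)" using dd by simp
    have "inner (d i) v' = - inner (dd i) v"
      using weak_gradient_test[OF g'] that(1) unfolding weak_gradient_iff by (metis fun_upd_same)
    then show ?thesis using \<open>inner w v'' = - inner (d i) v'\<close> by simp
  qed
  show ?thesis unfolding weak_laplacian_iff
  proof (intro allI impI conjI)
    fix \<phi> :: "real^'a \<Rightarrow> real" assume \<phi>: "test_function \<phi>"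
    have "inner w (L2_test (pd i (pd i \<phi>))) = inner (dd i) (L2_test \<phi>)" for i
      by (rule *[OF test_deriv_L2_test(1)[OF \<phi>] test_deriv_L2_test(1)[OF test_function_pd[OF \<phi>]]])
    then show "inner w (L2_test (laplacian \<phi>)) = inner (\<Sum>i\<in>UNIV. dd i) (L2_test \<phi>)"
      by (simp add: L2_test_laplacian[OF \<phi>] inner_sum_left inner_sum_right)
    have "inner w (\<i> *\<^sub>C L2_test (pd i (pd i \<phi>))) = inner (dd i) (\<i> *\<^sub>C L2_test \<phi>)" for i
      by (rule *[OF test_deriv_L2_test(2)[OF \<phi>] test_deriv_L2_test(2)[OF test_function_pd[OF \<phi>]]])
    then show "inner w (\<i> *\<^sub>C L2_test (laplacian \<phi>)) = inner (\<Sum>i\<in>UNIV. dd i) (\<i> *\<^sub>C L2_test \<phi>)"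
      by (simp add: L2_test_laplacian[OF \<phi>] inner_sum_left inner_sum_right
          linear_sum[OF bounded_linear.linear[OF bounded_linear_cscale]])
  qed
qed

lemma minus_i_laplacian_translate:
  "minus_i_laplacian u v \<Longrightarrow> minus_i_laplacian (translate a u) (translate a v)"
  unfolding minus_i_laplacian_def using weak_laplacian_translate translate_cscale by metis

text \<open>Test functions and their multiples by \<open>\<i>\<close> lie in the domain of the
  generator. This reduces identities between operators to pairings with elements of the
  domain.\<close>

lemma minus_i_laplacian_separates:
  assumes "\<And>w z. minus_i_laplacian w z \<Longrightarrow> inner v w = 0" shows "v = 0"
proof (rule L2_eq_0_if_test_pairings_0)
  fix \<phi> :: "real^'a \<Rightarrow> real" assume \<phi>: "test_function \<phi>"
  have "inner v w = 0" if "weak_laplacian w f" for w f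
    using that assms unfolding minus_i_laplacian_def by blast
  from this[OF weak_laplacian_test[OF test_deriv_L2_test(1) test_deriv_L2_test(1)]]
    this[OF weak_laplacian_test[OF test_deriv_L2_test(2) test_deriv_L2_test(2)]]
  show "test_pairing v \<phi> = 0"
    using \<phi> test_function_pd[OF \<phi>] by (simp add: test_pairing_inner complex_eq_iff)
qed

text \<open>Polarization. Together with the group law it makes \<open>S (- t)\<close> the adjoint of
  \<open>S t\<close>.\<close>

lemma inner_eq_if_norm_eq:
  assumes "\<And>x y. f (x + y) = f x + f y" "\<And>x. norm (f x) = norm x"
  shows "inner (f x) (f y) = inner x y"
  by (simp add: dot_norm flip: assms)

section \<open>Consequences of the group law and of the generator\<close>

locale schroedinger =
  fixes S :: "real \<Rightarrow> 'd::finite L2 \<Rightarrow> 'd L2"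
  assumes S: "schroedinger_group S"
begin

lemma S_add: "S t (u + v) = S t u + S t v"
  and S_cscale: "S t (c *\<^sub>C u) = c *\<^sub>C S t u"
  and norm_S [simp]: "norm (S t u) = norm u"
  and S_0 [simp]: "S 0 u = u"
  and S_S: "S s (S t u) = S (s + t) u"
  and continuous_S: "continuous_on UNIV (\<lambda>t. S t u)"
  using S by (auto simp: schroedinger_group_def unitary_group_def)

lemma generator:
  "minus_i_laplacian u v \<longleftrightarrow> ((\<lambda>h. (S h u - u) /\<^sub>R h) \<longlongrightarrow> v) (at 0)"
  using S by (simp add: schroedinger_group_def is_generator_def)

lemma bounded_linear_S: "bounded_linear (S t)"
  by (rule bounded_linear_intro[where K = 1]) (auto simp: S_add scaleR_L2_def S_cscale)

lemmas S_diff = linear_diff[OF bounded_linear.linear[OF bounded_linear_S]]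
lemmas S_scaleR = linear_scale[OF bounded_linear.linear[OF bounded_linear_S]]

lemma inner_S_left: "inner (S t u) v = inner u (S (- t) v)"
  using inner_eq_if_norm_eq[of "S t" u "S (- t) v"] by (simp add: S_add S_S)

lemma generator_S:
  assumes "minus_i_laplacian u v" shows "minus_i_laplacian (S s u) (S s v)"
proof -
  have "(S h (S s u) - S s u) /\<^sub>R h = S s ((S h u - u) /\<^sub>R h)" for h
    by (simp add: S_S S_diff S_scaleR add.commute)
  then show ?thesis using assms unfolding generator
    by (simp add: bounded_linear.tendsto[OF bounded_linear_S])
qed

text \<open>Differentiating \<open>inner (S h p) r = inner p (S (- h) r)\<close> at
  \<open>h = 0\<close> yields skewness from unitarity alone, with no integration by parts.\<close>

lemma generator_skew:
  fixes p r :: "'d L2"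
  assumes "minus_i_laplacian p p'" "minus_i_laplacian r r'"
  shows "inner p' r + inner p r' = 0"
proof -
  have L: "((\<lambda>h. inner ((S h p - p) /\<^sub>R h) r) \<longlongrightarrow> inner p' r) (at 0)"
    using assms(1) unfolding generator by (intro tendsto_intros)
  have "((\<lambda>h. (S (- h) r - r) /\<^sub>R (- h)) \<longlongrightarrow> r') (at 0)"
    using assms(2) unfolding generator
    by (rule filterlim_compose[where f = uminus])
       (auto simp: filterlim_at eventually_at intro!: tendsto_eq_intros exI[of _ 1])
  then have R: "((\<lambda>h. - inner p ((S (- h) r - r) /\<^sub>R (- h))) \<longlongrightarrow> - inner p r') (at 0)"
    by (intro tendsto_intros)
  have eq: "- inner p ((S (- h) r - r) /\<^sub>R (- h)) = inner ((S h p - p) /\<^sub>R h) r" for h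
    by (simp add: inner_diff inner_S_left)
  have "inner p' r = - inner p r'"
    using tendsto_unique[OF at_neq_bot L R[unfolded eq]] .
  then show ?thesis by simp
qed

lemma S_has_derivative:
  assumes "minus_i_laplacian u v"
  shows "((\<lambda>s. S s u) has_derivative (\<lambda>h. h *\<^sub>R S s v)) (at s)"
  unfolding has_derivative_at
proof
  show "bounded_linear (\<lambda>h. h *\<^sub>R S s v)" by (rule bounded_linear_scaleR_left)
  have "((\<lambda>h. (S h (S s u) - S s u) /\<^sub>R h) \<longlongrightarrow> S s v) (at 0)"
    using generator_S[OF assms] unfolding generator .
  then have "((\<lambda>h. norm ((S h (S s u) - S s u) /\<^sub>R h - S s v)) \<longlongrightarrow> norm (S s v - S s v)) (at 0)"
    by (intro tendsto_intros)
  moreover have "norm ((S h (S s u) - S s u) /\<^sub>R h - S s v) = norm (S (s + h) u - S s u - h *\<^sub>R S s v) / norm h"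
    if "h \<noteq> 0" for h
  proof -
    have "(S h (S s u) - S s u) /\<^sub>R h - S s v = (S (s + h) u - S s u - h *\<^sub>R S s v) /\<^sub>R h"
      using that by (simp add: S_S add.commute scaleR_diff_right)
    then show ?thesis by (simp add: divide_inverse)
  qed
  ultimately show "((\<lambda>h. norm (S (s + h) u - S s u - h *\<^sub>R S s v) / norm h) \<longlongrightarrow> 0) (at 0)"
    by (auto elim!: Lim_transform_eventually simp: eventually_at_filter)
qed

text \<open>For \<open>u\<close> and \<open>w\<close> in the domain of the generator, which is skew and commutes with translations,
  the pairing of the translate of \<open>S s u\<close> with \<open>S (s - t) w\<close> does not depend on \<open>s\<close>.\<close>

lemma S_translate_domain:
  assumes u: "minus_i_laplacian u v" shows "S t (translate a u) = translate a (S t u)"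
proof -
  have "S t (translate a u) - translate a (S t u) = 0"
  proof (rule minus_i_laplacian_separates)
    fix w z :: "'d L2" assume w: "minus_i_laplacian w z"
    \<comment> \<open>At \<open>s = 0\<close> and at \<open>s = t\<close> this is the pairing of
      \<open>w\<close> with \<open>S t (translate a u)\<close> and with
      \<open>translate a (S t u)\<close>, once \<open>S (- t)\<close> has been moved to the other
      side.\<close>
    define f where "f s = inner (translate a (S s u)) (S (s - t) w)" for s
    have "(f has_real_derivative 0) (at s)" for s
    proof -
      have "((\<lambda>s. s - t) has_derivative (\<lambda>h. h)) (at s)" by (auto intro!: derivative_eq_intros)
      from has_derivative_compose[OF this S_has_derivative[OF w]]
      have "((\<lambda>s. S (s - t) w) has_derivative (\<lambda>h. h *\<^sub>R S (s - t) z)) (at s)" .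
      moreover have "((\<lambda>s. translate a (S s u)) has_derivative (\<lambda>h. translate a (h *\<^sub>R S s v))) (at s)"
        by (rule bounded_linear.has_derivative[OF bounded_linear_translate S_has_derivative[OF u]])
      ultimately have "(f has_derivative (\<lambda>h. inner (translate a (S s u)) (h *\<^sub>R S (s - t) z)
          + inner (translate a (h *\<^sub>R S s v)) (S (s - t) w))) (at s)"
        unfolding f_def by (intro has_derivative_inner)
      moreover have "inner (translate a (S s u)) (h *\<^sub>R S (s - t) z) + inner (translate a (h *\<^sub>R S s v)) (S (s - t) w) = 0" for h
        using generator_skew[OF minus_i_laplacian_translate[OF generator_S[OF u]] generator_S[OF w], of a s "s - t"]
        by (simp add: translate_scaleR add.commute flip: distrib_left)
      ultimately have "(f has_derivative (\<lambda>h. 0)) (at s)" by (simp only:)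
      then show ?thesis by (simp only: has_field_derivative_def lambda_zero)
    qed
    then have "f t = f 0" using DERIV_isconst_all by blast
    then show "inner (S t (translate a u) - translate a (S t u)) w = 0"
      by (simp add: f_def inner_diff_left inner_S_left)
  qed
  then show ?thesis by simp
qed

text \<open>Taking adjoints transfers both operators to \<open>w\<close>, which lies in the domain,
  where the commutation for \<open>- t\<close> and \<open>- a\<close> is known; \<open>u\<close> is
  then arbitrary.\<close>

lemma S_translate: "S t (translate a u) = translate a (S t u)"
proof -
  have "S t (translate a u) - translate a (S t u) = 0"
  proof (rule minus_i_laplacian_separates)
    fix w z :: "'d L2" assume w: "minus_i_laplacian w z"
    show "inner (S t (translate a u) - translate a (S t u)) w = 0"
      using S_translate_domain[OF w, of "- t" "- a"]
      by (simp add: inner_diff_left inner_S_left inner_translate_left)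
  qed
  then show ?thesis by simp
qed

lemma S_dquot: "S t (dquot i h u) = dquot i h (S t u)"
  by (simp add: dquot_def S_scaleR S_diff S_translate)

end

section \<open>Weak measurability and Wiener increments\<close>

text \<open>Tonelli's theorem for the counting measure.\<close>

lemma ennreal_suminf_swap:
  fixes f :: "nat \<Rightarrow> nat \<Rightarrow> ennreal"
  shows "(\<Sum>i. \<Sum>j. f i j) = (\<Sum>j. \<Sum>i. f i j)"
  using nn_integral_suminf[of "\<lambda>i j. f i j" "count_space UNIV"] by (simp add: nn_integral_count_space_nat)

lemma centred_normal_moments:
  assumes v: "0 \<le> v"
  shows "integrable (centred_normal v) (\<lambda>x. x)" "(\<integral>x. x \<partial>centred_normal v) = 0"
    "integrable (centred_normal v) (\<lambda>x. x\<^sup>2)" "(\<integral>x. x\<^sup>2 \<partial>centred_normal v) = v"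
proof -
  have "integrable (centred_normal v) (\<lambda>x. x) \<and> (\<integral>x. x \<partial>centred_normal v) = 0 \<and>
    integrable (centred_normal v) (\<lambda>x. x\<^sup>2) \<and> (\<integral>x. x\<^sup>2 \<partial>centred_normal v) = v"
  proof (cases "v = 0")
    case True
    then have d: "centred_normal v = return borel 0" by (simp add: centred_normal_def)
    have int: "integrable (return borel 0) f" if "f \<in> borel_measurable borel" for f :: "real \<Rightarrow> real"
      using that by (intro integrableI_bounded) (auto simp: nn_integral_return)
    have "integrable (centred_normal v) (\<lambda>x. x)" "integrable (centred_normal v) (\<lambda>x. x\<^sup>2)"
      unfolding d by (rule int, measurable)+
    moreover have "(\<integral>x. x \<partial>centred_normal v) = 0" "(\<integral>x. x\<^sup>2 \<partial>centred_normal v) = 0"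
      unfolding d by (subst integral_return; simp)+
    ultimately show ?thesis using True by simp
  next
    case False
    then have s: "sqrt v > 0" using v by simp
    have d: "centred_normal v = density lborel (\<lambda>x. ennreal (normal_density 0 (sqrt v) x))"
      using False by (simp add: centred_normal_def)
    have "has_bochner_integral lborel (\<lambda>x. normal_density 0 (sqrt v) x *\<^sub>R x) 0"
      using normal_moment_odd[OF s, of 0 0] by simp
    moreover have "has_bochner_integral lborel (\<lambda>x. normal_density 0 (sqrt v) x *\<^sub>R x\<^sup>2) v"
      using normal_moment_even[OF s, of 0 1] v by simp
    moreover have "integrable (centred_normal v) g \<longleftrightarrow> integrable lborel (\<lambda>x. normal_density 0 (sqrt v) x *\<^sub>R g x)"
      "(\<integral>x. g x \<partial>centred_normal v) = (\<integral>x. normal_density 0 (sqrt v) x *\<^sub>R g x \<partial>lborel)"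
      if "g \<in> borel_measurable borel" for g :: "real \<Rightarrow> real"
      unfolding d using that by (intro integrable_density integral_density; simp)+
    from this[of "\<lambda>x. x"] this[of "\<lambda>x. x\<^sup>2"]
    have "integrable (centred_normal v) (\<lambda>x. x) \<longleftrightarrow> integrable lborel (\<lambda>x. normal_density 0 (sqrt v) x *\<^sub>R x)"
      "(\<integral>x. x \<partial>centred_normal v) = (\<integral>x. normal_density 0 (sqrt v) x *\<^sub>R x \<partial>lborel)"
      "integrable (centred_normal v) (\<lambda>x. x\<^sup>2) \<longleftrightarrow> integrable lborel (\<lambda>x. normal_density 0 (sqrt v) x *\<^sub>R x\<^sup>2)"
      "(\<integral>x. x\<^sup>2 \<partial>centred_normal v) = (\<integral>x. normal_density 0 (sqrt v) x *\<^sub>R x\<^sup>2 \<partial>lborel)"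
      by simp_all
    ultimately show ?thesis unfolding has_bochner_integral_iff by simp
  qed
  then show "integrable (centred_normal v) (\<lambda>x. x)" "(\<integral>x. x \<partial>centred_normal v) = 0"
    "integrable (centred_normal v) (\<lambda>x. x\<^sup>2)" "(\<integral>x. x\<^sup>2 \<partial>centred_normal v) = v" by auto
qed

text \<open>The type \<open>L2\<close> is not shown to be second countable, so sums of Borel measurable functions into it are
  not known to be Borel measurable. Weak measurability has all closure properties that are needed.\<close>

definition wmeas :: "'a measure \<Rightarrow> ('a \<Rightarrow> 'b::real_inner) \<Rightarrow> bool" where
  "wmeas N X \<longleftrightarrow> (\<forall>h. (\<lambda>\<omega>. inner (X \<omega>) h) \<in> borel_measurable N)"

lemma wmeasD [measurable_dest]: "wmeas N X \<Longrightarrow> (\<lambda>\<omega>. inner (X \<omega>) h) \<in> borel_measurable N"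
  by (simp add: wmeas_def)

lemma wmeas_borel: "X \<in> borel_measurable N \<Longrightarrow> wmeas N X"
  unfolding wmeas_def
  by (intro allI borel_measurable_continuous_on[where f = "\<lambda>x. inner x _"] continuous_intros)

lemma wmeas_add: "wmeas N X \<Longrightarrow> wmeas N Y \<Longrightarrow> wmeas N (\<lambda>\<omega>. X \<omega> + Y \<omega>)"
  by (auto simp: wmeas_def inner_add_left intro!: borel_measurable_add)

lemma wmeas_diff: "wmeas N X \<Longrightarrow> wmeas N Y \<Longrightarrow> wmeas N (\<lambda>\<omega>. X \<omega> - Y \<omega>)"
  by (auto simp: wmeas_def inner_diff_left intro!: borel_measurable_diff)

text \<open>\<open>k\<close> is the value at \<open>h\<close> of the adjoint of \<open>B\<close>.
  Having it vector by vector is enough to treat the coordinates of \<open>B (X \<omega>)\<close> as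
  coordinates of \<open>X \<omega>\<close>.\<close>

lemma bounded_linear_representer:
  fixes B :: "'b::{real_inner, complete_space} \<Rightarrow> 'c::real_inner"
  assumes "bounded_linear B" obtains k where "\<And>x. inner (B x) h = inner x k"
  using riesz_representation[OF bounded_linear_compose[OF bounded_linear_inner_left assms]] by blast

lemma wmeas_bounded_linear:
  fixes B :: "'b::{real_inner, complete_space} \<Rightarrow> 'c::real_inner"
  assumes "bounded_linear B" "wmeas N X" shows "wmeas N (\<lambda>\<omega>. B (X \<omega>))"
  unfolding wmeas_def
proof
  fix h
  obtain k where "\<And>x. inner (B x) h = inner x k" using bounded_linear_representer[OF assms(1)] by blast
  then show "(\<lambda>\<omega>. inner (B (X \<omega>)) h) \<in> borel_measurable N" using assms(2) by (simp add: wmeas_def)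
qed

text \<open>Splits an expectation over the finitely many events on which \<open>\<Phi>\<close> is
  constant, so that a random operator can be replaced by a fixed one on each event.\<close>

lemma nn_integral_simple_partition:
  assumes \<Phi>: "simple_function N \<Phi>" and sub: "subalgebra M N"
    and meas: "\<And>c. c \<in> \<Phi> ` space M \<Longrightarrow> g c \<in> borel_measurable M"
  shows "(\<integral>\<^sup>+\<omega>. g (\<Phi> \<omega>) \<omega> \<partial>M) = (\<Sum>c\<in>\<Phi> ` space M. \<integral>\<^sup>+\<omega>. indicator (\<Phi> -` {c} \<inter> space M) \<omega> * g c \<omega> \<partial>M)"
proof -
  have sp: "space N = space M" "sets N \<subseteq> sets M" using sub by (auto simp: subalgebra_def)
  have fin: "finite (\<Phi> ` space M)" using \<Phi> unfolding sp(1)[symmetric] by (rule simple_functionD(1))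
  have sets: "\<Phi> -` {c} \<inter> space M \<in> sets M" for c
    using simple_functionD(2)[OF \<Phi>, of "{c}"] sp by auto
  have "(\<integral>\<^sup>+\<omega>. g (\<Phi> \<omega>) \<omega> \<partial>M) = (\<integral>\<^sup>+\<omega>. (\<Sum>c\<in>\<Phi> ` space M. indicator (\<Phi> -` {c} \<inter> space M) \<omega> * g c \<omega>) \<partial>M)"
  proof (rule nn_integral_cong)
    fix \<omega> assume \<omega>: "\<omega> \<in> space M"
    have "(\<Sum>c\<in>\<Phi> ` space M. indicator (\<Phi> -` {c} \<inter> space M) \<omega> * g c \<omega>)
        = (\<Sum>c\<in>\<Phi> ` space M. if c = \<Phi> \<omega> then g (\<Phi> \<omega>) \<omega> else 0)"
      using \<omega> by (intro sum.cong) (auto simp: indicator_def)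
    also have "\<dots> = g (\<Phi> \<omega>) \<omega>" using \<omega> fin by (simp add: sum.delta)
    finally show "g (\<Phi> \<omega>) \<omega> = (\<Sum>c\<in>\<Phi> ` space M. indicator (\<Phi> -` {c} \<inter> space M) \<omega> * g c \<omega>)" by simp
  qed
  also have "\<dots> = (\<Sum>c\<in>\<Phi> ` space M. \<integral>\<^sup>+\<omega>. indicator (\<Phi> -` {c} \<inter> space M) \<omega> * g c \<omega> \<partial>M)"
    using meas sets by (intro nn_integral_sum borel_measurable_times_ennreal borel_measurable_indicator) auto
  finally show ?thesis .
qed

locale onb =
  fixes e :: "nat \<Rightarrow> 'd::finite L2"
  assumes e: "orthonormal_basis e"
begin

lemma norm_sums: "(\<lambda>j. (inner x (e j))\<^sup>2) sums (norm x)\<^sup>2"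
  using e by (intro parseval) (auto simp: orthonormal_basis_def)

lemma norm_suminf: "ennreal ((norm x)\<^sup>2) = (\<Sum>j. ennreal ((inner x (e j))\<^sup>2))"
  using norm_sums by (intro suminf_ennreal_eq[symmetric]) auto

text \<open>Here the countable basis enters: the squared norm is a series of squares of measurable
  coordinates.\<close>

lemma wmeas_norm [measurable_dest]:
  fixes X :: "_ \<Rightarrow> 'd L2"
  assumes "wmeas N X" shows "(\<lambda>\<omega>. ennreal ((norm (X \<omega>))\<^sup>2)) \<in> borel_measurable N"
  unfolding norm_suminf
proof (rule borel_measurable_suminf_order)
  fix j
  have "(\<lambda>\<omega>. inner (X \<omega>) (e j)) \<in> borel_measurable N" using assms by (simp add: wmeas_def)
  then show "(\<lambda>\<omega>. ennreal ((inner (X \<omega>) (e j))\<^sup>2)) \<in> borel_measurable N" by measurable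
qed

end

section \<open>Moments and independence of Wiener increments\<close>

locale wiener_setup = prob_space M + onb e
  for M :: "'a measure" and e :: "nat \<Rightarrow> 'd::finite L2" +
  fixes F :: "real \<Rightarrow> 'a measure" and Q R :: "'d L2 \<Rightarrow> 'd L2" and W :: "real \<Rightarrow> 'a \<Rightarrow> 'd L2"
  assumes F: "normal_filtration M F" and R: "is_op_sqrt R Q" and W: "Q_wiener M F Q W"
begin

lemma subalgebra_F: "0 \<le> t \<Longrightarrow> subalgebra M (F t)"
  using F by (simp add: normal_filtration_def)

lemma space_F: "0 \<le> t \<Longrightarrow> space (F t) = space M"
  using subalgebra_F by (simp add: subalgebra_def)

lemma sets_F_mono: "0 \<le> s \<Longrightarrow> s \<le> t \<Longrightarrow> sets (F s) \<subseteq> sets (F t)"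
  using F unfolding normal_filtration_def by blast

lemma F_mono:
  assumes "0 \<le> s" "s \<le> t" "f \<in> borel_measurable (F s)" shows "f \<in> borel_measurable (F t)"
proof (rule measurable_from_subalg[OF _ assms(3)])
  show "subalgebra (F t) (F s)"
    using sets_F_mono[OF assms(1,2)] space_F[of s] space_F[of t] assms(1,2) by (simp add: subalgebra_def)
qed

lemma F_meas: "0 \<le> s \<Longrightarrow> f \<in> borel_measurable (F s) \<Longrightarrow> f \<in> borel_measurable M"
  using subalgebra_F by (rule measurable_from_subalg)

lemma wmeas_F: "0 \<le> s \<Longrightarrow> wmeas (F s) X \<Longrightarrow> wmeas M X"
  by (auto simp: wmeas_def intro: F_meas)

lemma wmeas_W:
  assumes "0 \<le> s" "s \<le> t" shows "wmeas (F t) (\<lambda>\<omega>. W t \<omega> - W s \<omega>)"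
proof (rule wmeas_diff)
  show "wmeas (F t) (W t)" using W assms by (intro wmeas_borel) (auto simp: Q_wiener_def)
  have "wmeas (F s) (W s)" using W assms by (intro wmeas_borel) (auto simp: Q_wiener_def)
  then show "wmeas (F t) (W s)" using F_mono[OF assms] by (auto simp: wmeas_def)
qed

lemma selfadjoint_R: "inner (R u) v = inner u (R v)"
  using R by (auto simp: is_op_sqrt_def nonneg_selfadjoint_def)

lemma inner_Q: "inner (Q h) h = (norm (R h))\<^sup>2"
proof -
  have "Q h = R (R h)" using R by (auto simp: is_op_sqrt_def)
  then show ?thesis by (simp add: selfadjoint_R power2_norm_eq_inner)
qed

lemma increment_moments:
  assumes st: "0 \<le> s" "s \<le> t"
  defines "y \<equiv> \<lambda>h \<omega>. inner (W t \<omega> - W s \<omega>) h"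
  shows "integrable M (y h)" "(\<integral>\<omega>. y h \<omega> \<partial>M) = 0"
    "integrable M (\<lambda>\<omega>. (y h \<omega>)\<^sup>2)" "(\<integral>\<omega>. (y h \<omega>)\<^sup>2 \<partial>M) = (t - s) * (norm (R h))\<^sup>2"
proof -
  have [measurable]: "y h \<in> borel_measurable M"
    using wmeas_F[OF _ wmeas_W[OF st]] st unfolding y_def by (simp add: wmeas_def)
  have d: "distr M borel (y h) = centred_normal ((t - s) * (norm (R h))\<^sup>2)"
    using W st unfolding Q_wiener_def y_def inner_Q[symmetric] by blast
  have "0 \<le> (t - s) * (norm (R h))\<^sup>2" using st by simp
  note m = centred_normal_moments[OF this, folded d]
  show "integrable M (y h)" "integrable M (\<lambda>\<omega>. (y h \<omega>)\<^sup>2)"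
    using m(1,3) by (auto simp: integrable_distr_eq)
  show "(\<integral>\<omega>. y h \<omega> \<partial>M) = 0" "(\<integral>\<omega>. (y h \<omega>)\<^sup>2 \<partial>M) = (t - s) * (norm (R h))\<^sup>2"
    using m(2,4) by (auto simp: integral_distr)
qed

text \<open>Preimages under a Borel function of one coordinate are among the preimages of Borel sets
  of the Hilbert space, for which independence is given. The function \<open>f\<close> is a
  parameter so that both the coordinate and its square are covered.\<close>

lemma increment_indep:
  fixes x f :: "_ \<Rightarrow> real"
  assumes st: "0 \<le> s" "s \<le> t" and x: "x \<in> borel_measurable (F s)"
    and f: "f \<in> borel_measurable borel"
  shows "indep_var borel x borel (\<lambda>\<omega>. f (inner (W t \<omega> - W s \<omega>) h))"
  unfolding indep_var_eq
proof (intro conjI indep_set_sigma_sets)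
  let ?d = "\<lambda>\<omega>. W t \<omega> - W s \<omega>"
  let ?y = "\<lambda>\<omega>. f (inner (?d \<omega>) h)"
  show "x \<in> borel_measurable M" using F_meas[OF st(1) x] .
  have "(\<lambda>\<omega>. inner (?d \<omega>) h) \<in> borel_measurable M"
    using wmeas_F[OF _ wmeas_W[OF st]] st by (simp add: wmeas_def)
  then show y: "?y \<in> borel_measurable M" using f by measurable
  have ind: "indep_set (sets (F s)) {?d -` B \<inter> space M | B. B \<in> sets borel}"
    using W st by (simp add: Q_wiener_def)
  have ym: "?y -` A \<inter> space M \<in> {?d -` B \<inter> space M | B. B \<in> sets borel}" if "A \<in> sets borel" for A
  proof -
    have "(\<lambda>v. f (inner v h)) \<in> borel_measurable borel"
      by (rule measurable_compose[OF borel_measurable_continuous_onI f]) (intro continuous_intros)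
    then have "(\<lambda>v. f (inner v h)) -` A \<in> sets borel" using that by (metis measurable_sets_borel)
    moreover have "?y -` A = ?d -` ((\<lambda>v. f (inner v h)) -` A)" by auto
    ultimately show ?thesis by blast
  qed
  have xm: "x -` A \<inter> space M \<in> sets (F s)" if "A \<in> sets borel" for A
    using measurable_sets[OF x that] by (simp add: space_F[OF st(1)])
  show "indep_set {x -` A \<inter> space M |A. A \<in> sets borel} {?y -` A \<inter> space M |A. A \<in> sets borel}"
    using ind unfolding indep_set_def
    by (rule indep_sets_mono_sets) (use ym xm in \<open>auto split: bool.splits\<close>)
  have stable: "Int_stable {g -` A \<inter> space M |A. A \<in> sets borel}" for g :: "'a \<Rightarrow> real"
  proof (rule Int_stableI)
    fix a b assume "a \<in> {g -` A \<inter> space M |A. A \<in> sets borel}" "b \<in> {g -` A \<inter> space M |A. A \<in> sets borel}"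
    then obtain A B where "A \<in> sets borel" "B \<in> sets borel" "a = g -` A \<inter> space M" "b = g -` B \<inter> space M" by blast
    then show "a \<inter> b \<in> {g -` A \<inter> space M |A. A \<in> sets borel}"
      by (intro CollectI exI[of _ "A \<inter> B"]) auto
  qed
  show "Int_stable {x -` A \<inter> space M |A. A \<in> sets borel}" by (rule stable)
  show "Int_stable {?y -` A \<inter> space M |A. A \<in> sets borel}" by (rule stable)
qed

definition wL2 :: "'a measure \<Rightarrow> ('a \<Rightarrow> 'd L2) \<Rightarrow> bool" where
  "wL2 N X \<longleftrightarrow> wmeas N X \<and> (\<forall>h. integrable M (\<lambda>\<omega>. (inner (X \<omega>) h)\<^sup>2))"

text \<open>The isometry is proved coordinate by coordinate in the orthonormal basis, so only the coordinates
  of the partial sums of the integral need to be square integrable.\<close>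

lemma scalar_step:
  assumes st: "0 \<le> s" "s \<le> t" and x[measurable]: "x \<in> borel_measurable (F s)"
    and x2: "integrable M (\<lambda>\<omega>. (x \<omega>)\<^sup>2)" and A: "A \<in> sets (F s)"
  shows "(\<integral>\<^sup>+\<omega>. indicator A \<omega> * ennreal ((x \<omega> + inner (W t \<omega> - W s \<omega>) h)\<^sup>2) \<partial>M)
    = (\<integral>\<^sup>+\<omega>. indicator A \<omega> * ennreal ((x \<omega>)\<^sup>2) \<partial>M) + emeasure M A * ennreal ((t - s) * (norm (R h))\<^sup>2)"
proof -
  define y where "y \<omega> = inner (W t \<omega> - W s \<omega>) h" for \<omega>
  note y = increment_moments[OF st, of h, folded y_def]
  have [measurable]: "A \<in> sets M" using A subalgebra_F[OF st(1)] by (auto simp: subalgebra_def)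
  have xM [measurable]: "x \<in> borel_measurable M" using F_meas[OF st(1) x] .
  have ym [measurable]: "y \<in> borel_measurable M" using y(1) by simp
  have x1: "integrable M x" by (rule square_integrable_imp_integrable[OF xM x2])
  have Ax: "(\<lambda>\<omega>. indicator A \<omega> * x \<omega>) \<in> borel_measurable (F s)" using A by measurable
  have Ax1: "integrable M (\<lambda>\<omega>. indicator A \<omega> * x \<omega>)"
    using integrable_mult_indicator[OF _ x1, of A] by simp
  have Ax2: "integrable M (\<lambda>\<omega>. indicator A \<omega> * (x \<omega>)\<^sup>2)"
    using integrable_mult_indicator[OF _ x2, of A] by simp
  have A1: "integrable M (indicator A :: 'a \<Rightarrow> real)" by (simp add: integrable_indicator_iff less_top[symmetric])
  have i1: "indep_var borel (\<lambda>\<omega>. indicator A \<omega> * x \<omega>) borel y"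
    using increment_indep[OF st Ax, of "\<lambda>z. z" h] by (simp add: y_def[abs_def])
  have i2: "indep_var borel (indicator A) borel (\<lambda>\<omega>. (y \<omega>)\<^sup>2)"
    using increment_indep[OF st, of "indicator A" "\<lambda>z. z\<^sup>2" h] A by (simp add: y_def[abs_def])
  \<comment> \<open>The cross term factorizes by independence, and the increment has mean
    zero.\<close>
  have c1: "integrable M (\<lambda>\<omega>. indicator A \<omega> * x \<omega> * y \<omega>)" "(\<integral>\<omega>. indicator A \<omega> * x \<omega> * y \<omega> \<partial>M) = 0"
    using indep_var_integrable[OF i1 Ax1 y(1)] indep_var_lebesgue_integral[OF i1 Ax1 y(1)] y(2) by auto
  have c2: "integrable M (\<lambda>\<omega>. indicator A \<omega> * (y \<omega>)\<^sup>2)"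
    "(\<integral>\<omega>. indicator A \<omega> * (y \<omega>)\<^sup>2 \<partial>M) = measure M A * ((t - s) * (norm (R h))\<^sup>2)"
    using indep_var_integrable[OF i2 A1 y(3)] indep_var_lebesgue_integral[OF i2 A1 y(3)] y(4) by auto
  have eq: "indicator A \<omega> * (x \<omega> + y \<omega>)\<^sup>2 = indicator A \<omega> * (x \<omega>)\<^sup>2 + 2 * (indicator A \<omega> * x \<omega> * y \<omega>) + indicator A \<omega> * (y \<omega>)\<^sup>2" for \<omega>
    by (simp add: power2_sum algebra_simps)
  have int: "integrable M (\<lambda>\<omega>. indicator A \<omega> * (x \<omega> + y \<omega>)\<^sup>2)"
    unfolding eq using Ax2 c1(1) c2(1) by (intro Bochner_Integration.integrable_add integrable_mult_right) auto
  have e: "indicator A \<omega> * ennreal r = ennreal (indicator A \<omega> * r)" for \<omega> and r :: real by (auto simp: indicator_def)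
  have "(\<integral>\<^sup>+\<omega>. indicator A \<omega> * ennreal ((x \<omega> + y \<omega>)\<^sup>2) \<partial>M) = ennreal (\<integral>\<omega>. indicator A \<omega> * (x \<omega> + y \<omega>)\<^sup>2 \<partial>M)"
    unfolding e using int by (intro nn_integral_eq_integral) auto
  also have "(\<integral>\<omega>. indicator A \<omega> * (x \<omega> + y \<omega>)\<^sup>2 \<partial>M) = (\<integral>\<omega>. indicator A \<omega> * (x \<omega>)\<^sup>2 \<partial>M) + measure M A * ((t - s) * (norm (R h))\<^sup>2)"
    unfolding eq using Ax2 c1 c2 by simp
  also have "ennreal \<dots> = ennreal (\<integral>\<omega>. indicator A \<omega> * (x \<omega>)\<^sup>2 \<partial>M) + ennreal (measure M A) * ennreal ((t - s) * (norm (R h))\<^sup>2)"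
    using st by (simp add: ennreal_mult ennreal_plus integral_nonneg_AE)
  also have "ennreal (\<integral>\<omega>. indicator A \<omega> * (x \<omega>)\<^sup>2 \<partial>M) = (\<integral>\<^sup>+\<omega>. indicator A \<omega> * ennreal ((x \<omega>)\<^sup>2) \<partial>M)"
    unfolding e using Ax2 by (intro nn_integral_eq_integral[symmetric]) auto
  finally show ?thesis by (simp add: y_def emeasure_eq_measure)
qed

text \<open>An operator and its adjoint have the same Hilbert-Schmidt norm: \<open>k i\<close> is
  the adjoint of \<open>C\<close> at \<open>e i\<close>, and \<open>R\<close> is selfadjoint, so
  \<open>R\<close> after that adjoint is the adjoint of \<open>C\<close> after
  \<open>R\<close>.\<close>

lemma HS_swap:
  assumes C: "bounded_linear C" and k: "\<And>i x. inner (C x) (e i) = inner x (k i)"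
  shows "(\<Sum>i. ennreal ((norm (R (k i)))\<^sup>2)) = (\<Sum>j. ennreal ((norm (C (R (e j))))\<^sup>2))"
proof -
  have "(inner (R (k i)) (e j))\<^sup>2 = (inner (C (R (e j))) (e i))\<^sup>2" for i j
    by (metis inner_commute k selfadjoint_R)
  then show ?thesis unfolding norm_suminf by (subst ennreal_suminf_swap) simp
qed

text \<open>Coordinate \<open>i\<close> of \<open>C\<close> applied to the increment is the
  increment's coordinate along \<open>k i\<close>, so \<open>scalar_step\<close> applies to each
  \<open>i\<close>. The sum of the variances is then rewritten by \<open>HS_swap\<close>.\<close>

lemma operator_step:
  fixes C :: "'d L2 \<Rightarrow> 'd L2"
  assumes st: "0 \<le> s" "s \<le> t" and X: "wL2 (F s) X" and A: "A \<in> sets (F s)" and C: "bounded_linear C"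
  shows "(\<integral>\<^sup>+\<omega>. indicator A \<omega> * ennreal ((norm (X \<omega> + C (W t \<omega> - W s \<omega>)))\<^sup>2) \<partial>M)
    = (\<integral>\<^sup>+\<omega>. indicator A \<omega> * ennreal ((norm (X \<omega>))\<^sup>2) \<partial>M)
      + emeasure M A * (ennreal (t - s) * (\<Sum>j. ennreal ((norm (C (R (e j))))\<^sup>2)))"
proof -
  have "\<exists>k. \<forall>x. inner (C x) (e i) = inner x k" for i using bounded_linear_representer[OF C] by blast
  then obtain k where k: "\<And>i x. inner (C x) (e i) = inner x (k i)" by metis
  have AM [measurable]: "A \<in> sets M" using A subalgebra_F[OF st(1)] by (auto simp: subalgebra_def)
  have [measurable]: "wmeas M X" using X wmeas_F[OF st(1)] by (auto simp: wL2_def)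
  have [measurable]: "wmeas M (\<lambda>\<omega>. W t \<omega> - W s \<omega>)" using wmeas_F[OF _ wmeas_W[OF st]] st by simp
  have "(\<integral>\<^sup>+\<omega>. indicator A \<omega> * ennreal ((norm (X \<omega> + C (W t \<omega> - W s \<omega>)))\<^sup>2) \<partial>M)
    = (\<integral>\<^sup>+\<omega>. (\<Sum>i. indicator A \<omega> * ennreal ((inner (X \<omega>) (e i) + inner (W t \<omega> - W s \<omega>) (k i))\<^sup>2)) \<partial>M)"
    unfolding norm_suminf by (simp add: inner_add_left k)
  also have "\<dots> = (\<Sum>i. \<integral>\<^sup>+\<omega>. indicator A \<omega> * ennreal ((inner (X \<omega>) (e i) + inner (W t \<omega> - W s \<omega>) (k i))\<^sup>2) \<partial>M)"
    by (intro nn_integral_suminf) measurable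
  also have "\<dots> = (\<Sum>i. (\<integral>\<^sup>+\<omega>. indicator A \<omega> * ennreal ((inner (X \<omega>) (e i))\<^sup>2) \<partial>M) + emeasure M A * ennreal ((t - s) * (norm (R (k i)))\<^sup>2))"
    using X by (intro suminf_cong scalar_step st A) (auto simp: wL2_def wmeas_def)
  also have "\<dots> = (\<Sum>i. \<integral>\<^sup>+\<omega>. indicator A \<omega> * ennreal ((inner (X \<omega>) (e i))\<^sup>2) \<partial>M) + (\<Sum>i. emeasure M A * ennreal ((t - s) * (norm (R (k i)))\<^sup>2))"
    by (intro suminf_add[symmetric]) auto
  also have "(\<Sum>i. \<integral>\<^sup>+\<omega>. indicator A \<omega> * ennreal ((inner (X \<omega>) (e i))\<^sup>2) \<partial>M) = (\<integral>\<^sup>+\<omega>. (\<Sum>i. indicator A \<omega> * ennreal ((inner (X \<omega>) (e i))\<^sup>2)) \<partial>M)"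
    by (intro nn_integral_suminf[symmetric]) measurable
  also have "\<dots> = (\<integral>\<^sup>+\<omega>. indicator A \<omega> * ennreal ((norm (X \<omega>))\<^sup>2) \<partial>M)"
    unfolding norm_suminf by simp
  also have "(\<Sum>i. emeasure M A * ennreal ((t - s) * (norm (R (k i)))\<^sup>2)) = emeasure M A * (ennreal (t - s) * (\<Sum>i. ennreal ((norm (R (k i)))\<^sup>2)))"
    using st by (simp add: ennreal_mult flip: ennreal_suminf_cmult)
  finally show ?thesis unfolding HS_swap[OF C k] .
qed

lemma inner_simple:
  assumes \<Phi>: "simple_function (F s) \<Phi>" and s: "0 \<le> s" and \<omega>: "\<omega> \<in> space M"
  shows "inner (blinfun_apply (\<Phi> \<omega>) x) h = (\<Sum>c\<in>\<Phi> ` space M. indicator (\<Phi> -` {c} \<inter> space M) \<omega> * inner (blinfun_apply c x) h)"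
proof -
  have fin: "finite (\<Phi> ` space M)" using \<Phi> unfolding space_F[OF s, symmetric] by (rule simple_functionD(1))
  have "(\<Sum>c\<in>\<Phi> ` space M. indicator (\<Phi> -` {c} \<inter> space M) \<omega> * inner (blinfun_apply c x) h)
      = (\<Sum>c\<in>\<Phi> ` space M. if c = \<Phi> \<omega> then inner (blinfun_apply (\<Phi> \<omega>) x) h else 0)"
    using \<omega> by (intro sum.cong) (auto simp: indicator_def)
  also have "\<dots> = inner (blinfun_apply (\<Phi> \<omega>) x) h" using \<omega> fin by (simp add: sum.delta)
  finally show ?thesis by simp
qed

lemma simple_sets:
  assumes "simple_function (F s) \<Phi>" "0 \<le> s" shows "\<Phi> -` {c} \<inter> space M \<in> sets (F s)"
  using simple_functionD(2)[OF assms(1), of "{c}"] space_F[OF assms(2)] by simp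

lemma wmeas_simple:
  fixes \<Phi> :: "'a \<Rightarrow> 'd L2 \<Rightarrow>\<^sub>L 'd L2"
  assumes \<Phi>: "simple_function (F s) \<Phi>" and st: "0 \<le> s" "s \<le> t" and X: "wmeas (F t) X"
  shows "wmeas (F t) (\<lambda>\<omega>. blinfun_apply (\<Phi> \<omega>) (X \<omega>))"
  unfolding wmeas_def
proof
  fix h
  have sp: "space (F t) = space M" using st space_F by auto
  have sets: "\<Phi> -` {c} \<inter> space M \<in> sets (F t)" for c
    using simple_sets[OF \<Phi> st(1)] sets_F_mono[OF st] by blast
  have "(\<lambda>\<omega>. inner (blinfun_apply c (X \<omega>)) h) \<in> borel_measurable (F t)" for c :: "'d L2 \<Rightarrow>\<^sub>L 'd L2"
    using wmeas_bounded_linear[OF blinfun.bounded_linear_right[of c] X] unfolding wmeas_def by blast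
  then have "(\<lambda>\<omega>. \<Sum>c\<in>\<Phi> ` space M. indicator (\<Phi> -` {c} \<inter> space M) \<omega> * inner (blinfun_apply c (X \<omega>)) h) \<in> borel_measurable (F t)"
    using sets by (intro borel_measurable_sum borel_measurable_times borel_measurable_indicator) auto
  also have "?this \<longleftrightarrow> (\<lambda>\<omega>. inner (blinfun_apply (\<Phi> \<omega>) (X \<omega>)) h) \<in> borel_measurable (F t)"
    by (rule measurable_cong) (simp add: inner_simple[OF \<Phi> st(1)] sp)
  finally show "(\<lambda>\<omega>. inner (blinfun_apply (\<Phi> \<omega>) (X \<omega>)) h) \<in> borel_measurable (F t)" .
qed

lemma integrable_square_add:
  fixes x y :: "'a \<Rightarrow> real"
  assumes x: "x \<in> borel_measurable M" "integrable M (\<lambda>\<omega>. (x \<omega>)\<^sup>2)"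
    and y: "y \<in> borel_measurable M" "integrable M (\<lambda>\<omega>. (y \<omega>)\<^sup>2)"
  shows "integrable M (\<lambda>\<omega>. (x \<omega> + y \<omega>)\<^sup>2)"
proof (rule Bochner_Integration.integrable_bound)
  show "integrable M (\<lambda>\<omega>. 2 * (x \<omega>)\<^sup>2 + 2 * (y \<omega>)\<^sup>2)" using x y by auto
  have "norm ((a + b)\<^sup>2) \<le> norm (2 * a\<^sup>2 + 2 * b\<^sup>2)" for a b :: real
  proof -
    have "(a + b)\<^sup>2 \<le> 2 * a\<^sup>2 + 2 * b\<^sup>2" using sum_squares_bound[of a b] by (simp add: power2_sum)
    moreover have "0 \<le> 2 * a\<^sup>2 + 2 * b\<^sup>2" by simp
    ultimately show ?thesis by (simp only: real_norm_def abs_of_nonneg zero_le_power2)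
  qed
  then show "AE \<omega> in M. norm ((x \<omega> + y \<omega>)\<^sup>2) \<le> norm (2 * (x \<omega>)\<^sup>2 + 2 * (y \<omega>)\<^sup>2)" by blast
qed (use x y in measurable)

lemma integrable_square_sum:
  fixes x :: "'c \<Rightarrow> 'a \<Rightarrow> real"
  assumes "finite I" "\<And>i. i \<in> I \<Longrightarrow> x i \<in> borel_measurable M" "\<And>i. i \<in> I \<Longrightarrow> integrable M (\<lambda>\<omega>. (x i \<omega>)\<^sup>2)"
  shows "integrable M (\<lambda>\<omega>. (\<Sum>i\<in>I. x i \<omega>)\<^sup>2)"
  using assms by (induction I rule: finite_induct) (auto intro!: integrable_square_add)

text \<open>On the event that \<open>\<Phi>\<close> takes the value \<open>c\<close>, which belongs
  to the past, \<open>operator_step\<close> applies with \<open>C = c\<close>. The first conclusion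
  restores the hypothesis on \<open>X\<close> at the later time, so steps can be chained.\<close>

lemma simple_step:
  fixes \<Phi> :: "'a \<Rightarrow> 'd L2 \<Rightarrow>\<^sub>L 'd L2"
  assumes st: "0 \<le> s" "s \<le> t" and X: "wL2 (F s) X" and \<Phi>: "simple_function (F s) \<Phi>"
  defines "Y \<equiv> \<lambda>\<omega>. X \<omega> + blinfun_apply (\<Phi> \<omega>) (W t \<omega> - W s \<omega>)"
  shows "wL2 (F t) Y"
    "(\<integral>\<^sup>+\<omega>. ennreal ((norm (Y \<omega>))\<^sup>2) \<partial>M) = (\<integral>\<^sup>+\<omega>. ennreal ((norm (X \<omega>))\<^sup>2) \<partial>M)
      + ennreal (t - s) * (\<integral>\<^sup>+\<omega>. (\<Sum>j. ennreal ((norm (blinfun_apply (\<Phi> \<omega>) (R (e j))))\<^sup>2)) \<partial>M)"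
proof -
  let ?d = "\<lambda>\<omega>. W t \<omega> - W s \<omega>"
  let ?A = "\<lambda>c. \<Phi> -` {c} \<inter> space M"
  have t: "0 \<le> t" using st by simp
  have sub: "subalgebra M (F s)" using st subalgebra_F by simp
  have AM [measurable]: "?A c \<in> sets M" for c using simple_sets[OF \<Phi> st(1), of c] sub by (auto simp: subalgebra_def)
  have dt: "wmeas (F t) ?d" using st by (rule wmeas_W)
  have dM [measurable]: "wmeas M ?d" using wmeas_F[OF t dt] .
  have Xt: "wmeas (F t) X" using X F_mono[OF st] by (auto simp: wL2_def wmeas_def)
  have XM [measurable]: "wmeas M X" using X wmeas_F[OF st(1)] by (auto simp: wL2_def)
  have \<Phi>d: "wmeas (F t) (\<lambda>\<omega>. blinfun_apply (\<Phi> \<omega>) (?d \<omega>))" by (rule wmeas_simple[OF \<Phi> st dt])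
  have "integrable M (\<lambda>\<omega>. (inner (Y \<omega>) h)\<^sup>2)" for h
  proof -
    have cm: "(\<lambda>\<omega>. inner (blinfun_apply c (?d \<omega>)) h) \<in> borel_measurable M"
      "integrable M (\<lambda>\<omega>. (inner (blinfun_apply c (?d \<omega>)) h)\<^sup>2)" for c :: "'d L2 \<Rightarrow>\<^sub>L 'd L2"
    proof -
      obtain k where k: "\<And>x. inner (blinfun_apply c x) h = inner x k"
        using bounded_linear_representer[OF blinfun.bounded_linear_right] by blast
      show "integrable M (\<lambda>\<omega>. (inner (blinfun_apply c (?d \<omega>)) h)\<^sup>2)"
        unfolding k using increment_moments(3)[OF st] .
      show "(\<lambda>\<omega>. inner (blinfun_apply c (?d \<omega>)) h) \<in> borel_measurable M"
        unfolding k by measurable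
    qed
    have "integrable M (\<lambda>\<omega>. (\<Sum>c\<in>\<Phi> ` space M. indicator (?A c) \<omega> * inner (blinfun_apply c (?d \<omega>)) h)\<^sup>2)"
    proof (rule integrable_square_sum)
      show "finite (\<Phi> ` space M)" using \<Phi> unfolding space_F[OF st(1), symmetric] by (rule simple_functionD(1))
      fix c
      show "(\<lambda>\<omega>. indicator (?A c) \<omega> * inner (blinfun_apply c (?d \<omega>)) h) \<in> borel_measurable M"
        using cm(1) by measurable
      have eq: "(indicator (?A c) \<omega> * inner (blinfun_apply c (?d \<omega>)) h)\<^sup>2 = indicator (?A c) \<omega> *\<^sub>R (inner (blinfun_apply c (?d \<omega>)) h)\<^sup>2" for \<omega>
        by (auto simp: indicator_def)
      show "integrable M (\<lambda>\<omega>. (indicator (?A c) \<omega> * inner (blinfun_apply c (?d \<omega>)) h)\<^sup>2)"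
        unfolding eq using AM cm(2) by (rule integrable_mult_indicator)
    qed
    also have "?this \<longleftrightarrow> integrable M (\<lambda>\<omega>. (inner (blinfun_apply (\<Phi> \<omega>) (?d \<omega>)) h)\<^sup>2)"
      by (rule Bochner_Integration.integrable_cong[OF refl]) (simp add: inner_simple[OF \<Phi> st(1)])
    finally have "integrable M (\<lambda>\<omega>. (inner (blinfun_apply (\<Phi> \<omega>) (?d \<omega>)) h)\<^sup>2)" .
    moreover have "integrable M (\<lambda>\<omega>. (inner (X \<omega>) h)\<^sup>2)" using X by (simp add: wL2_def)
    ultimately show ?thesis unfolding Y_def inner_add_left
      using wmeasD[OF XM] wmeasD[OF wmeas_F[OF t \<Phi>d]] by (intro integrable_square_add)
  qed
  then show "wL2 (F t) Y" unfolding wL2_def using wmeas_add[OF Xt \<Phi>d] by (simp add: Y_def)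
  have Cm: "wmeas M (\<lambda>\<omega>. X \<omega> + blinfun_apply c (?d \<omega>))" for c :: "'d L2 \<Rightarrow>\<^sub>L 'd L2"
    using wmeas_add[OF XM wmeas_bounded_linear[OF blinfun.bounded_linear_right dM]] .
  define H where "H c = (\<Sum>j. ennreal ((norm (blinfun_apply c (R (e j))))\<^sup>2))" for c :: "'d L2 \<Rightarrow>\<^sub>L 'd L2"
  have "(\<integral>\<^sup>+\<omega>. ennreal ((norm (Y \<omega>))\<^sup>2) \<partial>M)
    = (\<Sum>c\<in>\<Phi> ` space M. \<integral>\<^sup>+\<omega>. indicator (?A c) \<omega> * ennreal ((norm (X \<omega> + blinfun_apply c (?d \<omega>)))\<^sup>2) \<partial>M)"
    unfolding Y_def by (intro nn_integral_simple_partition[OF \<Phi> sub, of "\<lambda>c \<omega>. ennreal ((norm (X \<omega> + blinfun_apply c (?d \<omega>)))\<^sup>2)"] wmeas_norm Cm)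
  also have "\<dots> = (\<Sum>c\<in>\<Phi> ` space M. (\<integral>\<^sup>+\<omega>. indicator (?A c) \<omega> * ennreal ((norm (X \<omega>))\<^sup>2) \<partial>M) + emeasure M (?A c) * (ennreal (t - s) * H c))"
    unfolding H_def by (intro sum.cong refl operator_step st X simple_sets \<Phi> blinfun.bounded_linear_right)
  also have "\<dots> = (\<Sum>c\<in>\<Phi> ` space M. \<integral>\<^sup>+\<omega>. indicator (?A c) \<omega> * ennreal ((norm (X \<omega>))\<^sup>2) \<partial>M)
      + (\<Sum>c\<in>\<Phi> ` space M. emeasure M (?A c) * (ennreal (t - s) * H c))"
    by (rule sum.distrib)
  also have "(\<Sum>c\<in>\<Phi> ` space M. \<integral>\<^sup>+\<omega>. indicator (?A c) \<omega> * ennreal ((norm (X \<omega>))\<^sup>2) \<partial>M) = (\<integral>\<^sup>+\<omega>. ennreal ((norm (X \<omega>))\<^sup>2) \<partial>M)"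
    using wmeas_norm[OF XM] by (intro nn_integral_simple_partition[OF \<Phi> sub, of "\<lambda>c \<omega>. ennreal ((norm (X \<omega>))\<^sup>2)", symmetric])
  also have "(\<Sum>c\<in>\<Phi> ` space M. emeasure M (?A c) * (ennreal (t - s) * H c)) = ennreal (t - s) * (\<Sum>c\<in>\<Phi> ` space M. emeasure M (?A c) * H c)"
    by (simp add: sum_distrib_left mult_ac)
  also have "(\<Sum>c\<in>\<Phi> ` space M. emeasure M (?A c) * H c) = (\<Sum>c\<in>\<Phi> ` space M. \<integral>\<^sup>+\<omega>. indicator (?A c) \<omega> * H c \<partial>M)"
    by (intro sum.cong refl) (simp add: nn_integral_multc)
  also have "\<dots> = (\<integral>\<^sup>+\<omega>. H (\<Phi> \<omega>) \<partial>M)"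
    by (intro nn_integral_simple_partition[OF \<Phi> sub, of "\<lambda>c \<omega>. H c", symmetric]) simp
  finally show "(\<integral>\<^sup>+\<omega>. ennreal ((norm (Y \<omega>))\<^sup>2) \<partial>M) = (\<integral>\<^sup>+\<omega>. ennreal ((norm (X \<omega>))\<^sup>2) \<partial>M)
      + ennreal (t - s) * (\<integral>\<^sup>+\<omega>. (\<Sum>j. ennreal ((norm (blinfun_apply (\<Phi> \<omega>) (R (e j))))\<^sup>2)) \<partial>M)"
    by (simp add: H_def)
qed

end

section \<open>The Ito isometry\<close>

text \<open>A strict upper bound forces \<open>c\<close> to be finite, and the perturbed value is
  then continuous at zero. This provides the room for a small relative and a small absolute
  error.\<close>

lemma ennreal_slack:
  fixes c b :: ennreal
  assumes "c < b"
  obtains \<epsilon> :: real where "\<epsilon> > 0" "ennreal (1 + \<epsilon>) * c + ennreal \<epsilon> < b"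
proof -
  have "c < top" using assms by (simp add: less_top[symmetric]) auto
  then obtain r where r: "c = ennreal r" "0 \<le> r" by (cases c rule: ennreal_cases) auto
  have "((\<lambda>\<epsilon>. ennreal ((1 + \<epsilon>) * r + \<epsilon>)) \<longlongrightarrow> ennreal ((1 + 0) * r + 0)) (at_right 0)"
    by (intro tendsto_intros tendsto_ennrealI)
  then have "eventually (\<lambda>\<epsilon>. ennreal ((1 + \<epsilon>) * r + \<epsilon>) < b) (at_right 0)"
    using assms r by (intro order_tendstoD) auto
  then obtain \<delta> where \<delta>: "\<delta> > 0" "\<And>\<epsilon>. 0 < \<epsilon> \<Longrightarrow> \<epsilon> < \<delta> \<Longrightarrow> ennreal ((1 + \<epsilon>) * r + \<epsilon>) < b"
    by (auto simp: eventually_at_right_field)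
  have "ennreal (1 + \<delta> / 2) * c + ennreal (\<delta> / 2) = ennreal ((1 + \<delta> / 2) * r + \<delta> / 2)"
    using \<delta>(1) r by (simp add: ennreal_mult ennreal_plus)
  then show ?thesis using that[of "\<delta> / 2"] \<delta> by simp
qed

text \<open>Convergence in mean square implies convergence of second moments, infinite values included. The
  hypotheses are those supplied by \<open>(a + b)\<^sup>2 \<le> (1 + \<epsilon>) a\<^sup>2 + (1 + 1/\<epsilon>) b\<^sup>2\<close>.\<close>

lemma tendsto_of_relative_error:
  fixes x d :: "nat \<Rightarrow> ennreal" and y :: ennreal
  assumes d: "d \<longlonglongrightarrow> 0" and K: "0 \<le> K"
    and le: "\<And>m \<epsilon>. 0 < \<epsilon> \<Longrightarrow> x m \<le> ennreal (1 + \<epsilon>) * y + ennreal ((1 + 1 / \<epsilon>) * K) * d m"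
    and ge: "\<And>m \<epsilon>. 0 < \<epsilon> \<Longrightarrow> y \<le> ennreal (1 + \<epsilon>) * x m + ennreal ((1 + 1 / \<epsilon>) * K) * d m"
  shows "x \<longlonglongrightarrow> y"
proof -
  have small: "eventually (\<lambda>m. ennreal ((1 + 1 / \<epsilon>) * K) * d m < ennreal \<epsilon>) sequentially" if "\<epsilon> > 0" for \<epsilon>
  proof -
    have "(\<lambda>m. ennreal ((1 + 1 / \<epsilon>) * K) * d m) \<longlonglongrightarrow> ennreal ((1 + 1 / \<epsilon>) * K) * 0"
      using d by (intro ennreal_tendsto_cmult) auto
    then show ?thesis using that by (intro order_tendstoD) auto
  qed
  show ?thesis
  proof (rule order_tendstoI)
    fix a assume "y < a"
    then obtain \<epsilon> where \<epsilon>: "\<epsilon> > 0" "ennreal (1 + \<epsilon>) * y + ennreal \<epsilon> < a" by (rule ennreal_slack)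
    show "eventually (\<lambda>m. x m < a) sequentially" using small[OF \<epsilon>(1)]
    proof eventually_elim
      case (elim m)
      have "x m \<le> ennreal (1 + \<epsilon>) * y + ennreal ((1 + 1 / \<epsilon>) * K) * d m" by (rule le[OF \<epsilon>(1)])
      also have "\<dots> \<le> ennreal (1 + \<epsilon>) * y + ennreal \<epsilon>" using elim by (intro add_left_mono) simp
      finally show ?case using \<epsilon>(2) by simp
    qed
  next
    fix a assume "a < y"
    then obtain \<epsilon> where \<epsilon>: "\<epsilon> > 0" "ennreal (1 + \<epsilon>) * a + ennreal \<epsilon> < y" by (rule ennreal_slack)
    show "eventually (\<lambda>m. a < x m) sequentially" using small[OF \<epsilon>(1)]
    proof eventually_elim
      case (elim m)
      show ?case
      \<comment> \<open>Arguing by contradiction avoids solving for \<open>x m\<close>, which would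
        involve truncated subtraction.\<close>
      proof (rule ccontr)
        assume "\<not> a < x m"
        then have "x m \<le> a" by simp
        have "y \<le> ennreal (1 + \<epsilon>) * x m + ennreal ((1 + 1 / \<epsilon>) * K) * d m" by (rule ge[OF \<epsilon>(1)])
        also have "\<dots> \<le> ennreal (1 + \<epsilon>) * a + ennreal \<epsilon>"
          using elim \<open>x m \<le> a\<close> by (intro add_mono mult_left_mono) auto
        finally show False using \<epsilon>(2) by simp
      qed
    qed
  qed
qed

text \<open>Young's inequality \<open>2 * p * q \<le> \<epsilon> * p^2 + q^2 / \<epsilon>\<close>
  for the mixed term of the squared triangle inequality. Only sums occur on the right, so the
  estimate survives integration to infinite values.\<close>

lemma norm_square_relative_error:
  fixes a b :: "'a::real_normed_vector"
  assumes \<epsilon>: "0 < \<epsilon>" and d: "(norm (a - b))\<^sup>2 \<le> K * D"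
  shows "(norm a)\<^sup>2 \<le> (1 + \<epsilon>) * (norm b)\<^sup>2 + (1 + 1 / \<epsilon>) * K * D"
proof -
  have "norm a \<le> norm b + norm (a - b)" using norm_triangle_sub by (metis add.commute)
  then have "(norm a)\<^sup>2 \<le> (norm b + norm (a - b))\<^sup>2" by (intro power_mono) auto
  moreover have "2 * norm b * norm (a - b) \<le> \<epsilon> * (norm b)\<^sup>2 + (1 / \<epsilon>) * (norm (a - b))\<^sup>2"
  proof -
    have "0 \<le> (1 / \<epsilon>) * (\<epsilon> * norm b - norm (a - b))\<^sup>2" using \<epsilon> by simp
    also have "\<dots> = \<epsilon> * (norm b)\<^sup>2 + (1 / \<epsilon>) * (norm (a - b))\<^sup>2 - 2 * norm b * norm (a - b)"
      using \<epsilon> by (simp add: power2_eq_square field_simps)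
    finally show ?thesis by simp
  qed
  ultimately have "(norm a)\<^sup>2 \<le> (1 + \<epsilon>) * (norm b)\<^sup>2 + (1 + 1 / \<epsilon>) * (norm (a - b))\<^sup>2"
    by (simp add: power2_sum algebra_simps)
  also have "\<dots> \<le> (1 + \<epsilon>) * (norm b)\<^sup>2 + (1 + 1 / \<epsilon>) * (K * D)"
    using \<epsilon> d by (intro add_left_mono mult_left_mono) auto
  finally show ?thesis by (simp add: mult.assoc)
qed

lemma ennreal_norm_square_relative_error:
  fixes a b c :: "'a::real_normed_vector"
  assumes \<epsilon>: "0 < \<epsilon>" and K: "0 \<le> K" and d: "(norm (a - b))\<^sup>2 \<le> K * (norm c)\<^sup>2"
  shows "ennreal ((norm a)\<^sup>2) \<le> ennreal (1 + \<epsilon>) * ennreal ((norm b)\<^sup>2) + ennreal ((1 + 1 / \<epsilon>) * K) * ennreal ((norm c)\<^sup>2)"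
proof -
  have "ennreal ((norm a)\<^sup>2) \<le> ennreal ((1 + \<epsilon>) * (norm b)\<^sup>2 + (1 + 1 / \<epsilon>) * K * (norm c)\<^sup>2)"
    using norm_square_relative_error[OF \<epsilon> d] by (rule ennreal_leI)
  also have "\<dots> = ennreal (1 + \<epsilon>) * ennreal ((norm b)\<^sup>2) + ennreal ((1 + 1 / \<epsilon>) * K) * ennreal ((norm c)\<^sup>2)"
    using \<epsilon> K by (simp add: ennreal_plus ennreal_mult)
  finally show ?thesis .
qed

lemma nn_integral_linear_bound:
  assumes "\<And>x. x \<in> space M \<Longrightarrow> f x \<le> a * g x + b * h x" "g \<in> borel_measurable M" "h \<in> borel_measurable M"
  shows "(\<integral>\<^sup>+x. f x \<partial>M) \<le> a * (\<integral>\<^sup>+x. g x \<partial>M) + b * (\<integral>\<^sup>+x. h x \<partial>M)"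
proof -
  have "(\<integral>\<^sup>+x. f x \<partial>M) \<le> (\<integral>\<^sup>+x. a * g x + b * h x \<partial>M)" using assms(1) by (rule nn_integral_mono)
  also have "\<dots> = a * (\<integral>\<^sup>+x. g x \<partial>M) + b * (\<integral>\<^sup>+x. h x \<partial>M)"
    using assms(2,3) by (simp add: nn_integral_add nn_integral_cmult)
  finally show ?thesis .
qed

text \<open>Bundles the random operators of an elementary process into a single simple function. The
  default 0 from \<open>n\<close> on makes the tuple depend on the first \<open>n\<close> entries
  only, so its range is finite.\<close>

lemma simple_function_tuple:
  fixes \<Phi> :: "nat \<Rightarrow> 'a \<Rightarrow> 'b::zero"
  assumes "\<And>k. k < n \<Longrightarrow> simple_function M (\<Phi> k)"
  shows "simple_function M (\<lambda>\<omega> k. if k < n then \<Phi> k \<omega> else 0)"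
  using assms
proof (induction n)
  case 0
  then show ?case by simp
next
  case (Suc n)
  have eq: "(\<lambda>\<omega> k. if k < Suc n then \<Phi> k \<omega> else 0) = (\<lambda>\<omega>. (\<lambda>k. if k < n then \<Phi> k \<omega> else 0)(n := \<Phi> n \<omega>))"
    by (auto simp: fun_eq_iff)
  show ?case unfolding eq
    using Suc by (intro simple_function_compose2[where h = "\<lambda>p c. p(n := c)"]) auto
qed

lemma elementary_process_tuple:
  "elementary_process n \<tau> \<Phi> r \<omega> u = elementary_process n \<tau> (\<lambda>k p. p k) r (\<lambda>k. if k < n then \<Phi> k \<omega> else 0) u"
  unfolding elementary_process_def by (intro sum.cong) auto

section \<open>Elementary integrands and their integrals\<close>

context wiener_setup
begin

context
  fixes t :: real and n :: nat and \<tau> :: "nat \<Rightarrow> real" and \<Phi> :: "nat \<Rightarrow> 'a \<Rightarrow> 'd L2 \<Rightarrow>\<^sub>L 'd L2"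
  assumes el: "elementary F t n \<tau> \<Phi>"
begin

lemma partition_0: "\<tau> 0 = 0" and partition_n: "\<tau> n = t" and partition_Suc: "k < n \<Longrightarrow> \<tau> k < \<tau> (Suc k)"
  using el unfolding elementary_def by blast+

lemma partition_mono: "i \<le> j \<Longrightarrow> j \<le> n \<Longrightarrow> \<tau> i \<le> \<tau> j"
proof (induction j)
  case (Suc j)
  then have "\<tau> j < \<tau> (Suc j)" by (intro partition_Suc) simp
  then show ?case using Suc by (cases "i = Suc j") auto
qed simp

lemma partition_nonneg: "k \<le> n \<Longrightarrow> 0 \<le> \<tau> k"
  using partition_mono[of 0 k] partition_0 by simp

lemma partition_le: "k \<le> n \<Longrightarrow> \<tau> k \<le> t"
  using partition_mono[of k n] partition_n by simp

lemma integrand_simple: "k < n \<Longrightarrow> simple_function (F (\<tau> k)) (\<Phi> k)"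
  using el unfolding elementary_def by blast

lemma integrand_simple_M:
  assumes "k < n" shows "simple_function M (\<Phi> k)"
proof -
  have sub: "subalgebra M (F (\<tau> k))" using assms by (intro subalgebra_F partition_nonneg) simp
  then have sp: "space (F (\<tau> k)) = space M" and sets: "sets (F (\<tau> k)) \<subseteq> sets M"
    by (simp_all add: subalgebra_def)
  show ?thesis using integrand_simple[OF assms] sets
    unfolding simple_function_def sp by (meson subsetD)
qed

text \<open>\<open>V\<close> serves as the partial sum before any increment, so its orthogonality to
  the noise is handled by the same step as that of the earlier increments.\<close>

lemma elementary_partial_sums:
  assumes V: "wL2 (F 0) V" and "k \<le> n"
  defines "X \<equiv> \<lambda>k \<omega>. V \<omega> + (\<Sum>l<k. blinfun_apply (\<Phi> l \<omega>) (W (\<tau> (Suc l)) \<omega> - W (\<tau> l) \<omega>))"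
  shows "wL2 (F (\<tau> k)) (X k) \<and> (\<integral>\<^sup>+\<omega>. ennreal ((norm (X k \<omega>))\<^sup>2) \<partial>M) = (\<integral>\<^sup>+\<omega>. ennreal ((norm (V \<omega>))\<^sup>2) \<partial>M)
    + (\<Sum>l<k. ennreal (\<tau> (Suc l) - \<tau> l) * (\<integral>\<^sup>+\<omega>. (\<Sum>j. ennreal ((norm (blinfun_apply (\<Phi> l \<omega>) (R (e j))))\<^sup>2)) \<partial>M))"
  using \<open>k \<le> n\<close>
proof (induction k)
  case 0
  have "X 0 = V" by (simp only: X_def lessThan_0 sum.empty add_0_right)
  then show ?case using V by (simp only: partition_0 lessThan_0 sum.empty add_0_right)
next
  case (Suc k)
  have st: "0 \<le> \<tau> k" "\<tau> k \<le> \<tau> (Suc k)" using Suc.prems by (auto intro: partition_nonneg partition_mono)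
  have eq: "X (Suc k) = (\<lambda>\<omega>. X k \<omega> + blinfun_apply (\<Phi> k \<omega>) (W (\<tau> (Suc k)) \<omega> - W (\<tau> k) \<omega>))"
    by (simp only: X_def sum.lessThan_Suc add.assoc)
  have IH: "wL2 (F (\<tau> k)) (X k)" using Suc.IH Suc.prems by (meson Suc_leD)
  have "simple_function (F (\<tau> k)) (\<Phi> k)" using Suc.prems by (intro integrand_simple) simp
  note step = simple_step[OF st IH this, folded eq[THEN fun_cong]]
  show ?case
    using step Suc.IH Suc.prems unfolding eq by (simp only: Suc_leD sum.lessThan_Suc add.assoc)
qed

lemma elementary_isometry:
  assumes V: "wL2 (F 0) V"
  shows "wmeas M (\<lambda>\<omega>. V \<omega> + elementary_integral W n \<tau> \<Phi> \<omega>)"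
    "(\<integral>\<^sup>+\<omega>. ennreal ((norm (V \<omega> + elementary_integral W n \<tau> \<Phi> \<omega>))\<^sup>2) \<partial>M) = (\<integral>\<^sup>+\<omega>. ennreal ((norm (V \<omega>))\<^sup>2) \<partial>M)
    + (\<Sum>l<n. ennreal (\<tau> (Suc l) - \<tau> l) * (\<integral>\<^sup>+\<omega>. (\<Sum>j. ennreal ((norm (blinfun_apply (\<Phi> l \<omega>) (R (e j))))\<^sup>2)) \<partial>M))"
  using elementary_partial_sums[OF V order_refl] wmeas_F[OF partition_nonneg[OF order_refl]]
  by (auto simp: elementary_integral_def wL2_def)

lemma elementary_process_cases:
  assumes "k < n" "\<tau> k < r" "r \<le> \<tau> (Suc k)"
  shows "elementary_process n \<tau> \<Phi> r \<omega> u = blinfun_apply (\<Phi> k \<omega>) u"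
proof -
  have "indicator {\<tau> l<..\<tau> (Suc l)} r = (if l = k then 1 else 0 :: real)" if "l < n" for l
  proof (cases l k rule: linorder_cases)
    case less
    then have "\<tau> (Suc l) \<le> \<tau> k" using assms by (intro partition_mono) auto
    then show ?thesis using less assms by auto
  next
    case greater
    then have "\<tau> (Suc k) \<le> \<tau> l" using that by (intro partition_mono) auto
    then show ?thesis using greater assms by auto
  qed (use assms in auto)
  then have "elementary_process n \<tau> \<Phi> r \<omega> u = (\<Sum>l<n. if l = k then blinfun_apply (\<Phi> k \<omega>) u else 0)"
    unfolding elementary_process_def by (intro sum.cong) auto
  then show ?thesis using assms(1) by simp
qed

lemma elementary_process_outside:
  "(\<And>k. k < n \<Longrightarrow> r \<notin> {\<tau> k<..\<tau> (Suc k)}) \<Longrightarrow> elementary_process n \<tau> \<Phi> r \<omega> u = 0"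
  unfolding elementary_process_def by (intro sum.neutral) auto

text \<open>At most one interval of the partition contains \<open>r\<close>, so squaring produces no
  mixed terms. At \<open>r = 0\<close> both sides vanish, the intervals being open on the
  left.\<close>

lemma elementary_process_HS:
  assumes r: "0 \<le> r" "r \<le> t"
  shows "(\<Sum>j. ennreal ((norm (elementary_process n \<tau> \<Phi> r \<omega> (R (e j))))\<^sup>2))
    = (\<Sum>l<n. indicator {\<tau> l<..\<tau> (Suc l)} r * (\<Sum>j. ennreal ((norm (blinfun_apply (\<Phi> l \<omega>) (R (e j))))\<^sup>2)))"
proof (cases "\<exists>k<n. r \<in> {\<tau> k<..\<tau> (Suc k)}")
  case False
  then have 0: "indicator {\<tau> l<..\<tau> (Suc l)} r = (0::ennreal)" if "l < n" for l using that by auto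
  have "elementary_process n \<tau> \<Phi> r \<omega> u = 0" for u using False by (intro elementary_process_outside) auto
  then have "(\<Sum>j. ennreal ((norm (elementary_process n \<tau> \<Phi> r \<omega> (R (e j))))\<^sup>2)) = 0" by simp
  also have "\<dots> = (\<Sum>l<n. indicator {\<tau> l<..\<tau> (Suc l)} r * (\<Sum>j. ennreal ((norm (blinfun_apply (\<Phi> l \<omega>) (R (e j))))\<^sup>2)))"
    by (intro sum.neutral[symmetric] ballI) (simp only: 0 lessThan_iff mult_zero_left)
  finally show ?thesis .
next
  case True
  then obtain k where k: "k < n" "\<tau> k < r" "r \<le> \<tau> (Suc k)" by auto
  have "indicator {\<tau> l<..\<tau> (Suc l)} r = (if l = k then 1 else 0 :: ennreal)" if "l < n" for l
  proof (cases l k rule: linorder_cases)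
    case less
    then have "\<tau> (Suc l) \<le> \<tau> k" using k by (intro partition_mono) auto
    then show ?thesis using less k by auto
  next
    case greater
    then have "\<tau> (Suc k) \<le> \<tau> l" using that by (intro partition_mono) auto
    then show ?thesis using greater k by auto
  qed (use k in auto)
  then have "(\<Sum>l<n. indicator {\<tau> l<..\<tau> (Suc l)} r * (\<Sum>j. ennreal ((norm (blinfun_apply (\<Phi> l \<omega>) (R (e j))))\<^sup>2)))
     = (\<Sum>l<n. if l = k then \<Sum>j. ennreal ((norm (blinfun_apply (\<Phi> k \<omega>) (R (e j))))\<^sup>2) else 0)"
    by (intro sum.cong) auto
  then show ?thesis using k(1) by (simp add: elementary_process_cases[OF k])
qed

lemma elementary_HS_integral:
  "(\<integral>\<^sup>+\<omega>. (\<integral>\<^sup>+r\<in>{0..t}. (\<Sum>j. ennreal ((norm (elementary_process n \<tau> \<Phi> r \<omega> (R (e j))))\<^sup>2)) \<partial>lborel) \<partial>M)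
    = (\<Sum>l<n. ennreal (\<tau> (Suc l) - \<tau> l) * (\<integral>\<^sup>+\<omega>. (\<Sum>j. ennreal ((norm (blinfun_apply (\<Phi> l \<omega>) (R (e j))))\<^sup>2)) \<partial>M))"
proof -
  define H where "H l \<omega> = (\<Sum>j. ennreal ((norm (blinfun_apply (\<Phi> l \<omega>) (R (e j))))\<^sup>2))" for l \<omega>
  have Hm: "H l \<in> borel_measurable M" if "l < n" for l
    using simple_function_compose1[OF integrand_simple_M[OF that], of "\<lambda>c. \<Sum>j. ennreal ((norm (blinfun_apply c (R (e j))))\<^sup>2)"]
    unfolding H_def[abs_def] by (rule borel_measurable_simple_function)
  have "(\<integral>\<^sup>+r\<in>{0..t}. (\<Sum>j. ennreal ((norm (elementary_process n \<tau> \<Phi> r \<omega> (R (e j))))\<^sup>2)) \<partial>lborel)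
    = (\<Sum>l<n. ennreal (\<tau> (Suc l) - \<tau> l) * H l \<omega>)" for \<omega>
  proof -
    have "(\<integral>\<^sup>+r\<in>{0..t}. (\<Sum>j. ennreal ((norm (elementary_process n \<tau> \<Phi> r \<omega> (R (e j))))\<^sup>2)) \<partial>lborel)
      = (\<integral>\<^sup>+r. (\<Sum>l<n. indicator {\<tau> l<..\<tau> (Suc l)} r * H l \<omega>) \<partial>lborel)"
    proof (rule nn_integral_cong)
      fix r
      show "(\<Sum>j. ennreal ((norm (elementary_process n \<tau> \<Phi> r \<omega> (R (e j))))\<^sup>2)) * indicator {0..t} r
         = (\<Sum>l<n. indicator {\<tau> l<..\<tau> (Suc l)} r * H l \<omega>)"
      proof (cases "r \<in> {0..t}")
        case True
        then have "indicator {0..t} r = (1::ennreal)" "0 \<le> r" "r \<le> t" by auto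
        then show ?thesis using elementary_process_HS[of r \<omega>] unfolding H_def by (simp only: mult_1_right)
      next
        case False
        have "indicator {\<tau> l<..\<tau> (Suc l)} r = (0 :: ennreal)" if "l < n" for l
          using partition_nonneg[of l] partition_le[of "Suc l"] that False by (auto simp: indicator_def)
        then have "(\<Sum>l<n. indicator {\<tau> l<..\<tau> (Suc l)} r * H l \<omega>) = 0"
          by (intro sum.neutral ballI) (simp only: lessThan_iff mult_zero_left)
        moreover have "indicator {0..t} r = (0::ennreal)" using False by simp
        ultimately show ?thesis by (simp only: mult_zero_right)
      qed
    qed
    also have "\<dots> = (\<Sum>l<n. \<integral>\<^sup>+r. indicator {\<tau> l<..\<tau> (Suc l)} r * H l \<omega> \<partial>lborel)"
      by (intro nn_integral_sum) simp
    also have "\<dots> = (\<Sum>l<n. ennreal (\<tau> (Suc l) - \<tau> l) * H l \<omega>)"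
      using partition_mono by (intro sum.cong refl) (simp add: nn_integral_multc)
    finally show ?thesis .
  qed
  then have "(\<integral>\<^sup>+\<omega>. (\<integral>\<^sup>+r\<in>{0..t}. (\<Sum>j. ennreal ((norm (elementary_process n \<tau> \<Phi> r \<omega> (R (e j))))\<^sup>2)) \<partial>lborel) \<partial>M)
    = (\<integral>\<^sup>+\<omega>. (\<Sum>l<n. ennreal (\<tau> (Suc l) - \<tau> l) * H l \<omega>) \<partial>M)" by simp
  also have "\<dots> = (\<Sum>l<n. \<integral>\<^sup>+\<omega>. ennreal (\<tau> (Suc l) - \<tau> l) * H l \<omega> \<partial>M)"
    using Hm by (intro nn_integral_sum) auto
  also have "\<dots> = (\<Sum>l<n. ennreal (\<tau> (Suc l) - \<tau> l) * (\<integral>\<^sup>+\<omega>. H l \<omega> \<partial>M))"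
    using Hm by (intro sum.cong refl nn_integral_cmult) auto
  finally show ?thesis unfolding H_def .
qed

text \<open>Composition with a bounded operator stays within the elementary processes, so the
  isometry for \<open>B\<close> applied to the integral is an instance of the one already
  proved.\<close>

lemma elementary_compose:
  fixes B :: "'d L2 \<Rightarrow>\<^sub>L 'd L2"
  shows "elementary F t n \<tau> (\<lambda>k \<omega>. B o\<^sub>L \<Phi> k \<omega>)"
  using el simple_function_compose1[of _ _ "\<lambda>c. B o\<^sub>L c"] by (auto simp: elementary_def)

lemma elementary_integral_compose:
  "elementary_integral W n \<tau> (\<lambda>k \<omega>. B o\<^sub>L \<Phi> k \<omega>) \<omega> = blinfun_apply B (elementary_integral W n \<tau> \<Phi> \<omega>)"
  by (simp add: elementary_integral_def blinfun.sum_right)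

lemma elementary_process_compose:
  "elementary_process n \<tau> (\<lambda>k \<omega>. B o\<^sub>L \<Phi> k \<omega>) r \<omega> u = blinfun_apply B (elementary_process n \<tau> \<Phi> r \<omega> u)"
  by (simp add: elementary_process_def blinfun.sum_right blinfun.scaleR_right)

text \<open>The whole path of the process is a function of one simple function, and any function of
  a simple function is simple; hence \<open>G\<close> may be arbitrary, in particular a time
  integral of a series.\<close>

lemma measurable_process_function:
  "(\<lambda>\<omega>. G (\<lambda>r u. elementary_process n \<tau> \<Phi> r \<omega> u)) \<in> borel_measurable M"
proof -
  have "simple_function M (\<lambda>\<omega>. (\<lambda>p. G (\<lambda>r u. elementary_process n \<tau> (\<lambda>k p. p k) r p u)) (\<lambda>k. if k < n then \<Phi> k \<omega> else 0))"
    by (rule simple_function_compose1[OF simple_function_tuple[OF integrand_simple_M]])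
  then show ?thesis unfolding elementary_process_tuple[of n \<tau> \<Phi>] by (rule borel_measurable_simple_function)
qed

end

lemma wL2_zero: "wL2 N (\<lambda>\<omega>. 0)"
  by (simp add: wL2_def wmeas_def)

lemma wmeas_elementary_integral:
  assumes "elementary F t n \<tau> \<Phi>" shows "wmeas M (elementary_integral W n \<tau> \<Phi>)"
  using elementary_isometry(1)[OF assms wL2_zero] by simp

lemma wmeas_elementary_process:
  fixes \<Phi> :: "nat \<Rightarrow> 'c \<Rightarrow> 'd L2 \<Rightarrow>\<^sub>L 'd L2"
  shows "wmeas borel (\<lambda>r. elementary_process n \<tau> \<Phi> r \<omega> v)"
  unfolding wmeas_def elementary_process_def inner_sum_left inner_scaleR_left
  by (intro allI borel_measurable_sum borel_measurable_times) auto

text \<open>Both sides of the elementary isometry pass to the limit, the left by mean square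
  convergence to \<open>I\<close>, the right by convergence of the integrands; boundedness of
  \<open>B\<close> costs only a factor. In the limit the integrand at time \<open>r\<close> has a
  Hilbert-Schmidt norm independent of \<open>r\<close>, which produces the factor \<open>t\<close>.
  The case of an infinite norm is included.\<close>

lemma stochastic_integral_isometry:
  assumes S: "schroedinger_group S" and t: "0 \<le> t"
    and I: "is_stochastic_integral M F R e W t (\<lambda>r \<omega>. S (t - r)) I"
    and V: "wL2 (F 0) V" and B: "bounded_linear B" and comm: "\<And>s v. B (S s v) = S s (B v)"
  shows "(\<integral>\<^sup>+\<omega>. ennreal ((norm (V \<omega> + B (I \<omega>)))\<^sup>2) \<partial>M)
    = (\<integral>\<^sup>+\<omega>. ennreal ((norm (V \<omega>))\<^sup>2) \<partial>M) + ennreal t * (\<Sum>j. ennreal ((norm (B (R (e j))))\<^sup>2))"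
proof -
  interpret S: schroedinger S by standard (rule S)
  obtain n \<tau> \<Psi> where el: "\<And>m. elementary F t (n m) (\<tau> m) (\<Psi> m)"
    and int: "(\<lambda>m. integrand_dist_sq M R e t (elementary_process (n m) (\<tau> m) (\<Psi> m)) (\<lambda>r \<omega>. S (t - r))) \<longlonglongrightarrow> 0"
    and lim: "(\<lambda>m. \<integral>\<^sup>+\<omega>. ennreal ((norm (elementary_integral W (n m) (\<tau> m) (\<Psi> m) \<omega> - I \<omega>))\<^sup>2) \<partial>M) \<longlonglongrightarrow> 0"
    and Im: "I \<in> borel_measurable M"
    using I unfolding is_stochastic_integral_def by blast
  define E where "E m = elementary_integral W (n m) (\<tau> m) (\<Psi> m)" for m
  define P where "P m = elementary_process (n m) (\<tau> m) (\<Psi> m)" for m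
  define H where "H = (\<Sum>j. ennreal ((norm (B (R (e j))))\<^sup>2))"
  define x where "x m = (\<integral>\<^sup>+\<omega>. ennreal ((norm (V \<omega> + B (E m \<omega>)))\<^sup>2) \<partial>M)" for m
  define a where "a m = (\<integral>\<^sup>+\<omega>. (\<integral>\<^sup>+r\<in>{0..t}. (\<Sum>j. ennreal ((norm (B (P m r \<omega> (R (e j)))))\<^sup>2)) \<partial>lborel) \<partial>M)" for m
  interpret B: bounded_linear B by (rule B)
  obtain k where k: "0 \<le> k" "\<And>v. norm (B v) \<le> norm v * k" using B.nonneg_bounded by blast
  define K where "K = k\<^sup>2"
  have K: "0 \<le> K" "\<And>v. (norm (B v))\<^sup>2 \<le> K * (norm v)\<^sup>2"
    using power_mono[OF k(2) norm_ge_zero, where n = 2] by (auto simp: K_def power_mult_distrib mult.commute)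
  have "blinfun_apply (Blinfun B) = B" by (rule bounded_linear_Blinfun_apply[OF B])
  note compose = elementary_process_compose[OF el, where B = "Blinfun B", unfolded this]
    elementary_integral_compose[OF el, where B = "Blinfun B", unfolded this]
  have xa: "x m = (\<integral>\<^sup>+\<omega>. ennreal ((norm (V \<omega>))\<^sup>2) \<partial>M) + a m" for m
    using elementary_isometry(2)[OF elementary_compose[OF el[of m], where B = "Blinfun B"] V]
      elementary_HS_integral[OF elementary_compose[OF el[of m], where B = "Blinfun B"]]
    by (simp only: x_def a_def P_def E_def compose)
  have wV: "wmeas M V" by (rule wmeas_F[OF order_refl]) (use V in \<open>simp add: wL2_def\<close>)
  have wI: "wmeas M I" using Im by (rule wmeas_borel)
  have wE: "wmeas M (E m)" for m unfolding E_def by (rule wmeas_elementary_integral[OF el])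
  have "x \<longlonglongrightarrow> (\<integral>\<^sup>+\<omega>. ennreal ((norm (V \<omega> + B (I \<omega>)))\<^sup>2) \<partial>M)"
  proof (rule tendsto_of_relative_error[OF lim K(1)])
    fix m and \<epsilon> :: real assume \<epsilon>: "0 < \<epsilon>"
    have eq: "V \<omega> + B (E m \<omega>) - (V \<omega> + B (I \<omega>)) = B (E m \<omega> - I \<omega>)"
      "norm (V \<omega> + B (I \<omega>) - (V \<omega> + B (E m \<omega>))) = norm (B (E m \<omega> - I \<omega>))" for \<omega>
      by (simp_all add: B.diff norm_minus_commute)
    show "x m \<le> ennreal (1 + \<epsilon>) * (\<integral>\<^sup>+\<omega>. ennreal ((norm (V \<omega> + B (I \<omega>)))\<^sup>2) \<partial>M)
      + ennreal ((1 + 1 / \<epsilon>) * K) * (\<integral>\<^sup>+\<omega>. ennreal ((norm (elementary_integral W (n m) (\<tau> m) (\<Psi> m) \<omega> - I \<omega>))\<^sup>2) \<partial>M)"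
      unfolding x_def E_def[symmetric]
      by (intro nn_integral_linear_bound ennreal_norm_square_relative_error \<epsilon> K(1) wmeas_norm wmeas_add wmeas_diff
          wmeas_bounded_linear[OF B] wV wI wE) (simp only: eq K(2))
    show "(\<integral>\<^sup>+\<omega>. ennreal ((norm (V \<omega> + B (I \<omega>)))\<^sup>2) \<partial>M) \<le> ennreal (1 + \<epsilon>) * x m
      + ennreal ((1 + 1 / \<epsilon>) * K) * (\<integral>\<^sup>+\<omega>. ennreal ((norm (elementary_integral W (n m) (\<tau> m) (\<Psi> m) \<omega> - I \<omega>))\<^sup>2) \<partial>M)"
      unfolding x_def E_def[symmetric]
      by (intro nn_integral_linear_bound ennreal_norm_square_relative_error \<epsilon> K(1) wmeas_norm wmeas_add wmeas_diff
          wmeas_bounded_linear[OF B] wV wI wE) (simp only: eq K(2))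
  qed
  moreover have "a \<longlonglongrightarrow> ennreal t * H"
  proof (rule tendsto_of_relative_error[OF int K(1)])
    fix m and \<epsilon> :: real assume \<epsilon>: "0 < \<epsilon>"
    define p where "p \<omega> r = (\<Sum>j. ennreal ((norm (B (P m r \<omega> (R (e j)))))\<^sup>2))" for \<omega> r
    define q where "q \<omega> r = (\<Sum>j. ennreal ((norm (P m r \<omega> (R (e j)) - S (t - r) (R (e j))))\<^sup>2))" for \<omega> r
    let ?c = "ennreal (1 + \<epsilon>)" and ?d = "ennreal ((1 + 1 / \<epsilon>) * K)"
    have wP: "wmeas borel (\<lambda>r. P m r \<omega> v)" for \<omega> v
      unfolding P_def by (rule wmeas_elementary_process)
    have wS: "wmeas borel (\<lambda>r. S (t - r) v)" for v
    proof (rule wmeas_borel[OF borel_measurable_continuous_onI])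
      show "continuous_on UNIV (\<lambda>r. S (t - r) v)"
        by (rule continuous_on_compose2[OF S.continuous_S[of v], of UNIV "\<lambda>r. t - r"]) (auto intro!: continuous_intros)
    qed
    have pm: "p \<omega> \<in> borel_measurable borel" for \<omega>
      unfolding p_def by (intro borel_measurable_suminf_order wmeas_norm wmeas_bounded_linear[OF B] wP)
    have qm: "q \<omega> \<in> borel_measurable borel" for \<omega>
      unfolding q_def by (intro borel_measurable_suminf_order wmeas_norm wmeas_diff wP wS)
    have BS: "norm (B (S s v)) = norm (B v)" for s v by (simp add: comm)
    \<comment> \<open>Commutation and the isometry of the group make the limit integrand constant in
      size.\<close>
    have Hr: "H = (\<Sum>j. ennreal ((norm (B (S (t - r) (R (e j)))))\<^sup>2))" for r by (simp only: H_def BS)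
    have comb: "(\<Sum>j. ?c * f j + ?d * g j) = ?c * (\<Sum>j. f j) + ?d * (\<Sum>j. g j)" for f g :: "nat \<Rightarrow> ennreal"
      by (simp add: suminf_add[symmetric])
    have K': "(norm (B v - B w))\<^sup>2 \<le> K * (norm (v - w))\<^sup>2" "(norm (B w - B v))\<^sup>2 \<le> K * (norm (v - w))\<^sup>2" for v w
      using K(2)[of "v - w"] by (simp_all add: B.diff norm_minus_commute)
    have pq: "p \<omega> r \<le> ?c * H + ?d * q \<omega> r" "H \<le> ?c * p \<omega> r + ?d * q \<omega> r" for \<omega> r
      unfolding p_def q_def Hr[of r] comb[symmetric]
      by (intro suminf_le summableI ennreal_norm_square_relative_error \<epsilon> K(1) K')+
    have Z: "(\<integral>\<^sup>+r\<in>{0..t}. H \<partial>lborel) = ennreal t * H"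
      using t by (simp add: nn_integral_cmult_indicator mult.commute)
    define p' where "p' \<omega> = (\<integral>\<^sup>+r\<in>{0..t}. p \<omega> r \<partial>lborel)" for \<omega>
    define q' where "q' \<omega> = (\<integral>\<^sup>+r\<in>{0..t}. q \<omega> r \<partial>lborel)" for \<omega>
    \<comment> \<open>Measurability in \<open>\<omega>\<close> comes from the finitely many paths of
      the elementary process, without joint measurability in time.\<close>
    have [measurable]: "p' \<in> borel_measurable M"
      using measurable_process_function[OF el[of m], where G = "\<lambda>f. \<integral>\<^sup>+r\<in>{0..t}. (\<Sum>j. ennreal ((norm (B (f r (R (e j)))))\<^sup>2)) \<partial>lborel"]
      unfolding p'_def[abs_def] p_def P_def .
    have [measurable]: "q' \<in> borel_measurable M"
      using measurable_process_function[OF el[of m], where G = "\<lambda>f. \<integral>\<^sup>+r\<in>{0..t}. (\<Sum>j. ennreal ((norm (f r (R (e j)) - S (t - r) (R (e j))))\<^sup>2)) \<partial>lborel"]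
      unfolding q'_def[abs_def] q_def P_def .
    have dist: "integrand_dist_sq M R e t (elementary_process (n m) (\<tau> m) (\<Psi> m)) (\<lambda>r \<omega>. S (t - r)) = (\<integral>\<^sup>+\<omega>. q' \<omega> \<partial>M)"
      by (simp only: integrand_dist_sq_def q'_def q_def P_def)
    have am: "a m = (\<integral>\<^sup>+\<omega>. p' \<omega> \<partial>M)" by (simp only: a_def p'_def p_def)
    have ind: "f * indicator {0..t} r \<le> ?c * (g * indicator {0..t} r) + ?d * (h * indicator {0..t} r)"
      if "f \<le> ?c * g + ?d * h" for f g h and r :: real
      using that by (auto simp: indicator_def)
    have "p' \<omega> \<le> ?c * (ennreal t * H) + ?d * q' \<omega>" "ennreal t * H \<le> ?c * p' \<omega> + ?d * q' \<omega>" for \<omega>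
      unfolding Z[symmetric] p'_def q'_def using pm qm pq
      by (intro nn_integral_linear_bound ind; simp)+
    moreover have "(\<integral>\<^sup>+\<omega>. ennreal t * H \<partial>M) = ennreal t * H" by (simp add: emeasure_space_1)
    ultimately show "a m \<le> ?c * (ennreal t * H) + ?d * integrand_dist_sq M R e t (elementary_process (n m) (\<tau> m) (\<Psi> m)) (\<lambda>r \<omega>. S (t - r))"
      "ennreal t * H \<le> ?c * a m + ?d * integrand_dist_sq M R e t (elementary_process (n m) (\<tau> m) (\<Psi> m)) (\<lambda>r \<omega>. S (t - r))"
      unfolding dist am
      using nn_integral_linear_bound[of M p' ?c "\<lambda>\<omega>. ennreal t * H" ?d q']
        nn_integral_linear_bound[of M "\<lambda>\<omega>. ennreal t * H" ?c p' ?d q'] by simp_all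
  qed
  then have "x \<longlonglongrightarrow> (\<integral>\<^sup>+\<omega>. ennreal ((norm (V \<omega>))\<^sup>2) \<partial>M) + ennreal t * H"
    unfolding xa by (intro tendsto_intros)
  ultimately show ?thesis unfolding H_def by (rule LIMSEQ_unique)
qed

section \<open>The mean energy\<close>

lemma dquot_mean_square:
  assumes S: "schroedinger_group S" and t: "0 \<le> t"
    and I: "is_stochastic_integral M F R e W t (\<lambda>r \<omega>. S (t - r)) I"
    and u: "AE \<omega> in M. u \<omega> = S t (u0 \<omega>) - \<i> *\<^sub>C I \<omega>"
    and u0: "u0 \<in> borel_measurable (F 0)"
    and fin: "(\<integral>\<^sup>+\<omega>. ennreal ((norm (dquot i h (u0 \<omega>)))\<^sup>2) \<partial>M) < \<infinity>"
  shows "(\<integral>\<^sup>+\<omega>. ennreal ((norm (dquot i h (u \<omega>)))\<^sup>2) \<partial>M) = (\<integral>\<^sup>+\<omega>. ennreal ((norm (dquot i h (u0 \<omega>)))\<^sup>2) \<partial>M)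
    + ennreal t * (\<Sum>j. ennreal ((norm (dquot i h (R (e j))))\<^sup>2))"
proof -
  interpret S: schroedinger S by standard (rule S)
  \<comment> \<open>Multiplication by \<open>\<i>\<close> is isometric, commutes with
    \<open>dquot\<close> and turns the term \<open>- \<i> *\<^sub>C I \<omega>\<close> into
    \<open>I \<omega>\<close>, the form required by the isometry.\<close>
  define V where "V \<omega> = \<i> *\<^sub>C dquot i h (S t (u0 \<omega>))" for \<omega>
  have nV: "norm (V \<omega>) = norm (dquot i h (u0 \<omega>))" for \<omega>
    by (simp add: V_def norm_cscale flip: S.S_dquot)
  have wV: "wmeas (F 0) V" unfolding V_def
    by (intro wmeas_bounded_linear[OF bounded_linear_cscale] wmeas_bounded_linear[OF bounded_linear_dquot]
        wmeas_bounded_linear[OF S.bounded_linear_S] wmeas_borel u0)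
  have V: "wL2 (F 0) V" unfolding wL2_def
  proof (intro conjI allI wV)
    fix h'
    have [measurable]: "wmeas M V" using wmeas_F[OF _ wV] by simp
    show "integrable M (\<lambda>\<omega>. (inner (V \<omega>) h')\<^sup>2)"
    proof (rule integrableI_nonneg)
      have "(\<integral>\<^sup>+\<omega>. ennreal ((inner (V \<omega>) h')\<^sup>2) \<partial>M) \<le> (\<integral>\<^sup>+\<omega>. ennreal ((norm h')\<^sup>2) * ennreal ((norm (V \<omega>))\<^sup>2) \<partial>M)"
      proof (rule nn_integral_mono)
        fix \<omega>
        have "(inner (V \<omega>) h')\<^sup>2 \<le> (norm (V \<omega>) * norm h')\<^sup>2"
          using power_mono[OF Cauchy_Schwarz_ineq2[of "V \<omega>" h'], of 2] by simp
        then show "ennreal ((inner (V \<omega>) h')\<^sup>2) \<le> ennreal ((norm h')\<^sup>2) * ennreal ((norm (V \<omega>))\<^sup>2)"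
          by (simp add: ennreal_mult[symmetric] power_mult_distrib mult.commute ennreal_leI)
      qed
      also have "\<dots> = ennreal ((norm h')\<^sup>2) * (\<integral>\<^sup>+\<omega>. ennreal ((norm (V \<omega>))\<^sup>2) \<partial>M)"
        by (intro nn_integral_cmult wmeas_norm) measurable
      also have "\<dots> < \<infinity>" using fin unfolding nV by (simp add: ennreal_mult_less_top)
      finally show "(\<integral>\<^sup>+\<omega>. ennreal ((inner (V \<omega>) h')\<^sup>2) \<partial>M) < \<infinity>" .
    qed auto
  qed
  have "norm (dquot i h (S t (u0 \<omega>) - \<i> *\<^sub>C I \<omega>)) = norm (V \<omega> + dquot i h (I \<omega>))" for \<omega>
  proof -
    have "\<i> *\<^sub>C dquot i h (S t (u0 \<omega>) - \<i> *\<^sub>C I \<omega>) = V \<omega> + dquot i h (I \<omega>)"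
      unfolding linear_diff[OF bounded_linear.linear[OF bounded_linear_dquot]] dquot_cscale V_def cscale_diff_right cscale_cscale
      using cscale_of_real[of "-1" "dquot i h (I \<omega>)"] by simp
    then show ?thesis using norm_cscale[of \<i> "dquot i h (S t (u0 \<omega>) - \<i> *\<^sub>C I \<omega>)"] by simp
  qed
  then have "(\<integral>\<^sup>+\<omega>. ennreal ((norm (dquot i h (u \<omega>)))\<^sup>2) \<partial>M) = (\<integral>\<^sup>+\<omega>. ennreal ((norm (V \<omega> + dquot i h (I \<omega>)))\<^sup>2) \<partial>M)"
    using u by (intro nn_integral_cong_AE) (auto elim: eventually_mono)
  also have "\<dots> = (\<integral>\<^sup>+\<omega>. ennreal ((norm (V \<omega>))\<^sup>2) \<partial>M) + ennreal t * (\<Sum>j. ennreal ((norm (dquot i h (R (e j))))\<^sup>2))"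
    by (rule stochastic_integral_isometry[OF S t I V bounded_linear_dquot]) (rule S.S_dquot[symmetric])
  finally show ?thesis unfolding nV .
qed

section \<open>From difference quotients to the mean energy\<close>

definition dquot_energy :: "nat \<Rightarrow> 'd L2 \<Rightarrow> ennreal" where
  "dquot_energy n v = (\<Sum>i\<in>UNIV. ennreal ((norm (dquot i (dyadic n) v))\<^sup>2))"

lemma grad_norm_sq_dquot_energy: "grad_norm_sq v = (SUP n. dquot_energy n v)"
  by (simp add: dquot_energy_def grad_norm_sq_SUP)

lemma incseq_dquot_energy: "incseq (\<lambda>n. dquot_energy n v)"
  unfolding dquot_energy_def by (rule incseq_dquot_sum)

lemma measurable_norm_dquot:
  fixes v :: "'a \<Rightarrow> 'd L2"
  shows "v \<in> borel_measurable M \<Longrightarrow> (\<lambda>\<omega>. ennreal ((norm (dquot i h (v \<omega>)))\<^sup>2)) \<in> borel_measurable M"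
  by (intro wmeas_norm wmeas_bounded_linear[OF bounded_linear_dquot] wmeas_borel)

lemma measurable_dquot_energy:
  "v \<in> borel_measurable M \<Longrightarrow> (\<lambda>\<omega>. dquot_energy n (v \<omega>)) \<in> borel_measurable M"
  unfolding dquot_energy_def by (intro borel_measurable_sum measurable_norm_dquot)

text \<open>\<open>grad_norm_sq\<close> is defined by a case distinction on existence; its form as
  an increasing supremum of measurable functions is what admits monotone convergence.\<close>

lemma nn_integral_grad_norm_sq:
  fixes v :: "'a \<Rightarrow> 'd L2"
  assumes "v \<in> borel_measurable M"
  shows "(\<integral>\<^sup>+\<omega>. grad_norm_sq (v \<omega>) \<partial>M) = (SUP n. \<integral>\<^sup>+\<omega>. dquot_energy n (v \<omega>) \<partial>M)"
  unfolding grad_norm_sq_dquot_energy using measurable_dquot_energy[OF assms] incseq_dquot_energy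
  by (intro nn_integral_monotone_convergence_SUP) (auto simp: incseq_def le_fun_def)

lemma nn_integral_energy:
  fixes v :: "'a \<Rightarrow> 'd L2"
  assumes "v \<in> borel_measurable M"
  shows "(\<integral>\<^sup>+\<omega>. energy (v \<omega>) \<partial>M) = ennreal (1/2) * (\<integral>\<^sup>+\<omega>. grad_norm_sq (v \<omega>) \<partial>M)"
  unfolding energy_def grad_norm_sq_dquot_energy using measurable_dquot_energy[OF assms]
  by (intro nn_integral_cmult borel_measurable_SUP) auto

lemma mean_grad_norm_sq:
  assumes S: "schroedinger_group S" and t: "0 \<le> t"
    and I: "is_stochastic_integral M F R e W t (\<lambda>r \<omega>. S (t - r)) I"
    and u: "AE \<omega> in M. u \<omega> = S t (u0 \<omega>) - \<i> *\<^sub>C I \<omega>" and um: "u \<in> borel_measurable M"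
    and u0: "u0 \<in> borel_measurable (F 0)"
    and fin: "(\<integral>\<^sup>+\<omega>. grad_norm_sq (u0 \<omega>) \<partial>M) < \<infinity>"
  shows "(\<integral>\<^sup>+\<omega>. grad_norm_sq (u \<omega>) \<partial>M) = (\<integral>\<^sup>+\<omega>. grad_norm_sq (u0 \<omega>) \<partial>M) + ennreal t * grad_HS_sq R e"
proof -
  have u0m: "u0 \<in> borel_measurable M" using F_meas[OF order_refl] u0 measurable_from_subalg[OF subalgebra_F] by blast
  have n: "(\<integral>\<^sup>+\<omega>. dquot_energy n (u \<omega>) \<partial>M) = (\<integral>\<^sup>+\<omega>. dquot_energy n (u0 \<omega>) \<partial>M) + ennreal t * (\<Sum>j. dquot_energy n (R (e j)))" for n
  proof -
    \<comment> \<open>Each quotient in one direction is dominated by the full gradient, so the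
      finite mean for \<open>u0\<close> supplies the finiteness hypothesis of
      \<open>dquot_mean_square\<close>.\<close>
    have le: "ennreal ((norm (dquot i (dyadic n) v))\<^sup>2) \<le> grad_norm_sq v" for i and v :: "'d L2"
    proof -
      have "f i \<le> sum f UNIV" for f :: "'d \<Rightarrow> ennreal" by (intro member_le_sum) auto
      then have "ennreal ((norm (dquot i (dyadic n) v))\<^sup>2) \<le> dquot_energy n v" unfolding dquot_energy_def .
      also have "\<dots> \<le> grad_norm_sq v" unfolding grad_norm_sq_dquot_energy by (rule SUP_upper) simp
      finally show ?thesis .
    qed
    have "(\<integral>\<^sup>+\<omega>. ennreal ((norm (dquot i (dyadic n) (u0 \<omega>)))\<^sup>2) \<partial>M) < \<infinity>" for i
      using fin le by (meson nn_integral_mono le_less_trans)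
    note step = dquot_mean_square[OF S t I u u0 this]
    have "(\<integral>\<^sup>+\<omega>. dquot_energy n (u \<omega>) \<partial>M) = (\<Sum>i\<in>UNIV. \<integral>\<^sup>+\<omega>. ennreal ((norm (dquot i (dyadic n) (u \<omega>)))\<^sup>2) \<partial>M)"
      unfolding dquot_energy_def by (intro nn_integral_sum measurable_norm_dquot um)
    also have "\<dots> = (\<Sum>i\<in>UNIV. \<integral>\<^sup>+\<omega>. ennreal ((norm (dquot i (dyadic n) (u0 \<omega>)))\<^sup>2) \<partial>M)
        + ennreal t * (\<Sum>i\<in>UNIV. \<Sum>j. ennreal ((norm (dquot i (dyadic n) (R (e j))))\<^sup>2))"
      unfolding step by (simp only: sum.distrib sum_distrib_left)
    also have "(\<Sum>i\<in>UNIV. \<integral>\<^sup>+\<omega>. ennreal ((norm (dquot i (dyadic n) (u0 \<omega>)))\<^sup>2) \<partial>M) = (\<integral>\<^sup>+\<omega>. dquot_energy n (u0 \<omega>) \<partial>M)"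
      unfolding dquot_energy_def by (intro nn_integral_sum[symmetric] measurable_norm_dquot u0m)
    also have "(\<Sum>i\<in>UNIV. \<Sum>j. ennreal ((norm (dquot i (dyadic n) (R (e j))))\<^sup>2)) = (\<Sum>j. dquot_energy n (R (e j)))"
      unfolding dquot_energy_def by (intro suminf_sum[symmetric] summableI)
    finally show ?thesis .
  qed
  have inc0: "incseq (\<lambda>n. \<integral>\<^sup>+\<omega>. dquot_energy n (u0 \<omega>) \<partial>M)"
    using incseq_dquot_energy by (auto simp: incseq_def intro!: nn_integral_mono)
  have inc1: "incseq (\<lambda>n. ennreal t * (\<Sum>j. dquot_energy n (R (e j))))"
    using incseq_dquot_energy by (auto simp: incseq_def intro!: mult_left_mono suminf_le)
  have "(\<integral>\<^sup>+\<omega>. grad_norm_sq (u \<omega>) \<partial>M) = (SUP n. (\<integral>\<^sup>+\<omega>. dquot_energy n (u0 \<omega>) \<partial>M) + ennreal t * (\<Sum>j. dquot_energy n (R (e j))))"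
    unfolding nn_integral_grad_norm_sq[OF um] n ..
  also have "\<dots> = (SUP n. \<integral>\<^sup>+\<omega>. dquot_energy n (u0 \<omega>) \<partial>M) + (SUP n. ennreal t * (\<Sum>j. dquot_energy n (R (e j))))"
    by (rule ennreal_SUP_add[OF inc0 inc1])
  also have "(SUP n. ennreal t * (\<Sum>j. dquot_energy n (R (e j)))) = ennreal t * (SUP n. \<Sum>j. dquot_energy n (R (e j)))"
    by (rule SUP_mult_left_ennreal[symmetric])
  also have "(SUP n. \<Sum>j. dquot_energy n (R (e j))) = grad_HS_sq R e"
    unfolding grad_HS_sq_def grad_norm_sq_dquot_energy
    by (intro ennreal_suminf_SUP_eq[symmetric] incseq_dquot_energy)
  also have "(SUP n. \<integral>\<^sup>+\<omega>. dquot_energy n (u0 \<omega>) \<partial>M) = (\<integral>\<^sup>+\<omega>. grad_norm_sq (u0 \<omega>) \<partial>M)"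
    by (rule nn_integral_grad_norm_sq[OF u0m, symmetric])
  finally show ?thesis .
qed

end

theorem proposition3p7:
  fixes M :: "'a measure" and F :: "real \<Rightarrow> 'a measure"
    and Q R :: "'d::finite L2 \<Rightarrow> 'd L2" and e :: "nat \<Rightarrow> 'd L2"
    and W :: "real \<Rightarrow> 'a \<Rightarrow> 'd L2" and S :: "real \<Rightarrow> 'd L2 \<Rightarrow> 'd L2"
    and u0 :: "'a \<Rightarrow> 'd L2" and u :: "real \<Rightarrow> 'a \<Rightarrow> 'd L2"
  assumes "prob_space M" and "normal_filtration M F"
    and "nonneg_selfadjoint Q" and "trace_class Q" and "is_op_sqrt R Q"
    and "orthonormal_basis e"
    and "Q_wiener M F Q W"
    and "schroedinger_group S"
    and "u0 \<in> borel_measurable (F 0)"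
    and "mild_solution M F R e W S u0 u"
    and "(\<integral>\<^sup>+\<omega>. energy (u0 \<omega>) \<partial>M) < \<infinity>"
    and "grad_HS_sq R e < \<infinity>"
  shows "\<forall>t\<ge>0. (\<integral>\<^sup>+\<omega>. energy (u t \<omega>) \<partial>M)
           = (\<integral>\<^sup>+\<omega>. energy (u0 \<omega>) \<partial>M) + ennreal (t / 2) * grad_HS_sq R e"
proof (intro allI impI)
  fix t :: real assume t: "0 \<le> t"
  interpret prob_space M by fact
  interpret onb e by standard fact
  interpret wiener_setup M e F Q R W by standard fact+
  obtain I where um: "u t \<in> borel_measurable M"
    and I: "is_stochastic_integral M F R e W t (\<lambda>r \<omega>. S (t - r)) I"
    and u: "AE \<omega> in M. u t \<omega> = S t (u0 \<omega>) - \<i> *\<^sub>C I \<omega>"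
    using \<open>mild_solution M F R e W S u0 u\<close> t unfolding mild_solution_def by blast
  have u0m: "u0 \<in> borel_measurable M" by (rule F_meas[OF order_refl]) fact
  have fin: "(\<integral>\<^sup>+\<omega>. grad_norm_sq (u0 \<omega>) \<partial>M) < \<infinity>"
    using \<open>(\<integral>\<^sup>+\<omega>. energy (u0 \<omega>) \<partial>M) < \<infinity>\<close> unfolding nn_integral_energy[OF u0m]
    by (auto simp: ennreal_mult_less_top)
  have half: "ennreal (1/2) * (ennreal t * x) = ennreal (t / 2) * x" for x
  proof -
    have "ennreal (1/2) * ennreal t = ennreal (t / 2)" using t by (subst ennreal_mult[symmetric]) auto
    then show ?thesis by (simp only: mult.assoc[symmetric])
  qed
  show "(\<integral>\<^sup>+\<omega>. energy (u t \<omega>) \<partial>M) = (\<integral>\<^sup>+\<omega>. energy (u0 \<omega>) \<partial>M) + ennreal (t / 2) * grad_HS_sq R e"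
    unfolding nn_integral_energy[OF um] nn_integral_energy[OF u0m]
      mean_grad_norm_sq[OF \<open>schroedinger_group S\<close> t I u um \<open>u0 \<in> borel_measurable (F 0)\<close> fin]
    by (simp only: distrib_left half)
qed

end
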